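(* Let $s\in(0,1)$, $N>2s$, $2^*=\frac{2N}{N-2s}$, $p\ge 2^*-1$ and $q>(p-1)\frac{N}{2s}-1$ (in particular $q>p$). Let $u$ be any weak solution of $$(-\Delta)^s u=u^p-u^q\ \text{ in }\mathbb{R}^N,\quad u\in\dot H^s(\mathbb{R}^N)\cap L^{q+1}(\mathbb{R}^N),\quad u>0\ \text{ in }\mathbb{R}^N.$$ Then $u$ is radially symmetric and strictly decreasing about some point in $\mathbb{R}^N$.
   Context: $c_{N,s}=\frac{2^{2s}s\,\Gamma(\frac N2+s)}{\pi^{N/2}\Gamma(1-s)}$. Set $\|u\|^2_{\dot H^s(\mathbb{R}^N)}=\frac{c_{N,s}}{2}\int_{\mathbb{R}^N}\int_{\mathbb{R}^N}\frac{|u(x)-u(y)|^2}{|x-y|^{N+2s}}\,dx\,dy$; $\dot H^s(\mathbb{R}^N)$ is the completion of $C_0^\infty(\mathbb{R}^N)$ with respect to $\|u\|_{\dot H^s(\mathbb{R}^N)}+|u|_{L^{2^*}(\mathbb{R}^N)}$. A weak solution of the problem is a function $u\in\dot H^s(\mathbb{R}^N)\cap L^{q+1}(\mathbb{R}^N)$ with $u>0$ in $\mathbb{R}^N$ such that for every $\varphi\in\dot H^s(\mathbb{R}^N)$ $$\frac{c_{N,s}}{2}\int_{\mathbb{R}^N}\int_{\mathbb{R}^N}\frac{(u(x)-u(y))(\varphi(x)-\varphi(y))}{|x-y|^{N+2s}}\,dx\,dy=\int_{\mathbb{R}^N}u^p\varphi\,dx-\int_{\mathbb{R}^N}u^q\varphi\,dx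 .$$ As usual, $u$ is identified with its continuous representative. *)

theory Defs
  imports "HOL-Analysis.Analysis"
begin

text \<open>
  Euclidean space of dimension \<open>N\<close> is an arbitrary type of class \<open>euclidean_space\<close>, with
  \<open>N = DIM('a)\<close>. An element of one of the function spaces below is given by a Borel
  representative; every almost-everywhere class of Lebesgue measurable functions has one.
\<close>

definition frac_const :: "nat \<Rightarrow> real \<Rightarrow> real" where
  "frac_const N s =
     (2 powr (2 * s) * s * Gamma (real N / 2 + s)) / (pi powr (real N / 2) * Gamma (1 - s))"

definition crit_exp :: "nat \<Rightarrow> real \<Rightarrow> real" where
  "crit_exp N s = 2 * real N / (real N - 2 * s)"

fun Ck :: "nat \<Rightarrow> ('a::euclidean_space \<Rightarrow> real) \<Rightarrow> bool" where
  "Ck 0 f \<longleftrightarrow> continuous_on UNIV f"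
| "Ck (Suc k) f \<longleftrightarrow>
     (\<forall>x. f differentiable (at x)) \<and>
     (\<forall>b\<in>Basis. Ck k (\<lambda>x. frechet_derivative f (at x) b))"

definition test_function :: "('a::euclidean_space \<Rightarrow> real) \<Rightarrow> bool" where
  "test_function f \<longleftrightarrow> (\<forall>k. Ck k f) \<and> compact (closure {x. f x \<noteq> 0})"

definition in_Lp :: "real \<Rightarrow> ('a::euclidean_space \<Rightarrow> real) \<Rightarrow> bool" where
  "in_Lp r f \<longleftrightarrow> f \<in> borel_measurable borel \<and> integrable lborel (\<lambda>x. \<bar>f x\<bar> powr r)"

definition Lp_norm :: "real \<Rightarrow> ('a::euclidean_space \<Rightarrow> real) \<Rightarrow> real" where
  "Lp_norm r f = (\<integral>x. \<bar>f x\<bar> powr r \<partial>lborel) powr (1 / r)"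

text \<open>
  The integrands below are \<open>0\<close> on the diagonal, by the convention \<open>a / 0 = 0\<close>; the diagonal
  is a null set.
\<close>

definition frac_form :: "real \<Rightarrow> ('a::euclidean_space \<Rightarrow> real) \<Rightarrow> ('a \<Rightarrow> real) \<Rightarrow> real" where
  "frac_form s u \<phi> =
     frac_const DIM('a) s / 2 *
     (\<integral>(x, y). (u x - u y) * (\<phi> x - \<phi> y) / norm (x - y) powr (real DIM('a) + 2 * s)
        \<partial>(lborel \<Otimes>\<^sub>M lborel))"

definition finite_frac_energy :: "real \<Rightarrow> ('a::euclidean_space \<Rightarrow> real) \<Rightarrow> bool" where
  "finite_frac_energy s u \<longleftrightarrow>
     integrable (lborel \<Otimes>\<^sub>M lborel)
       (\<lambda>(x, y). \<bar>u x - u y\<bar>\<^sup>2 / norm (x - y) powr (real DIM('a) + 2 * s))"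

definition dotH_norm :: "real \<Rightarrow> ('a::euclidean_space \<Rightarrow> real) \<Rightarrow> real" where
  "dotH_norm s u =
     sqrt (frac_const DIM('a) s / 2 *
       (\<integral>(x, y). \<bar>u x - u y\<bar>\<^sup>2 / norm (x - y) powr (real DIM('a) + 2 * s)
          \<partial>(lborel \<Otimes>\<^sub>M lborel)))"

text \<open>
  The completion of the test functions with respect to the sum of the two norms, realised as a
  space of functions: since the \<open>L\<close>-norm with exponent \<open>crit_exp\<close> is part of the norm and
  \<open>L\<^sup>2\<close> of the weighted product measure is complete, every Cauchy sequence of test functions
  converges in this norm to a function, unique almost everywhere. The finiteness conditions
  ensure that the Bochner integrals in the norms are genuine.
\<close>

definition dotH :: "real \<Rightarrow> ('a::euclidean_space \<Rightarrow> real) \<Rightarrow> bool" where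
  "dotH s u \<longleftrightarrow>
     in_Lp (crit_exp DIM('a) s) u \<and> finite_frac_energy s u \<and>
     (\<exists>\<psi> :: nat \<Rightarrow> 'a \<Rightarrow> real. (\<forall>n. test_function (\<psi> n)) \<and>
        (\<lambda>n. dotH_norm s (\<lambda>x. u x - \<psi> n x)
             + Lp_norm (crit_exp DIM('a) s) (\<lambda>x. u x - \<psi> n x)) \<longlonglongrightarrow> 0)"

text \<open>
  The two integrability conditions say that the integrals on the right-hand side of the weak
  formulation exist; the one on the left exists by the Cauchy-Schwarz inequality.
\<close>

definition weak_solution ::
    "real \<Rightarrow> real \<Rightarrow> real \<Rightarrow> ('a::euclidean_space \<Rightarrow> real) \<Rightarrow> bool" where
  "weak_solution s p q u \<longleftrightarrow>
     dotH s u \<and> in_Lp (q + 1) u \<and> (\<forall>x. 0 < u x) \<and>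
     (\<forall>\<phi>. dotH s \<phi> \<longrightarrow>
        integrable lborel (\<lambda>x. u x powr p * \<phi> x) \<and>
        integrable lborel (\<lambda>x. u x powr q * \<phi> x) \<and>
        frac_form s u \<phi> =
          (\<integral>x. u x powr p * \<phi> x \<partial>lborel) - (\<integral>x. u x powr q * \<phi> x \<partial>lborel))"

definition radially_strictly_decreasing_about ::
    "'a::euclidean_space \<Rightarrow> ('a \<Rightarrow> real) \<Rightarrow> bool" where
  "radially_strictly_decreasing_about x0 u \<longleftrightarrow>
     (\<exists>g :: real \<Rightarrow> real. (\<forall>x. u x = g (norm (x - x0))) \<and> strict_antimono_on {0..} g)"

end

theory Submission
  imports Defs
begin

text \<open>
  Testing the equation with \<open>(u - 1)\<^sup>+\<close> gives \<open>u \<le> 1\<close>, because \<open>p < q\<close>; the right-hand side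
  \<open>f u = u\<^sup>p - u\<^sup>q\<close> is then bounded. Hoelder continuity follows by doubling variables in the
  second-difference form of the equation satisfied by the mollifications of \<open>u\<close>.

  Symmetry is proved by moving planes in energy form. For a reflection \<open>R\<close> in a hyperplane, test
  the equation for \<open>u - u \<circ> R\<close> with its positive part \<open>w\<close> in the half-space. Since
  \<open>f a - f b \<le> p a\<^sup>p\<^sup>-\<^sup>1 (a - b)\<close> for \<open>b < a \<le> 1\<close>, where the exponent \<open>p - 1\<close> is at least \<open>2\<^sup>* - 2\<close>,
  the inequalities of Hoelder and Sobolev force \<open>w = 0\<close> as soon as the integral of \<open>u\<close> to the
  power \<open>2\<^sup>*\<close> over \<open>{w > 0}\<close> is small. This starts the procedure at infinity and, together with
  the strong maximum principle, shows that \<open>u\<close> is symmetric at the critical position.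
  The critical planes of all directions pass through one point, so \<open>u\<close> is radially
  nonincreasing, and the strong maximum principle for the planes beyond the center makes the
  monotonicity strict.
\<close>

section \<open>Measure-preserving maps and the kernel\<close>

text \<open>A weak solution is only an almost-everywhere class of finite energy, so no pointwise
  values of the operator are at hand, and it is not obvious that the tests \<open>(u - 1)^+\<close>
  and \<open>w\<close> lie in \<open>dotH\<close>. The way around is to truncate Lipschitz
  approximants of \<open>u\<close> instead of \<open>u\<close>. The truncations are admissible
  tests, and a uniform energy bound with almost-everywhere convergence lets both sides of the
  equation pass to the limit, the Sobolev inequality turning the energy bound into one in the
  critical Lebesgue space. The right-hand side must then grow at most like
  \<open>u powr (r - 1)\<close> with \<open>r\<close> the critical exponent, which
  \<open>u \<le> 1\<close> provides; the first test, made before that bound is known, discards the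
  region \<open>1 \<le> u\<close> by its sign. Continuity turns integral statements into pointwise
  comparisons across a plane, and uniform continuity gives decay at infinity. The nonlocal kernel
  enters the comparison through one fact: two points on the same side of a plane are closer to each
  other than one of them is to the mirror image of the other.\<close>

lemma vimage_involution:
  assumes "\<And>x. T (T x) = x"
  shows "T -` A = T ` A"
  using assms by (metis (no_types, lifting) image_iff subsetI subset_antisym vimage_eq)

text \<open>Balls go to balls of the same radius, and Vitali's theorem fills an open set up to a
  null set with countably many disjoint balls; the null remainder stays null because the map is
  Lipschitz. The type is arbitrary, so maps of the product space \<open>'a \<times> 'a\<close> are
  covered too.\<close>

lemma distr_isometric_involution:
  fixes T :: "'a::euclidean_space \<Rightarrow> 'a"
  assumes inv: "\<And>x. T (T x) = x" and iso: "\<And>x y. dist (T x) (T y) = dist x y"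
  shows "distr lborel borel T = lborel"
proof -
  have cont: "continuous_on UNIV T"
    unfolding continuous_on_iff using iso by metis
  then have [measurable]: "T \<in> borel_measurable borel"
    by (rule borel_measurable_continuous_onI)
  have ball: "T -` ball a r = ball (T a) r" for a r
  proof -
    have "dist a (T x) = dist (T a) x" for x using iso[of a "T x"] by (simp add: inv)
    then show ?thesis by (auto simp: ball_def)
  qed
  have op: "emeasure lborel (T -` U) = emeasure lborel U" if U: "open U" for U
  proof -
    define K where "K = {(a, r). 0 < r \<and> ball a r \<subseteq> U}"
    have ex: "\<exists>i. i \<in> K \<and> x \<in> ball (fst i) (snd i) \<and> snd i < d" if "x \<in> U" "0 < d" for x d
    proof -
      obtain e where "e > 0" "ball x e \<subseteq> U" using U \<open>x \<in> U\<close> openE by blast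
      then show ?thesis using \<open>0 < d\<close>
        by (intro exI[of _ "(x, min e (d/2))"]) (auto simp: K_def)
    qed
    obtain C where C: "countable C" "C \<subseteq> K"
        "pairwise (\<lambda>i j. disjnt (ball (fst i) (snd i)) (ball (fst j) (snd j))) C"
        "negligible (U - (\<Union>i\<in>C. ball (fst i) (snd i)))"
      by (rule Vitali_covering_theorem_balls[where S=U and K=K and a=fst and r=snd, OF ex])
    let ?V = "\<Union>i\<in>C. ball (fst i) (snd i)"
    have VU: "?V \<subseteq> U" 
    proof safe
      fix x a b assume "(a, b) \<in> C" "x \<in> ball (fst (a, b)) (snd (a, b))"
      then show "x \<in> U" using C(2) unfolding K_def by (metis (no_types, lifting) case_prodD fst_conv mem_Collect_eq snd_conv subsetD)
    qed
    have dj: "disjoint_family_on (\<lambda>i. ball (fst i) (snd i)) C"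
      using C(3) by (auto simp: disjoint_family_on_def pairwise_def disjnt_def)
    then have dj': "disjoint_family_on (\<lambda>i. T -` ball (fst i) (snd i)) C"
      unfolding disjoint_family_on_def by blast
    have sm: "T -` ball a r \<in> sets borel" for a r by (simp add: ball)
    have null: "emeasure lborel W = emeasure lborel (W \<inter> V)"
      if "negligible (W - V)" "W \<in> sets borel" "V \<in> sets borel" for W V :: "'a set"
    proof -
      have "W - V \<in> null_sets lborel"
        using that by (auto simp: negligible_iff_null_sets null_sets_completion_iff)
      then have "emeasure lborel ((W \<inter> V) \<union> (W - V)) = emeasure lborel (W \<inter> V)"
        using that by (intro emeasure_Un_null_set) auto
      then show ?thesis by (simp add: Int_Diff_Un)
    qed
    have Vm: "?V \<in> sets borel" by (intro borel_open open_UN) auto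
    have neg': "negligible (T -` U - T -` ?V)"
    proof -
      have "negligible (T ` (U - ?V))"
      proof (rule negligible_locally_Lipschitz_image[OF _ C(4)])
        fix x assume "x \<in> U - ?V"
        show "\<exists>W B. open W \<and> x \<in> W \<and> (\<forall>y\<in>(U - ?V) \<inter> W. norm (T y - T x) \<le> B * norm (y - x))"
          by (intro exI[of _ UNIV] exI[of _ 1]) (metis Int_UNIV_right UNIV_I dist_norm iso mult_1 open_UNIV order_refl)
      qed simp
      moreover have "T -` U - T -` ?V = T ` (U - ?V)"
        using vimage_involution[OF inv, of "U - ?V"] by (simp add: vimage_Diff)
      ultimately show ?thesis by simp
    qed
    have "emeasure lborel U = emeasure lborel ?V"
      using null[OF C(4) borel_open[OF U] Vm] VU by (simp add: Int_absorb1)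
    also have "\<dots> = (\<integral>\<^sup>+i. emeasure lborel (ball (fst i) (snd i)) \<partial>count_space C)"
      using C(1) dj by (intro emeasure_UN_countable) auto
    also have "\<dots> = (\<integral>\<^sup>+i. emeasure lborel (T -` ball (fst i) (snd i)) \<partial>count_space C)"
      using C(2) by (intro nn_integral_cong) (auto simp: ball K_def emeasure_ball less_imp_le)
    also have "\<dots> = emeasure lborel (\<Union>i\<in>C. T -` ball (fst i) (snd i))"
      using C(1) dj' sm by (intro emeasure_UN_countable[symmetric]) auto
    also have "(\<Union>i\<in>C. T -` ball (fst i) (snd i)) = T -` ?V" by auto
    also have "emeasure lborel (T -` ?V) = emeasure lborel (T -` U)"
    proof -
      have "T -` U \<in> sets borel" "T -` ?V \<in> sets borel"
        using open_vimage[OF U cont] open_vimage[OF _ cont, of ?V] by (auto intro!: borel_open)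
      from null[OF neg' this] show ?thesis using VU by (simp add: Int_absorb1 vimage_mono)
    qed
    finally show ?thesis by simp
  qed
  show ?thesis
  proof (rule measure_eqI_generator_eq[where E="Collect open" and \<Omega>=UNIV and A="\<lambda>i. ball 0 (real i)"])
    show "Int_stable (Collect open)" by (auto simp: Int_stable_def)
    show "sets (distr lborel borel T) = sigma_sets UNIV (Collect open)"
      by (simp add: sets_borel)
    show "sets lborel = sigma_sets UNIV (Collect (open :: 'a set \<Rightarrow> bool))"
      by (simp add: sets_borel)
    show "(\<Union>i. ball (0::'a) (real i)) = UNIV"
    proof (intro set_eqI iffI)
      fix x :: 'a
      obtain n :: nat where "norm x < real n" using reals_Archimedean2 by blast
      then show "x \<in> (\<Union>i. ball 0 (real i))" by (intro UN_I[of n]) auto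
    qed simp
    show "emeasure (distr lborel borel T) (ball 0 (real i)) \<noteq> \<infinity>" for i
      using op[of "ball 0 (real i)"] by (simp add: emeasure_distr emeasure_ball)
  qed (auto simp: emeasure_distr op)
qed

abbreviation lborel2 :: "('a::euclidean_space \<times> 'a) measure" where
  "lborel2 \<equiv> lborel \<Otimes>\<^sub>M lborel"

lemma space_lborel2 [simp]: "space lborel2 = UNIV"
  by (simp add: space_pair_measure)

lemma nn_integral_lborel_translate:
  fixes f :: "'a::euclidean_space \<Rightarrow> ennreal"
  assumes [measurable]: "f \<in> borel_measurable borel"
  shows "(\<integral>\<^sup>+x. f (c + x) \<partial>lborel) = (\<integral>\<^sup>+x. f x \<partial>lborel)"
proof -
  have "(\<integral>\<^sup>+x. f x \<partial>lborel) = (\<integral>\<^sup>+x. f x \<partial>distr lborel borel ((+) c))"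
    by (simp add: lborel_distr_plus)
  also have "\<dots> = (\<integral>\<^sup>+x. f (c + x) \<partial>lborel)"
    by (rule nn_integral_distr) auto
  finally show ?thesis by simp
qed

lemma measure_preserving_integral:
  fixes f :: "'a \<Rightarrow> real"
  assumes "distr M M T = M" and [measurable]: "T \<in> measurable M M"
    and [measurable]: "f \<in> borel_measurable M"
  shows "integrable M (\<lambda>x. f (T x)) \<longleftrightarrow> integrable M f"
    and "(\<integral>x. f (T x) \<partial>M) = (\<integral>x. f x \<partial>M)"
    and "(\<integral>\<^sup>+x. ennreal (f (T x)) \<partial>M) = (\<integral>\<^sup>+x. ennreal (f x) \<partial>M)"
proof -
  have "integrable M f \<longleftrightarrow> integrable (distr M M T) f" by (simp add: assms(1))
  also have "\<dots> \<longleftrightarrow> integrable M (\<lambda>x. f (T x))" by (rule integrable_distr_eq) auto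
  finally show "integrable M (\<lambda>x. f (T x)) \<longleftrightarrow> integrable M f" by simp
  have "(\<integral>x. f x \<partial>M) = (\<integral>x. f x \<partial>distr M M T)" by (simp add: assms(1))
  also have "\<dots> = (\<integral>x. f (T x) \<partial>M)" by (rule integral_distr) auto
  finally show "(\<integral>x. f (T x) \<partial>M) = (\<integral>x. f x \<partial>M)" by simp
  have "(\<integral>\<^sup>+x. ennreal (f x) \<partial>M) = (\<integral>\<^sup>+x. ennreal (f x) \<partial>distr M M T)" by (simp add: assms(1))
  also have "\<dots> = (\<integral>\<^sup>+x. ennreal (f (T x)) \<partial>M)" by (rule nn_integral_distr) auto
  finally show "(\<integral>\<^sup>+x. ennreal (f (T x)) \<partial>M) = (\<integral>\<^sup>+x. ennreal (f x) \<partial>M)" by simp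
qed

lemma distr_translate_lborel: "distr lborel lborel ((+) c) = (lborel :: 'a::euclidean_space measure)"
proof -
  have "distr lborel lborel ((+) c) = distr lborel borel ((+) c)"
    by (rule distr_cong) auto
  then show ?thesis by (simp add: lborel_distr_plus)
qed

text \<open>Substitution \<open>y = x + h\<close> in a double integral. It later allows the energy
  form to be integrated over the base point first, with the increment \<open>h\<close>
  frozen.\<close>

lemma distr_shear_lborel2:
  "distr lborel2 lborel2 (\<lambda>(x, h). (x, x + h)) = (lborel2 :: ('a::euclidean_space \<times> 'a) measure)"
proof (rule measure_eqI)
  fix A :: "('a \<times> 'a) set" assume "A \<in> sets (distr lborel2 lborel2 (\<lambda>(x, h). (x, x + h)))"
  then have A[measurable]: "A \<in> sets (borel \<Otimes>\<^sub>M borel)" by simp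
  have "emeasure (distr lborel2 lborel2 (\<lambda>(x, h). (x, x + h))) A = (\<integral>\<^sup>+p. indicator A p \<partial>distr lborel2 lborel2 (\<lambda>(x, h). (x, x + h)))"
    by (simp)
  also have "\<dots> = (\<integral>\<^sup>+p. indicator A (case p of (x, h) \<Rightarrow> (x, x + h)) \<partial>lborel2)"
    by (subst nn_integral_distr) (auto)
  also have "\<dots> = (\<integral>\<^sup>+x. \<integral>\<^sup>+h. indicator A (x, x + h) \<partial>lborel \<partial>lborel)"
    by (subst lborel.nn_integral_fst[symmetric]) auto
  also have "\<dots> = (\<integral>\<^sup>+x. \<integral>\<^sup>+h. indicator A (x, h) \<partial>lborel \<partial>lborel)"
    by (intro nn_integral_cong nn_integral_lborel_translate) auto
  also have "\<dots> = (\<integral>\<^sup>+p. indicator A p \<partial>lborel2)"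
    by (subst lborel.nn_integral_fst[symmetric]) auto
  also have "\<dots> = emeasure lborel2 A" by simp
  finally show "emeasure (distr lborel2 lborel2 (\<lambda>(x, h). (x, x + h))) A = emeasure lborel2 A" .
qed simp

text \<open>Each coordinate may be reflected alone, which is what folding a double integral onto a
  half-space requires.\<close>

lemma distr_isometric_involution2:
  fixes T :: "'a::euclidean_space \<Rightarrow> 'a"
  assumes inv: "\<And>x. T (T x) = x" and iso: "\<And>x y. dist (T x) (T y) = dist x y"
  shows "distr lborel lborel T = lborel" "T \<in> measurable borel borel"
    "distr lborel2 lborel2 (\<lambda>(x, y). (T x, y)) = lborel2"
    "distr lborel2 lborel2 (\<lambda>(x, y). (x, T y)) = lborel2"
    "distr lborel2 lborel2 (\<lambda>(x, y). (T x, T y)) = lborel2"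
proof -
  have [measurable]: "T \<in> borel_measurable borel"
    by (rule borel_measurable_continuous_onI) (use iso in \<open>unfold continuous_on_iff, metis\<close>)
  then show "T \<in> measurable borel borel" .
  have "distr lborel lborel T = distr lborel borel T"
    by (rule distr_cong) auto
  then show "distr lborel lborel T = lborel" by (simp add: distr_isometric_involution[OF assms])
  have *: "distr lborel2 lborel2 S = lborel2"
    if S: "\<And>x. S (S x) = x" "\<And>x y. dist (S x) (S y) = dist x y" for S :: "'a \<times> 'a \<Rightarrow> 'a \<times> 'a"
  proof -
    have "distr lborel2 lborel2 S = distr lborel borel S"
      unfolding lborel_prod by (rule distr_cong) auto
    then show ?thesis by (simp add: distr_isometric_involution[OF S] lborel_prod)
  qed
  show "distr lborel2 lborel2 (\<lambda>(x, y). (T x, y)) = lborel2"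
    "distr lborel2 lborel2 (\<lambda>(x, y). (x, T y)) = lborel2"
    "distr lborel2 lborel2 (\<lambda>(x, y). (T x, T y)) = lborel2"
    by (rule *; auto simp: inv iso dist_prod_def)+
qed

section \<open>The singular kernel and its integrability\<close>

text \<open>Since \<open>0 powr a = 0\<close> and \<open>1 / 0 = 0\<close>, the value at the origin
  is \<open>0\<close>, the smallest and not the largest one. Comparisons of kernel values therefore
  exclude coinciding points.\<close>

definition ker :: "real \<Rightarrow> 'a::euclidean_space \<Rightarrow> real" where
  "ker s h = 1 / norm h powr (real DIM('a) + 2 * s)"

lemma ker_nonneg [simp]: "0 \<le> ker s h"
  by (simp add: ker_def)

lemma ker_minus [simp]: "ker s (- h) = ker s h"
  by (simp add: ker_def)

lemma ker_commute: "ker s (x - y) = ker s (y - x)"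
  by (simp add: ker_def norm_minus_commute)

lemma ker_measurable [measurable]: "ker s \<in> borel_measurable borel"
  unfolding ker_def by measurable

lemma ker_strict_mono:
  fixes h h' :: "'a::euclidean_space"
  shows "0 < norm h \<Longrightarrow> norm h < norm h' \<Longrightarrow> 0 < s \<Longrightarrow> ker s h' < ker s h"
  unfolding ker_def by (intro divide_strict_left_mono powr_less_mono2 mult_pos_pos) (auto simp: powr_gt_zero)

text \<open>Dyadic annuli: where \<open>2 ^ k \<le> norm h < 2 ^ (k + 1)\<close> the integrand is at
  most \<open>2 powr (- b * k)\<close>, the enclosing ball has volume of order
  \<open>2 ^ (k * N)\<close>, and the resulting geometric series has ratio
  \<open>2 powr (N - b) < 1\<close>.\<close>

lemma nn_integral_powr_tail:
  assumes b: "real DIM('a) < b"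
  shows "(\<integral>\<^sup>+h. ennreal (indicator {h. 1 \<le> norm h} h * norm h powr (- b)) \<partial>(lborel :: 'a::euclidean_space measure)) < \<infinity>"
proof -
  let ?V = "unit_ball_vol DIM('a)"
  define c where "c = (\<lambda>k. 2 powr (- b * real k))"
  have ptw: "ennreal (indicator {h. 1 \<le> norm h} h * norm h powr (- b))
      \<le> (\<Sum>k. ennreal (c k) * indicator (ball 0 (2 ^ Suc k)) h)" for h :: 'a
  proof (cases "1 \<le> norm h")
    case True
    define k where "k = nat \<lfloor>log 2 (norm h)\<rfloor>"
    have "0 < norm h" using True by linarith
    then have l0: "0 \<le> log 2 (norm h)" using True by (subst zero_le_log_cancel_iff) auto
    then have k: "real k \<le> log 2 (norm h)" "log 2 (norm h) < real k + 1"
      by (auto simp: k_def)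
    have h: "norm h = 2 powr log 2 (norm h)" using True by (subst powr_log_cancel) auto
    have "norm h < 2 powr (real k + 1)" using k by (subst h) (rule powr_less_mono, auto)
    then have hk: "norm h < 2 ^ Suc k" by (simp add: powr_add powr_realpow)
    have "2 powr real k \<le> norm h" using k by (subst h) (rule powr_mono, auto)
    then have "norm h powr (- b) \<le> (2 powr real k) powr (- b)"
      using b by (intro powr_mono2') auto
    also have "\<dots> = c k" by (simp add: c_def powr_powr mult.commute)
    finally have "ennreal (indicator {h. 1 \<le> norm h} h * norm h powr (- b))
        \<le> ennreal (c k) * indicator (ball 0 (2 ^ Suc k)) h"
      using True hk by (simp add: ennreal_leI)
    also have "\<dots> = (\<Sum>j\<in>{k}. ennreal (c j) * indicator (ball 0 (2 ^ Suc j)) h)" by (subst sum.insert) simp_all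
    also have "\<dots> \<le> (\<Sum>k. ennreal (c k) * indicator (ball 0 (2 ^ Suc k)) h)"
      by (rule sum_le_suminf) auto
    finally show ?thesis .
  qed simp
  have "(\<integral>\<^sup>+h. ennreal (indicator {h. 1 \<le> norm h} h * norm h powr (- b)) \<partial>(lborel :: 'a measure))
     \<le> (\<integral>\<^sup>+h. (\<Sum>k. ennreal (c k) * indicator (ball 0 (2 ^ Suc k)) h) \<partial>(lborel :: 'a measure))"
    by (intro nn_integral_mono ptw)
  also have "\<dots> = (\<Sum>k. \<integral>\<^sup>+h. ennreal (c k) * indicator (ball 0 (2 ^ Suc k)) h \<partial>(lborel :: 'a measure))"
    by (intro nn_integral_suminf borel_measurable_times_ennreal borel_measurable_const borel_measurable_indicator) auto
  also have "\<dots> = (\<Sum>k. ennreal (?V * 2 ^ DIM('a) * (2 powr (real DIM('a) - b)) ^ k))"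
  proof (intro suminf_cong)
    fix k
    have "(\<integral>\<^sup>+h. ennreal (c k) * indicator (ball 0 (2 ^ Suc k)) h \<partial>(lborel :: 'a measure))
        = ennreal (c k) * ennreal (?V * (2 ^ Suc k) ^ DIM('a))"
      by (simp add: nn_integral_cmult_indicator emeasure_ball)
    also have "\<dots> = ennreal (c k * (?V * (2 ^ Suc k) ^ DIM('a)))"
      by (simp add: ennreal_mult c_def)
    also have "c k * (?V * (2 ^ Suc k) ^ DIM('a)) = ?V * 2 ^ DIM('a) * (2 powr (real DIM('a) - b)) ^ k"
    proof -
      have "(2 powr (real DIM('a) - b)) ^ k = 2 powr ((real DIM('a) - b) * real k)"
        by (simp add: powr_power mult.commute)
      also have "\<dots> = 2 powr (real (DIM('a) * k)) * c k"
        by (simp add: c_def flip: powr_add) (simp add: algebra_simps)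
      also have "2 powr (real (DIM('a) * k)) = (2::real) ^ (DIM('a) * k)"
        by (rule powr_realpow) simp
      finally have e: "(2 powr (real DIM('a) - b)) ^ k = 2 ^ (DIM('a) * k) * c k" .
      have "(2 ^ Suc k) ^ DIM('a) = (2::real) ^ DIM('a) * 2 ^ (DIM('a) * k)"
        by (simp add: power_mult_distrib power_mult mult.commute flip: power_mult)
      then show ?thesis by (simp add: e)
    qed
    finally show "(\<integral>\<^sup>+h. ennreal (c k) * indicator (ball 0 (2 ^ Suc k)) h \<partial>(lborel :: 'a measure))
        = ennreal (?V * 2 ^ DIM('a) * (2 powr (real DIM('a) - b)) ^ k)" .
  qed
  also have "\<dots> < \<infinity>"
  proof -
    have q: "2 powr (real DIM('a) - b) < 1" using b by (simp add: powr_less_one)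
    have "summable (\<lambda>k. ?V * 2 ^ DIM('a) * (2 powr (real DIM('a) - b)) ^ k)"
      using q by (intro summable_mult summable_geometric) auto
    then show ?thesis by (simp add: suminf_ennreal2 zero_le_mult_iff less_top)
  qed
  finally show ?thesis .
qed

text \<open>The same decomposition towards the origin, with shells of outer radius
  \<open>2 powr (- k)\<close> and ratio \<open>2 powr (b - N) < 1\<close>.\<close>

lemma nn_integral_powr_near:
  assumes b: "b < real DIM('a)" "0 \<le> b"
  shows "(\<integral>\<^sup>+h. ennreal (indicator {h. norm h \<le> 1} h * norm h powr (- b)) \<partial>(lborel :: 'a::euclidean_space measure)) < \<infinity>"
proof -
  let ?V = "unit_ball_vol DIM('a)"
  define c where "c = (\<lambda>k. 2 powr (b * (real k + 1)))"
  have ptw: "ennreal (indicator {h. norm h \<le> 1} h * norm h powr (- b))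
      \<le> (\<Sum>k. ennreal (c k) * indicator (cball 0 (2 powr (- real k))) h)" for h :: 'a
  proof (cases "0 < norm h \<and> norm h \<le> 1")
    case True
    define k where "k = nat \<lfloor>- log 2 (norm h)\<rfloor>"
    have l0: "0 \<le> - log 2 (norm h)" using True by simp
    then have k: "real k \<le> - log 2 (norm h)" "- log 2 (norm h) < real k + 1"
      unfolding k_def by linarith+
    have h: "norm h = 2 powr log 2 (norm h)" using True by (subst powr_log_cancel) auto
    have "norm h \<le> 2 powr (- real k)" using k by (subst h) (rule powr_mono, auto)
    then have hk: "h \<in> cball 0 (2 powr (- real k))" by simp
    have "2 powr (- (real k + 1)) \<le> norm h" using k by (subst h) (rule powr_mono, auto)
    then have "norm h powr (- b) \<le> (2 powr (- (real k + 1))) powr (- b)"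
      using b by (intro powr_mono2') auto
    also have "\<dots> = c k" unfolding c_def powr_powr by (simp add: algebra_simps)
    finally have "ennreal (indicator {h. norm h \<le> 1} h * norm h powr (- b))
        \<le> ennreal (c k) * indicator (cball 0 (2 powr (- real k))) h"
      using True hk by (simp add: ennreal_leI)
    also have "\<dots> = (\<Sum>j\<in>{k}. ennreal (c j) * indicator (cball 0 (2 powr (- real j))) h)" by (subst sum.insert) simp_all
    also have "\<dots> \<le> (\<Sum>k. ennreal (c k) * indicator (cball 0 (2 powr (- real k))) h)"
      by (rule sum_le_suminf) auto
    finally show ?thesis .
  qed auto
  have "(\<integral>\<^sup>+h. ennreal (indicator {h. norm h \<le> 1} h * norm h powr (- b)) \<partial>(lborel :: 'a measure))
     \<le> (\<integral>\<^sup>+h. (\<Sum>k. ennreal (c k) * indicator (cball 0 (2 powr (- real k))) h) \<partial>(lborel :: 'a measure))"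
    by (intro nn_integral_mono ptw)
  also have "\<dots> = (\<Sum>k. \<integral>\<^sup>+h. ennreal (c k) * indicator (cball 0 (2 powr (- real k))) h \<partial>(lborel :: 'a measure))"
    by (intro nn_integral_suminf borel_measurable_times_ennreal borel_measurable_const borel_measurable_indicator) auto
  also have "\<dots> = (\<Sum>k. ennreal (?V * 2 powr b * (2 powr (b - real DIM('a))) ^ k))"
  proof (intro suminf_cong)
    fix k
    have "(\<integral>\<^sup>+h. ennreal (c k) * indicator (cball 0 (2 powr (- real k))) h \<partial>(lborel :: 'a measure))
        = ennreal (c k) * ennreal (?V * (2 powr (- real k)) ^ DIM('a))"
      by (simp add: nn_integral_cmult_indicator emeasure_cball)
    also have "\<dots> = ennreal (c k * (?V * (2 powr (- real k)) ^ DIM('a)))"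
      by (simp add: ennreal_mult c_def)
    also have "c k * (?V * (2 powr (- real k)) ^ DIM('a)) = ?V * 2 powr b * (2 powr (b - real DIM('a))) ^ k"
      by (simp add: powr_power c_def flip: powr_add) (simp add: algebra_simps)
    finally show "(\<integral>\<^sup>+h. ennreal (c k) * indicator (cball 0 (2 powr (- real k))) h \<partial>(lborel :: 'a measure))
        = ennreal (?V * 2 powr b * (2 powr (b - real DIM('a))) ^ k)" .
  qed
  also have "\<dots> < \<infinity>"
  proof -
    have q: "2 powr (b - real DIM('a)) < 1" using b by (simp add: powr_less_one)
    have "summable (\<lambda>k. ?V * 2 powr b * (2 powr (b - real DIM('a))) ^ k)"
      using q by (intro summable_mult summable_geometric) auto
    then show ?thesis by (simp add: suminf_ennreal2 zero_le_mult_iff less_top)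
  qed
  finally show ?thesis .
qed

text \<open>Up to a constant, \<open>min 1 ((norm h)\<^sup>2)\<close> bounds the squared increments
  of a bounded Lipschitz function. Near the origin integrability rests on \<open>s < 1\<close>, far
  away on \<open>0 < s\<close>.\<close>

lemma integrable_ker:
  assumes s: "0 < s" "s < 1"
  shows "integrable (lborel :: 'a::euclidean_space measure) (\<lambda>h. min 1 ((norm h)\<^sup>2) * ker s h)"
proof -
  let ?N = "real DIM('a)"
  \<comment> \<open>In dimension one with \<open>s < 1 / 2\<close> the exponent
    \<open>N + 2 * s - 2\<close> is negative, while \<open>nn_integral_powr_near\<close> asks for
    \<open>0 \<le> b\<close>. Raising \<open>b\<close> is harmless because
    \<open>norm h \<le> 1\<close> there.\<close>
  define b where "b = max (?N + 2 * s - 2) 0"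
  have b: "b < ?N" "0 \<le> b" "?N + 2 * s - 2 \<le> b" using s by (auto simp: b_def)
  have ptw: "ennreal (norm (min 1 ((norm h)\<^sup>2) * ker s h)) \<le>
     ennreal (indicator {h. norm h \<le> 1} h * norm h powr (- b))
     + ennreal (indicator {h. 1 \<le> norm h} h * norm h powr (- (?N + 2 * s)))" for h :: 'a
  proof (cases "h = 0")
    case False
    then have h: "0 < norm h" by simp
    show ?thesis
    proof (cases "norm h \<le> 1")
      case True
      have "min 1 ((norm h)\<^sup>2) * ker s h \<le> (norm h)\<^sup>2 * ker s h"
        by (intro mult_right_mono) auto
      also have "\<dots> = norm h powr (2 - (?N + 2 * s))"
        using h by (simp add: ker_def powr_diff)
      also have "\<dots> \<le> norm h powr (- b)"
        using True h b by (intro powr_mono') auto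
      finally have "ennreal (norm (min 1 ((norm h)\<^sup>2) * ker s h)) \<le> ennreal (norm h powr (- b))"
        by (simp add: ennreal_leI)
      also have "\<dots> = ennreal (indicator {h. norm h \<le> 1} h * norm h powr (- b))"
        using True by simp
      finally show ?thesis by (rule order_trans) simp
    next
      case False
      have "min 1 ((norm h)\<^sup>2) * ker s h \<le> 1 * ker s h"
        by (intro mult_right_mono) auto
      also have "\<dots> = norm h powr (- (?N + 2 * s))"
        by (simp add: ker_def powr_minus_divide del: minus_add_distrib)
      finally have "ennreal (norm (min 1 ((norm h)\<^sup>2) * ker s h))
          \<le> ennreal (indicator {h. 1 \<le> norm h} h * norm h powr (- (?N + 2 * s)))"
        using False by (simp add: ennreal_leI)
      then show ?thesis by (rule order_trans) simp
    qed
  qed (auto simp: ker_def)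
  have "(\<integral>\<^sup>+h. ennreal (norm (min 1 ((norm h)\<^sup>2) * ker s h)) \<partial>(lborel :: 'a measure))
    \<le> (\<integral>\<^sup>+h. (ennreal (indicator {h. norm h \<le> 1} h * norm h powr (- b))
     + ennreal (indicator {h. 1 \<le> norm h} h * norm h powr (- (?N + 2 * s)))) \<partial>(lborel :: 'a measure))"
    by (intro nn_integral_mono ptw)
  also have "\<dots> = (\<integral>\<^sup>+h. ennreal (indicator {h. norm h \<le> 1} h * norm h powr (- b)) \<partial>(lborel :: 'a measure))
     + (\<integral>\<^sup>+h. ennreal (indicator {h. 1 \<le> norm h} h * norm h powr (- (?N + 2 * s))) \<partial>(lborel :: 'a measure))"
    by (rule nn_integral_add) measurable
  also have "\<dots> < \<infinity>"
    using nn_integral_powr_near[OF b(1,2)] nn_integral_powr_tail[where 'a='a, of "?N + 2 * s"] s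
    by simp
  finally show ?thesis by (intro integrableI_bounded) measurable
qed

section \<open>Energy form and Sobolev inequality\<close>

abbreviation dif :: "('a \<Rightarrow> real) \<Rightarrow> 'a \<times> 'a \<Rightarrow> real" where
  "dif u p \<equiv> u (fst p) - u (snd p)"

abbreviation ker2 :: "real \<Rightarrow> 'a::euclidean_space \<times> 'a \<Rightarrow> real" where
  "ker2 s p \<equiv> ker s (fst p - snd p)"

text \<open>The factor \<open>frac_const / 2\<close> is left out. \<open>frac_form_eq\<close>
  restores it, and it reappears as the constant \<open>C\<close> of the equation.\<close>

definition form :: "real \<Rightarrow> ('a::euclidean_space \<Rightarrow> real) \<Rightarrow> ('a \<Rightarrow> real) \<Rightarrow> real" where
  "form s u v = (\<integral>p. dif u p * dif v p * ker2 s p \<partial>lborel2)"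

definition fin_energy :: "real \<Rightarrow> ('a::euclidean_space \<Rightarrow> real) \<Rightarrow> bool" where
  "fin_energy s u \<longleftrightarrow> u \<in> borel_measurable borel \<and>
     integrable lborel2 (\<lambda>p. (dif u p)\<^sup>2 * ker2 s p)"

lemma fin_energy_measurable: "fin_energy s u \<Longrightarrow> u \<in> borel_measurable borel"
  by (simp add: fin_energy_def)

lemma fin_energy_dominated:
  fixes u v :: "'a::euclidean_space \<Rightarrow> real"
  assumes "integrable lborel2 G" and [measurable]: "v \<in> borel_measurable borel"
    and "\<And>x y. (v x - v y)\<^sup>2 * ker s (x - y) \<le> G (x, y)"
  shows "fin_energy s v"
  unfolding fin_energy_def
proof
  show "integrable lborel2 (\<lambda>p. (dif v p)\<^sup>2 * ker2 s p)"
  proof (rule Bochner_Integration.integrable_bound[OF assms(1)])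
    have "norm ((dif v p)\<^sup>2 * ker2 s p) \<le> norm (G p)" for p
      using assms(3)[of "fst p" "snd p"] by simp
    then show "AE p in lborel2. norm ((dif v p)\<^sup>2 * ker2 s p) \<le> norm (G p)" by simp
  qed measurable
qed fact

lemma form_integrable:
  assumes u: "fin_energy s u" and v: "fin_energy s v"
  shows "integrable lborel2 (\<lambda>p. dif u p * dif v p * ker2 s p)"
proof (rule Bochner_Integration.integrable_bound)
  show "integrable lborel2 (\<lambda>p. (dif u p)\<^sup>2 * ker2 s p + (dif v p)\<^sup>2 * ker2 s p)"
    using u v by (auto simp: fin_energy_def)
  have [measurable]: "u \<in> borel_measurable borel" "v \<in> borel_measurable borel"
    using u v by (auto simp: fin_energy_def)
  show "(\<lambda>p. dif u p * dif v p * ker2 s p) \<in> borel_measurable lborel2" by measurable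
  have "\<bar>a * b\<bar> * k \<le> a\<^sup>2 * k + b\<^sup>2 * k" if "0 \<le> k" for a b k :: real
  proof -
    have "\<bar>a * b\<bar> \<le> a\<^sup>2 + b\<^sup>2"
    proof -
      have "2 * (\<bar>a\<bar> * \<bar>b\<bar>) \<le> a\<^sup>2 + b\<^sup>2"
        using sum_squares_bound[of "\<bar>a\<bar>" "\<bar>b\<bar>"] by (simp add: mult.assoc)
      moreover have "0 \<le> \<bar>a\<bar> * \<bar>b\<bar>" by simp
      ultimately show ?thesis unfolding abs_mult by linarith
    qed
    from mult_right_mono[OF this that] show ?thesis by (simp add: algebra_simps)
  qed
  then show "AE p in lborel2. norm (dif u p * dif v p * ker2 s p) \<le> norm ((dif u p)\<^sup>2 * ker2 s p + (dif v p)\<^sup>2 * ker2 s p)"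
    by (auto simp: abs_mult)
qed

lemma form_nonneg: "0 \<le> form s u u"
  unfolding form_def by (intro integral_nonneg_AE) auto

lemma form_self: "form s u u = (\<integral>p. (dif u p)\<^sup>2 * ker2 s p \<partial>lborel2)"
  by (simp add: form_def power2_eq_square)

lemma fin_energy_add:
  assumes "fin_energy s u" "fin_energy s v"
  shows "fin_energy s (\<lambda>x. u x + v x)"
proof -
  have [measurable]: "u \<in> borel_measurable borel" "v \<in> borel_measurable borel"
    using assms by (auto simp: fin_energy_def)
  have "integrable lborel2 (\<lambda>p. 2 * ((dif u p)\<^sup>2 * ker2 s p) + 2 * ((dif v p)\<^sup>2 * ker2 s p))"
    using assms by (auto simp: fin_energy_def)
  then show ?thesis
  proof (rule fin_energy_dominated)
    have "(a + b)\<^sup>2 * k \<le> 2 * (a\<^sup>2 * k) + 2 * (b\<^sup>2 * k)" if "0 \<le> k" for a b k :: real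
    proof -
      have "(a + b)\<^sup>2 \<le> 2 * a\<^sup>2 + 2 * b\<^sup>2"
        using zero_le_power2[of "a - b"] by (simp add: power2_eq_square algebra_simps)
      from mult_right_mono[OF this that] show ?thesis by (simp add: algebra_simps)
    qed
    from this[of "ker s (x - y)" "u x - u y" "v x - v y" for x y]
    show "(u x + v x - (u y + v y))\<^sup>2 * ker s (x - y) \<le> 2 * ((dif u (x, y))\<^sup>2 * ker2 s (x, y)) + 2 * ((dif v (x, y))\<^sup>2 * ker2 s (x, y))" for x y
      by (simp add: algebra_simps)
  qed simp
qed

lemma fin_energy_cmult:
  assumes "fin_energy s u"
  shows "fin_energy s (\<lambda>x. c * u x)"
proof -
  have "(\<lambda>p. (dif (\<lambda>x. c * u x) p)\<^sup>2 * ker2 s p) = (\<lambda>p. c\<^sup>2 * ((dif u p)\<^sup>2 * ker2 s p))"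
    by (simp add: fun_eq_iff power2_eq_square algebra_simps)
  then show ?thesis using assms unfolding fin_energy_def by auto
qed

lemma fin_energy_diff:
  assumes "fin_energy s u" "fin_energy s v"
  shows "fin_energy s (\<lambda>x. u x - v x)"
  using fin_energy_add[OF assms(1) fin_energy_cmult[OF assms(2), of "-1"]] by simp

lemma form_le_add:
  assumes u: "fin_energy s u1" "fin_energy s u2" and v: "fin_energy s v"
    and le: "\<And>x y. (v x - v y)\<^sup>2 \<le> c1 * (u1 x - u1 y)\<^sup>2 + c2 * (u2 x - u2 y)\<^sup>2"
  shows "form s v v \<le> c1 * form s u1 u1 + c2 * form s u2 u2"
proof -
  have "form s v v \<le> (\<integral>p. c1 * ((dif u1 p)\<^sup>2 * ker2 s p) + c2 * ((dif u2 p)\<^sup>2 * ker2 s p) \<partial>lborel2)"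
    unfolding form_self
  proof (rule integral_mono)
    show "integrable lborel2 (\<lambda>p. (dif v p)\<^sup>2 * ker2 s p)" using v by (simp add: fin_energy_def)
    show "integrable lborel2 (\<lambda>p. c1 * ((dif u1 p)\<^sup>2 * ker2 s p) + c2 * ((dif u2 p)\<^sup>2 * ker2 s p))"
      using u by (simp add: fin_energy_def)
    show "(dif v p)\<^sup>2 * ker2 s p \<le> c1 * ((dif u1 p)\<^sup>2 * ker2 s p) + c2 * ((dif u2 p)\<^sup>2 * ker2 s p)" for p
      using mult_right_mono[OF le[of "fst p" "snd p"], of "ker2 s p"] by (simp add: algebra_simps)
  qed
  then show ?thesis using u by (simp add: form_self fin_energy_def)
qed

lemma form_le_of_dif_le:
  assumes "fin_energy s u" "fin_energy s v"
    and "\<And>x y. (v x - v y)\<^sup>2 \<le> c * (u x - u y)\<^sup>2"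
  shows "form s v v \<le> c * form s u u"
  using form_le_add[of s u u v c 0] assms by simp

lemma form_diff_le:
  assumes u: "fin_energy s u" and v: "fin_energy s v"
  shows "form s (\<lambda>x. u x - v x) (\<lambda>x. u x - v x) \<le> 2 * form s u u + 2 * form s v v"
proof (rule form_le_add[OF u v fin_energy_diff[OF u v]])
  have "(a - b)\<^sup>2 \<le> 2 * a\<^sup>2 + 2 * b\<^sup>2" for a b :: real
    using zero_le_power2[of "a + b"] by (simp add: power2_eq_square algebra_simps)
  from this[of "u x - u y" "v x - v y" for x y]
  show "(u x - v x - (u y - v y))\<^sup>2 \<le> 2 * (u x - u y)\<^sup>2 + 2 * (v x - v y)\<^sup>2" for x y
    by (simp add: algebra_simps)
qed

text \<open>
  The Sobolev inequality by Chebyshev: with \<open>t = \<bar>f x\<bar>\<close>, half of a ball around \<open>x\<close> of volume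
  comparable to \<open>\<integral>\<bar>f\<bar>\<^sup>r / t\<^sup>r\<close> consists of points where \<open>\<bar>f\<bar> \<le> t / 2\<close>. This bounds
  \<open>\<integral>\<bar>f x - f y\<bar>\<^sup>2 ker s (x - y) dy\<close> below by a multiple of \<open>t\<^sup>r\<close>.
\<close>

lemma Sobolev_pointwise:
  fixes f :: "'a::euclidean_space \<Rightarrow> real" and s :: real
  defines "r \<equiv> crit_exp DIM('a) s" and "N \<equiv> real DIM('a)"
  defines "V \<equiv> unit_ball_vol N"
  assumes s: "0 < s" "2 * s < N"
    and [measurable]: "f \<in> borel_measurable borel"
    and int: "integrable lborel (\<lambda>x. \<bar>f x\<bar> powr r)"
    and A: "A = (\<integral>x. \<bar>f x\<bar> powr r \<partial>lborel)" "0 < A"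
  shows "ennreal (V / 8 * (2 powr (r + 1) / V) powr (- (2 * s / N)) * A powr (- (2 * s / N)) * \<bar>f x\<bar> powr r)
     \<le> (\<integral>\<^sup>+y. ennreal ((f x - f y)\<^sup>2 * ker s (x - y)) \<partial>lborel)"
proof (cases "f x = 0")
  case False
  define t where "t = \<bar>f x\<bar>"
  define b where "b = (t / 2) powr (- r) * A"
  have t: "0 < t" using False by (simp add: t_def)
  have N: "0 < N" by (simp add: N_def)
  have V: "0 < V" by (simp add: V_def N_def)
  have r: "r = 2 * N / (N - 2 * s)" by (simp add: r_def crit_exp_def N_def)
  have b: "0 < b" using t A by (simp add: b_def)
  \<comment> \<open>The radius gives the ball volume \<open>2 * b\<close>. Chebyshev bounds the
    measure of \<open>Bad\<close> by \<open>b\<close>, so that at least \<open>b\<close> remains for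
    \<open>G\<close>.\<close>
  define \<rho> where "\<rho> = (2 * b / V) powr (1 / N)"
  have \<rho>: "0 < \<rho>" using b V by (simp add: \<rho>_def)
  have \<rho>N: "V * \<rho> ^ DIM('a) = 2 * b"
  proof -
    have "\<rho> ^ DIM('a) = \<rho> powr N" using \<rho> by (simp add: powr_realpow N_def)
    also have "\<dots> = 2 * b / V" using N b V by (simp add: \<rho>_def powr_powr)
    finally show ?thesis using V by simp
  qed
  define Bad where "Bad = {y. t / 2 < \<bar>f y\<bar>}"
  define G where "G = ball x \<rho> \<inter> {y. \<bar>f y\<bar> \<le> t / 2}"
  have [measurable]: "Bad \<in> sets borel" "G \<in> sets borel" by (auto simp: Bad_def G_def)
  have "emeasure lborel Bad \<le> emeasure lborel {y\<in>UNIV. 1 \<le> ennreal ((t / 2) powr (- r)) * ennreal (\<bar>f y\<bar> powr r)}"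
  proof (rule emeasure_mono)
    show "Bad \<subseteq> {y\<in>UNIV. 1 \<le> ennreal ((t / 2) powr (- r)) * ennreal (\<bar>f y\<bar> powr r)}"
    proof
      fix y assume "y \<in> Bad"
      then have "t / 2 \<le> \<bar>f y\<bar>" by (simp add: Bad_def)
      moreover have "0 < r" using r s N by simp
      ultimately have "(t / 2) powr r \<le> \<bar>f y\<bar> powr r" using t by (intro powr_mono2) auto
      then have "1 \<le> (t / 2) powr (- r) * \<bar>f y\<bar> powr r"
        using t by (simp add: powr_minus field_simps)
      then show "y \<in> {y\<in>UNIV. 1 \<le> ennreal ((t / 2) powr (- r)) * ennreal (\<bar>f y\<bar> powr r)}"
        by (simp add: ennreal_leI flip: ennreal_mult ennreal_1)
    qed
  qed measurable
  also have "\<dots> \<le> ennreal ((t / 2) powr (- r)) * (\<integral>\<^sup>+y. ennreal (\<bar>f y\<bar> powr r) * indicator UNIV y \<partial>lborel)"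
    by (rule nn_integral_Markov_inequality) auto
  also have "\<dots> = ennreal b"
    using int A by (simp add: b_def nn_integral_eq_integral ennreal_mult)
  finally have bad: "emeasure lborel Bad \<le> ennreal b" .
  have "ennreal (2 * b) = emeasure lborel (ball x \<rho>)"
    using \<rho> \<rho>N by (simp add: emeasure_ball V_def N_def)
  also have "\<dots> \<le> emeasure lborel (G \<union> Bad)"
    by (rule emeasure_mono) (auto simp: G_def Bad_def)
  also have "\<dots> \<le> emeasure lborel G + emeasure lborel Bad"
    by (rule emeasure_subadditive) auto
  also have "\<dots> \<le> emeasure lborel G + ennreal b" by (intro add_left_mono bad)
  finally have "ennreal b + ennreal b \<le> emeasure lborel G + ennreal b"
    using b by (simp flip: ennreal_plus)
  then have Gb: "ennreal b \<le> emeasure lborel G"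
    using ennreal_add_left_cancel_le[of "ennreal b"] by (simp add: add.commute)
  define c where "c = t\<^sup>2 / 4 * \<rho> powr (- (N + 2 * s))"
  have c: "0 \<le> c" by (simp add: c_def)
  have on_G: "c \<le> (f x - f y)\<^sup>2 * ker s (x - y)" if "y \<in> G" for y
  proof -
    have y: "dist x y < \<rho>" "\<bar>f y\<bar> \<le> t / 2" using that by (auto simp: G_def)
    have "x \<noteq> y" using y t by (auto simp: t_def)
    have "t / 2 \<le> \<bar>f x - f y\<bar>" using y unfolding t_def by linarith
    then have "(t / 2)\<^sup>2 \<le> (f x - f y)\<^sup>2" using t by (metis abs_le_square_iff abs_of_pos half_gt_zero)
    moreover have "\<rho> powr (- (N + 2 * s)) \<le> ker s (x - y)"
    proof -
      have "\<rho> powr (- (N + 2 * s)) \<le> norm (x - y) powr (- (N + 2 * s))"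
        using y \<open>x \<noteq> y\<close> s N by (intro powr_mono2') (auto simp: dist_norm)
      then show ?thesis by (simp add: ker_def N_def powr_minus_divide del: minus_add_distrib)
    qed
    ultimately have "(t / 2)\<^sup>2 * \<rho> powr (- (N + 2 * s)) \<le> (f x - f y)\<^sup>2 * ker s (x - y)"
      by (intro mult_mono) auto
    then show ?thesis by (simp add: c_def power_divide)
  qed
  have "V / 8 * (2 powr (r + 1) / V) powr (- (2 * s / N)) * A powr (- (2 * s / N)) * \<bar>f x\<bar> powr r = c * b"
  proof -
    have *: "2 * b / V = 2 powr (r + 1) / V * A * t powr (- r)"
      using t V by (simp add: b_def powr_divide powr_minus powr_add field_simps)
    \<comment> \<open>As \<open>\<rho>\<close> is the \<open>N\<close>-th root of
      \<open>2 * b / V\<close>, one full power of \<open>2 * b / V\<close> cancels against the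
      measure \<open>b\<close> of the good set; what remains carries the exponent
      \<open>- (2 * s / N)\<close>.\<close>
    have "\<rho> powr (- (N + 2 * s)) = (2 * b / V) powr (- 1 + (- (2 * s / N)))"
      using N unfolding \<rho>_def powr_powr by (simp add: field_simps)
    also have "\<dots> = V / (2 * b) * (2 * b / V) powr (- (2 * s / N))"
      using b V by (subst powr_add) (simp add: powr_minus)
    finally have "c * b = t\<^sup>2 * V / 8 * (2 * b / V) powr (- (2 * s / N))"
      using b by (simp add: c_def field_simps)
    also have "(2 * b / V) powr (- (2 * s / N)) = (2 powr (r + 1) / V) powr (- (2 * s / N)) * A powr (- (2 * s / N)) * t powr (r * (2 * s / N))"
    proof -
      have "(X * A * t powr (- r)) powr e = X powr e * A powr e * t powr (- r * e)" if "0 \<le> X" for X e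
        using that A(2) by (simp add: powr_mult powr_powr)
      from this[of "2 powr (r + 1) / V" "- (2 * s / N)"] V show ?thesis unfolding * by simp
    qed
    also have "t\<^sup>2 * V / 8 * ((2 powr (r + 1) / V) powr (- (2 * s / N)) * A powr (- (2 * s / N)) * t powr (r * (2 * s / N)))
       = V / 8 * (2 powr (r + 1) / V) powr (- (2 * s / N)) * A powr (- (2 * s / N)) * (t powr 2 * t powr (r * (2 * s / N)))"
      using t by simp
    also have "t powr 2 * t powr (r * (2 * s / N)) = t powr r"
    proof -
      \<comment> \<open>The relation that characterizes the critical exponent.\<close>
      have "2 + r * (2 * s / N) = r" using r s N by (simp add: field_simps)
      then show ?thesis by (metis powr_add)
    qed
    finally show ?thesis by (simp add: t_def)
  qed
  also have "ennreal (c * b) = ennreal c * ennreal b" using c b by (simp add: ennreal_mult)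
  also have "\<dots> \<le> ennreal c * emeasure lborel G" by (intro mult_left_mono Gb) auto
  also have "\<dots> = (\<integral>\<^sup>+y. ennreal c * indicator G y \<partial>lborel)" by (simp add: nn_integral_cmult_indicator)
  also have "\<dots> \<le> (\<integral>\<^sup>+y. ennreal ((f x - f y)\<^sup>2 * ker s (x - y)) \<partial>lborel)"
    by (rule nn_integral_mono) (auto simp: indicator_def intro!: ennreal_leI on_G)
  finally show ?thesis .
qed simp

text \<open>Reciprocal of the numerical factor on the left-hand side of
  \<open>Sobolev_pointwise\<close>; not the optimal constant.\<close>

definition Sobolev_const :: "nat \<Rightarrow> real \<Rightarrow> real" where
  "Sobolev_const n s = 1 / (unit_ball_vol n / 8 *
     (2 powr (crit_exp n s + 1) / unit_ball_vol n) powr (- (2 * s / n)))"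

lemma Sobolev_const_pos: "0 < n \<Longrightarrow> 0 < Sobolev_const n s"
proof -
  assume "0 < n"
  have "0 < unit_ball_vol (real n)" by simp
  then have "unit_ball_vol (real n) \<noteq> 0" by linarith
  then show ?thesis unfolding Sobolev_const_def by (intro divide_pos_pos mult_pos_pos) auto
qed

text \<open>Integrating \<open>Sobolev_pointwise\<close> over \<open>x\<close> produces
  \<open>A powr (1 - 2 * s / N)\<close> with \<open>A\<close> the integral of
  \<open>\<bar>f\<bar> powr r\<close>, and \<open>1 - 2 * s / N = 2 / r\<close>. The case
  \<open>A = 0\<close> is trivial.\<close>

lemma Sobolev_inequality:
  fixes f :: "'a::euclidean_space \<Rightarrow> real" and s :: real
  defines "r \<equiv> crit_exp DIM('a) s"
  assumes s: "0 < s" "2 * s < real DIM('a)"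
    and f: "fin_energy s f" and int: "integrable lborel (\<lambda>x. \<bar>f x\<bar> powr r)"
  shows "(\<integral>x. \<bar>f x\<bar> powr r \<partial>lborel) powr (2 / r) \<le> Sobolev_const DIM('a) s * form s f f"
proof -
  define A where "A = (\<integral>x. \<bar>f x\<bar> powr r \<partial>lborel)"
  define N where "N = real DIM('a)"
  define c where "c = unit_ball_vol N / 8 * (2 powr (r + 1) / unit_ball_vol N) powr (- (2 * s / N))"
  have [measurable]: "f \<in> borel_measurable borel" using f by (simp add: fin_energy_def)
  have "0 \<le> A" unfolding A_def by (intro integral_nonneg_AE) auto
  have S: "Sobolev_const DIM('a) s = 1 / c"
    by (simp add: Sobolev_const_def c_def r_def N_def)
  have c: "0 < c" using Sobolev_const_pos[of "DIM('a)" s] unfolding S by simp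
  show ?thesis
  proof (cases "A = 0")
    case False
    with \<open>0 \<le> A\<close> have A: "0 < A" by simp
    have "ennreal (c * A powr (- (2 * s / N)) * A) = (\<integral>\<^sup>+x. ennreal (c * A powr (- (2 * s / N)) * \<bar>f x\<bar> powr r) \<partial>lborel)"
      using int c by (subst nn_integral_eq_integral) (auto simp: A_def)
    also have "\<dots> \<le> (\<integral>\<^sup>+x. (\<integral>\<^sup>+y. ennreal ((f x - f y)\<^sup>2 * ker s (x - y)) \<partial>lborel) \<partial>lborel)"
      using Sobolev_pointwise[OF s(1,2), of f A] int A
      by (intro nn_integral_mono) (simp add: A_def r_def N_def c_def)
    also have "\<dots> = (\<integral>\<^sup>+p. ennreal ((dif f p)\<^sup>2 * ker2 s p) \<partial>lborel2)"
      by (subst lborel.nn_integral_fst[symmetric]) auto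
    also have "\<dots> = ennreal (form s f f)"
      using f unfolding form_self by (subst nn_integral_eq_integral) (auto simp: fin_energy_def)
    finally have "c * A powr (- (2 * s / N)) * A \<le> form s f f"
      using form_nonneg[of s f] by (simp add: ennreal_le_iff)
    moreover have "A powr (- (2 * s / N)) * A = A powr (2 / r)"
    proof -
      have "A powr (- (2 * s / N)) * A = A powr (- (2 * s / N) + 1)"
        using A powr_add[of A "- (2 * s / N)" 1] by simp
      also have "- (2 * s / N) + 1 = 2 / r"
        using s by (simp add: r_def crit_exp_def N_def field_simps)
      finally show ?thesis .
    qed
    ultimately have "c * A powr (2 / r) \<le> form s f f" by (simp add: mult.assoc)
    then show ?thesis unfolding S A_def[symmetric] using c by (simp add: field_simps)
  next
    case True
    then show ?thesis unfolding A_def[symmetric]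
      using form_nonneg[of s f] Sobolev_const_pos[of "DIM('a)" s] by simp
  qed
qed

section \<open>Passage to the limit under bounded energy\<close>

text \<open>A substitute for dominated convergence when the majorant splits into a fixed integrable
  function and an arbitrarily small multiple of functions with bounded integrals. Young's inequality
  supplies exactly such majorants for products with a fixed factor.\<close>

lemma integral_abs_tendsto_zero:
  fixes b H :: "nat \<Rightarrow> 'b \<Rightarrow> real"
  assumes b [measurable]: "\<And>n. b n \<in> borel_measurable M" and lim: "AE x in M. (\<lambda>n. b n x) \<longlonglongrightarrow> 0"
    and H: "\<And>n. integrable M (H n)" "\<And>n x. 0 \<le> H n x" "\<And>n. (\<integral>x. H n x \<partial>M) \<le> C"
    and bd: "\<And>\<delta>. 0 < \<delta> \<Longrightarrow> \<exists>W. integrable M W \<and> (\<forall>n x. \<bar>b n x\<bar> \<le> W x + \<delta> * H n x)"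
  shows "integrable M (b n)" "(\<lambda>n. \<integral>x. b n x \<partial>M) \<longlonglongrightarrow> 0"
proof -
  have int: "integrable M (b n)" for n
  proof -
    obtain W where W: "integrable M W" "\<forall>n x. \<bar>b n x\<bar> \<le> W x + 1 * H n x" using bd[of 1] by auto
    have WH: "integrable M (\<lambda>x. W x + H n x)" using W(1) H(1) by auto
    have "\<bar>b n x\<bar> \<le> \<bar>W x + H n x\<bar>" for x using W(2)[rule_format, of n x] by simp
    then show ?thesis
      by (intro Bochner_Integration.integrable_bound[OF WH]) auto
  qed
  then show "integrable M (b n)" .
  have "0 \<le> (\<integral>x. H 0 x \<partial>M)" by (intro integral_nonneg_AE) (simp add: H)
  then have C: "0 \<le> C" using H(3)[of 0] by linarith
  have t: "(\<lambda>n. \<integral>x. \<bar>b n x\<bar> \<partial>M) \<longlonglongrightarrow> 0"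
  proof (rule LIMSEQ_I)
    fix e :: real assume e: "0 < e"
    define \<delta> where "\<delta> = e / (2 * (C + 1))"
    have \<delta>: "0 < \<delta>" "\<delta> * C < e / 2" using C e by (auto simp: \<delta>_def field_simps)
    obtain W where W: "integrable M W" "\<And>n x. \<bar>b n x\<bar> \<le> W x + \<delta> * H n x" using bd[OF \<delta>(1)] by auto
    have [measurable]: "H n \<in> borel_measurable M" for n using H(1) by auto
    \<comment> \<open>The excess of \<open>\<bar>b n x\<bar>\<close> over
      \<open>\<delta> * H n x\<close> is dominated by \<open>W\<close> and tends to zero; what is
      cut off contributes at most \<open>\<delta> * C < e / 2\<close>.\<close>
    define g where "g = (\<lambda>n x. max 0 (\<bar>b n x\<bar> - \<delta> * H n x))"
    have gW: "norm (g n x) \<le> \<bar>W x\<bar>" for n x using W(2)[of n x] by (auto simp: g_def)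
    have [measurable]: "g n \<in> borel_measurable M" for n by (simp add: g_def)
    have gi: "integrable M (g n)" for n
      by (rule Bochner_Integration.integrable_bound[OF W(1)]) (use gW in auto)
    have "(\<lambda>n. \<integral>x. g n x \<partial>M) \<longlonglongrightarrow> (\<integral>x. 0 \<partial>M)"
    proof (rule integral_dominated_convergence[where w="\<lambda>x. \<bar>W x\<bar>"])
      show "AE x in M. (\<lambda>n. g n x) \<longlonglongrightarrow> 0"
        using lim
      proof eventually_elim
        case (elim x)
        have "\<bar>g n x\<bar> \<le> \<bar>b n x\<bar>" for n using H(2)[of n x] \<delta>(1) by (auto simp: g_def)
        then show ?case
          by (intro Lim_null_comparison[OF always_eventually tendsto_rabs_zero[OF elim]]) auto
      qed
    qed (use W(1) gW in auto)
    then have "(\<lambda>n. \<integral>x. g n x \<partial>M) \<longlonglongrightarrow> 0" by simp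
    from LIMSEQ_D[OF this, of "e/2"] e obtain n0 where n0: "\<And>n. n \<ge> n0 \<Longrightarrow> \<bar>\<integral>x. g n x \<partial>M\<bar> < e / 2" by auto
    show "\<exists>no. \<forall>n\<ge>no. norm ((\<integral>x. \<bar>b n x\<bar> \<partial>M) - 0) < e"
    proof (intro exI allI impI)
      fix n assume n: "n0 \<le> n"
      have "(\<integral>x. \<bar>b n x\<bar> \<partial>M) \<le> (\<integral>x. g n x + \<delta> * H n x \<partial>M)"
        using int gi H(1) by (intro integral_mono) (auto simp: g_def)
      also have "\<dots> = (\<integral>x. g n x \<partial>M) + \<delta> * (\<integral>x. H n x \<partial>M)" using gi H(1) by simp
      also have "\<dots> < e / 2 + e / 2"
        using n0[OF n] mult_left_mono[OF H(3)[of n], of \<delta>] \<delta> by linarith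
      finally have "(\<integral>x. \<bar>b n x\<bar> \<partial>M) < e" by simp
      moreover have "0 \<le> (\<integral>x. \<bar>b n x\<bar> \<partial>M)" by (intro integral_nonneg_AE) auto
      ultimately show "norm ((\<integral>x. \<bar>b n x\<bar> \<partial>M) - 0) < e" by simp
    qed
  qed
  have nb: "norm (\<integral>x. b n x \<partial>M) \<le> (\<integral>x. \<bar>b n x\<bar> \<partial>M)" for n
    using integral_norm_bound[of M "b n"] by simp
  show "(\<lambda>n. \<integral>x. b n x \<partial>M) \<longlonglongrightarrow> 0"
    by (rule Lim_null_comparison[OF always_eventually[OF allI[OF nb]] t])
qed

lemma crit_exp_gt_2:
  assumes "0 < s" "2 * s < real n"
  shows "2 < crit_exp n s"
  using assms by (simp add: crit_exp_def field_simps)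

lemma AE_lborel2:
  fixes P :: "'a::euclidean_space \<Rightarrow> bool"
  assumes "AE x in lborel. P x"
  shows "AE p in lborel2. P (fst p)" "AE p in lborel2. P (snd p)"
proof -
  obtain N where N: "N \<in> null_sets lborel" "{x. \<not> P x} \<subseteq> N"
    using assms by (auto elim!: AE_E simp: null_sets_def)
  have "N \<times> UNIV \<in> null_sets (lborel2 :: ('a \<times> 'a) measure)"
    using N lborel.emeasure_pair_measure_Times[of N lborel UNIV]
    by (auto simp: null_sets_def)
  then show "AE p in lborel2. P (fst p)"
    by (rule AE_I'[of _ _]) (use N in auto)
  have "UNIV \<times> N \<in> null_sets (lborel2 :: ('a \<times> 'a) measure)"
    using N lborel.emeasure_pair_measure_Times[of UNIV lborel N]
    by (auto simp: null_sets_def)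
  then show "AE p in lborel2. P (snd p)"
    by (rule AE_I'[of _ _]) (use N in auto)
qed

lemma Fatou_bounded:
  fixes g :: "nat \<Rightarrow> 'b \<Rightarrow> real"
  assumes g: "\<And>n. integrable M (g n)" "\<And>n x. 0 \<le> g n x" "\<And>n. (\<integral>x. g n x \<partial>M) \<le> C"
    and lim: "AE x in M. (\<lambda>n. g n x) \<longlonglongrightarrow> h x" and [measurable]: "h \<in> borel_measurable M"
  shows "integrable M h" "(\<integral>x. h x \<partial>M) \<le> C"
proof -
  have [measurable]: "g n \<in> borel_measurable M" for n using g(1) by (rule borel_measurable_integrable)
  have h0: "AE x in M. 0 \<le> h x"
    using lim by eventually_elim (rule LIMSEQ_le_const, auto simp: g)
  have "0 \<le> (\<integral>x. g 0 x \<partial>M)" by (intro integral_nonneg_AE) (simp add: g)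
  then have C: "0 \<le> C" using g(3)[of 0] by linarith
  have "(\<integral>\<^sup>+x. ennreal (h x) \<partial>M) = (\<integral>\<^sup>+x. liminf (\<lambda>n. ennreal (g n x)) \<partial>M)"
  proof (rule nn_integral_cong_AE)
    show "AE x in M. ennreal (h x) = liminf (\<lambda>n. ennreal (g n x))"
      using lim
    proof eventually_elim
      case (elim x)
      then have "(\<lambda>n. ennreal (g n x)) \<longlonglongrightarrow> ennreal (h x)" by (rule tendsto_ennrealI)
      then show ?case by (metis lim_imp_Liminf trivial_limit_sequentially)
    qed
  qed
  also have "\<dots> \<le> liminf (\<lambda>n. \<integral>\<^sup>+x. ennreal (g n x) \<partial>M)"
    by (rule nn_integral_liminf) auto
  also have "\<dots> \<le> liminf (\<lambda>n. ennreal C)"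
    by (intro Liminf_mono always_eventually allI) (simp add: nn_integral_eq_integral g ennreal_leI)
  also have "\<dots> = ennreal C" by (simp add: Liminf_const)
  finally have le: "(\<integral>\<^sup>+x. ennreal (h x) \<partial>M) \<le> ennreal C" .
  show int: "integrable M h"
  proof (rule integrableI_nonneg)
    show "(\<integral>\<^sup>+x. ennreal (h x) \<partial>M) < \<infinity>" using le by (rule le_less_trans) simp
  qed (use h0 in auto)
  show "(\<integral>x. h x \<partial>M) \<le> C"
    using le C by (simp add: nn_integral_eq_integral[OF int h0])
qed

lemma powr_diff_le:
  fixes a b :: real
  assumes "0 < r"
  shows "\<bar>a - b\<bar> powr r \<le> 2 powr r * (\<bar>a\<bar> powr r + \<bar>b\<bar> powr r)"
proof -
  define m where "m = max \<bar>a\<bar> \<bar>b\<bar>"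
  have "\<bar>a - b\<bar> \<le> 2 * m" by (simp add: m_def)
  then have "\<bar>a - b\<bar> powr r \<le> (2 * m) powr r" using assms by (intro powr_mono2) auto
  also have "\<dots> = 2 powr r * m powr r" by (simp add: powr_mult m_def)
  also have "\<dots> \<le> 2 powr r * (\<bar>a\<bar> powr r + \<bar>b\<bar> powr r)"
    by (intro mult_left_mono) (auto simp: m_def max_def)
  finally show ?thesis .
qed

text \<open>Young's inequality for \<open>F / c\<close> and \<open>c * a\<close> with
  \<open>c = \<delta> powr (1 / r)\<close>; the factors \<open>1 / r\<close> and
  \<open>1 / r'\<close> are dropped. The small weight falls on the factor that varies with the
  sequence.\<close>

lemma Young_delta:
  fixes a F :: real
  assumes r: "1 < r" and d: "0 < \<delta>"
  shows "\<bar>F * a\<bar> \<le> (1 / \<delta> powr (1 / r)) powr (r / (r - 1)) * \<bar>F\<bar> powr (r / (r - 1)) + \<delta> * \<bar>a\<bar> powr r"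
proof -
  define c where "c = \<delta> powr (1 / r)"
  define r' where "r' = r / (r - 1)"
  have r': "1 < r'" using r by (simp add: r'_def)
  have c: "0 < c" using d by (simp add: c_def)
  have "\<bar>F * a\<bar> = (1 / c * \<bar>F\<bar>) * (c * \<bar>a\<bar>)" using c by (simp add: abs_mult)
  also have "\<dots> \<le> (1 / c * \<bar>F\<bar>) powr r' / r' + (c * \<bar>a\<bar>) powr r / r"
    using r r' c by (intro Youngs_inequality) (auto simp: r'_def field_simps)
  also have "\<dots> \<le> (1 / c * \<bar>F\<bar>) powr r' + (c * \<bar>a\<bar>) powr r"
    using r r' by (intro add_mono) (auto simp: divide_le_eq mult_le_cancel_left1)
  also have "(1 / c * \<bar>F\<bar>) powr r' = (1 / c) powr r' * \<bar>F\<bar> powr r'"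
    using powr_mult[of "1 / c" "\<bar>F\<bar>" r'] c by simp
  also have "(c * \<bar>a\<bar>) powr r = c powr r * \<bar>a\<bar> powr r" using c by (simp add: powr_mult)
  also have "c powr r = \<delta>" using d r by (simp add: c_def powr_powr)
  finally show ?thesis by (simp add: c_def r'_def)
qed

lemma integrable_Young:
  fixes F a :: "'b \<Rightarrow> real"
  assumes r: "1 < r" and F: "F \<in> borel_measurable M" "integrable M (\<lambda>x. \<bar>F x\<bar> powr (r / (r - 1)))"
    and a: "a \<in> borel_measurable M" "integrable M (\<lambda>x. \<bar>a x\<bar> powr r)"
  shows "integrable M (\<lambda>x. F x * a x)"
proof -
  have "integrable M (\<lambda>x. (1 / 1 powr (1 / r)) powr (r / (r - 1)) * \<bar>F x\<bar> powr (r / (r - 1)) + 1 * \<bar>a x\<bar> powr r)"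
    using F a by auto
  then show ?thesis
  proof (rule Bochner_Integration.integrable_bound)
    show "AE x in M. norm (F x * a x) \<le> norm ((1 / 1 powr (1 / r)) powr (r / (r - 1)) * \<bar>F x\<bar> powr (r / (r - 1)) + 1 * \<bar>a x\<bar> powr r)"
      using Young_delta[OF r, of 1 "F x" "a x" for x]
      by (intro AE_I2) (simp only: real_norm_def, rule order_trans[OF _ abs_ge_self], simp)
  qed (use F a in measurable)
qed

text \<open>The Sobolev inequality turns the energy bound into a bound in the critical Lebesgue
  space. Bounds and almost-everywhere convergence then identify both weak limits through
  \<open>integral_abs_tendsto_zero\<close>, with no extraction of subsequences. Truncated tests
  enter the equation this way.\<close>

lemma weak_limit:
  fixes \<phi> :: "nat \<Rightarrow> 'a::euclidean_space \<Rightarrow> real" and s :: real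
  defines "r \<equiv> crit_exp DIM('a) s"
  assumes s: "0 < s" "2 * s < real DIM('a)"
    and \<phi>: "\<And>n. fin_energy s (\<phi> n)" "\<And>n. integrable lborel (\<lambda>x. \<bar>\<phi> n x\<bar> powr r)"
    and bd: "\<And>n. form s (\<phi> n) (\<phi> n) \<le> A"
    and lim: "AE x in lborel. (\<lambda>n. \<phi> n x) \<longlonglongrightarrow> \<phi>0 x"
    and [measurable]: "\<phi>0 \<in> borel_measurable borel"
  shows "fin_energy s \<phi>0" "integrable lborel (\<lambda>x. \<bar>\<phi>0 x\<bar> powr r)"
    and "\<And>u. fin_energy s u \<Longrightarrow> (\<lambda>n. form s u (\<phi> n)) \<longlonglongrightarrow> form s u \<phi>0"
    and "\<And>F. F \<in> borel_measurable borel \<Longrightarrow> integrable lborel (\<lambda>x. \<bar>F x\<bar> powr (r / (r - 1))) \<Longrightarrow>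
       (\<lambda>n. \<integral>x. F x * \<phi> n x \<partial>lborel) \<longlonglongrightarrow> (\<integral>x. F x * \<phi>0 x \<partial>lborel)"
proof -
  have r: "2 < r" using crit_exp_gt_2[OF s] by (simp add: r_def)
  have [measurable]: "\<phi> n \<in> borel_measurable borel" for n using \<phi>(1) by (rule fin_energy_measurable)
  have lim2: "AE p in lborel2. (\<lambda>n. dif (\<phi> n) p) \<longlonglongrightarrow> dif \<phi>0 p"
    using AE_lborel2[OF lim] by eventually_elim (auto intro: tendsto_diff)
  have "integrable lborel2 (\<lambda>p. (dif \<phi>0 p)\<^sup>2 * ker2 s p)"
    and en0: "(\<integral>p. (dif \<phi>0 p)\<^sup>2 * ker2 s p \<partial>lborel2) \<le> A"
  proof -
    have 1: "\<And>n. integrable lborel2 (\<lambda>p. (dif (\<phi> n) p)\<^sup>2 * ker2 s p)"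
      using \<phi>(1) by (simp add: fin_energy_def)
    have 2: "\<And>n. (\<integral>p. (dif (\<phi> n) p)\<^sup>2 * ker2 s p \<partial>lborel2) \<le> A"
      using bd by (simp add: form_self)
    have 3: "AE p in lborel2. (\<lambda>n. (dif (\<phi> n) p)\<^sup>2 * ker2 s p) \<longlonglongrightarrow> (dif \<phi>0 p)\<^sup>2 * ker2 s p"
      using lim2 by eventually_elim (intro tendsto_mult tendsto_power tendsto_const)
    show "integrable lborel2 (\<lambda>p. (dif \<phi>0 p)\<^sup>2 * ker2 s p)"
      by (rule Fatou_bounded[OF 1 _ 2 3]) auto
    show "(\<integral>p. (dif \<phi>0 p)\<^sup>2 * ker2 s p \<partial>lborel2) \<le> A"
      by (rule Fatou_bounded[OF 1 _ 2 3]) auto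
  qed
  then show fe0: "fin_energy s \<phi>0" by (simp add: fin_energy_def)
  define S where "S = Sobolev_const DIM('a) s"
  have S: "0 < S" unfolding S_def by (rule Sobolev_const_pos) simp
  have A: "0 \<le> A" using bd[of 0] form_nonneg[of s "\<phi> 0"] by linarith
  define B where "B = (S * A) powr (r / 2)"
  have Bn: "(\<integral>x. \<bar>\<phi> n x\<bar> powr r \<partial>lborel) \<le> B" for n
  proof -
    let ?I = "\<integral>x. \<bar>\<phi> n x\<bar> powr r \<partial>lborel"
    have I: "0 \<le> ?I" by (intro integral_nonneg_AE) auto
    have "?I powr (2 / r) \<le> S * form s (\<phi> n) (\<phi> n)"
      using Sobolev_inequality[OF s \<phi>(1)] \<phi>(2) unfolding S_def r_def by blast
    also have "\<dots> \<le> S * A" using bd S by (simp add: mult_left_mono)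
    finally have "(?I powr (2 / r)) powr (r / 2) \<le> B"
      unfolding B_def using r by (intro powr_mono2) auto
    then show ?thesis using r I by (simp add: powr_powr)
  qed
  have i0: "integrable lborel (\<lambda>x. \<bar>\<phi>0 x\<bar> powr r)" and B0: "(\<integral>x. \<bar>\<phi>0 x\<bar> powr r \<partial>lborel) \<le> B"
  proof -
    have 3: "AE x in lborel. (\<lambda>n. \<bar>\<phi> n x\<bar> powr r) \<longlonglongrightarrow> \<bar>\<phi>0 x\<bar> powr r"
      using lim by eventually_elim (use r in \<open>auto intro!: tendsto_powr' tendsto_intros\<close>)
    show "integrable lborel (\<lambda>x. \<bar>\<phi>0 x\<bar> powr r)"
      by (rule Fatou_bounded[OF \<phi>(2) _ Bn 3]) auto
    show "(\<integral>x. \<bar>\<phi>0 x\<bar> powr r \<partial>lborel) \<le> B"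
      by (rule Fatou_bounded[OF \<phi>(2) _ Bn 3]) auto
  qed
  show "integrable lborel (\<lambda>x. \<bar>\<phi>0 x\<bar> powr r)" by (rule i0)
  define a where "a = (\<lambda>n x. \<phi> n x - \<phi>0 x)"
  have fa: "fin_energy s (a n)" for n unfolding a_def by (rule fin_energy_diff[OF \<phi>(1) fe0])
  show "(\<lambda>n. form s u (\<phi> n)) \<longlonglongrightarrow> form s u \<phi>0" if u: "fin_energy s u" for u
  proof -
    have [measurable]: "u \<in> borel_measurable borel" "a n \<in> borel_measurable borel" for n
      using u fa by (auto intro: fin_energy_measurable)
    define b where "b = (\<lambda>n p. dif u p * dif (a n) p * ker2 s p)"
    define H where "H = (\<lambda>n p. (dif (a n) p)\<^sup>2 * ker2 s p)"
    have "(\<lambda>n. \<integral>p. b n p \<partial>lborel2) \<longlonglongrightarrow> 0"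
    proof (rule integral_abs_tendsto_zero(2))
      show "b n \<in> borel_measurable lborel2" for n unfolding b_def by measurable
      show "AE p in lborel2. (\<lambda>n. b n p) \<longlonglongrightarrow> 0"
        using lim2
      proof eventually_elim
        case (elim p)
        have "dif (a n) p = dif (\<phi> n) p - dif \<phi>0 p" for n by (simp add: a_def)
        then have "(\<lambda>n. dif (a n) p) \<longlonglongrightarrow> 0" using LIM_zero[OF elim] by simp
        then have "(\<lambda>n. dif u p * dif (a n) p * ker2 s p) \<longlonglongrightarrow> dif u p * 0 * ker2 s p"
          by (intro tendsto_intros)
        then show ?case by (simp add: b_def)
      qed
      show "integrable lborel2 (H n)" for n using fa by (simp add: H_def fin_energy_def)
      show "0 \<le> H n p" for n p by (simp add: H_def)
      show "(\<integral>p. H n p \<partial>lborel2) \<le> 4 * A" for n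
      proof -
        have "(\<integral>p. H n p \<partial>lborel2) = form s (a n) (a n)" by (simp add: H_def form_self)
        also have "\<dots> \<le> 2 * form s (\<phi> n) (\<phi> n) + 2 * form s \<phi>0 \<phi>0"
          unfolding a_def by (rule form_diff_le[OF \<phi>(1) fe0])
        finally show ?thesis using bd[of n] en0 unfolding form_self[of s \<phi>0] by linarith
      qed
      \<comment> \<open>Completing the square: \<open>\<bar>c * e\<bar> \<le> c\<^sup>2 / (4 *
        \<delta>) + \<delta> * e\<^sup>2\<close>, with the large factor on the increment of the
        fixed \<open>u\<close>.\<close>
      show "\<exists>W. integrable lborel2 W \<and> (\<forall>n p. \<bar>b n p\<bar> \<le> W p + \<delta> * H n p)" if d: "0 < \<delta>" for \<delta>
      proof (intro exI conjI allI)
        show "integrable lborel2 (\<lambda>p. 1 / (4 * \<delta>) * ((dif u p)\<^sup>2 * ker2 s p))"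
          using u unfolding fin_energy_def by (intro integrable_mult_right) auto
        have "\<bar>c * e * k\<bar> \<le> 1 / (4 * \<delta>) * (c\<^sup>2 * k) + \<delta> * (e\<^sup>2 * k)" if "0 \<le> k" for c e k :: real
        proof -
          have "0 \<le> (\<bar>c\<bar> - 2 * \<delta> * \<bar>e\<bar>)\<^sup>2 / (4 * \<delta>)" using d by simp
          also have "\<dots> = 1 / (4 * \<delta>) * c\<^sup>2 + \<delta> * e\<^sup>2 - \<bar>c * e\<bar>"
            using d by (simp add: power2_diff power_mult_distrib abs_mult field_simps) (simp add: power2_eq_square)
          finally have "\<bar>c * e\<bar> \<le> 1 / (4 * \<delta>) * c\<^sup>2 + \<delta> * e\<^sup>2" by simp
          from mult_right_mono[OF this that] show ?thesis using that by (simp add: abs_mult algebra_simps)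
        qed
        then show "\<bar>b n p\<bar> \<le> 1 / (4 * \<delta>) * ((dif u p)\<^sup>2 * ker2 s p) + \<delta> * H n p" for n p
          unfolding b_def H_def by simp
      qed
    qed
    moreover have "(\<integral>p. b n p \<partial>lborel2) = form s u (\<phi> n) - form s u \<phi>0" for n
    proof -
      have "(\<integral>p. b n p \<partial>lborel2) = (\<integral>p. dif u p * dif (\<phi> n) p * ker2 s p - dif u p * dif \<phi>0 p * ker2 s p \<partial>lborel2)"
        by (rule Bochner_Integration.integral_cong) (auto simp: b_def a_def algebra_simps)
      also have "\<dots> = form s u (\<phi> n) - form s u \<phi>0"
        unfolding form_def by (rule Bochner_Integration.integral_diff) (intro form_integrable u \<phi>(1) fe0)+
      finally show ?thesis .
    qed
    ultimately show ?thesis by (simp add: LIM_zero_iff)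
  qed
  show "(\<lambda>n. \<integral>x. F x * \<phi> n x \<partial>lborel) \<longlonglongrightarrow> (\<integral>x. F x * \<phi>0 x \<partial>lborel)"
    if [measurable]: "F \<in> borel_measurable borel" and F: "integrable lborel (\<lambda>x. \<bar>F x\<bar> powr (r / (r - 1)))" for F
  proof -
    have [measurable]: "a n \<in> borel_measurable borel" for n
      using fa by (auto intro: fin_energy_measurable)
    define H where "H = (\<lambda>n x. 2 powr r * (\<bar>\<phi> n x\<bar> powr r + \<bar>\<phi>0 x\<bar> powr r))"
    have iH: "integrable lborel (H n)" for n using \<phi>(2) i0 by (auto simp: H_def)
    have "(\<lambda>n. \<integral>x. F x * a n x \<partial>lborel) \<longlonglongrightarrow> 0"
    proof (rule integral_abs_tendsto_zero(2))
      show "(\<lambda>x. F x * a n x) \<in> borel_measurable lborel" for n by measurable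
      show "AE x in lborel. (\<lambda>n. F x * a n x) \<longlonglongrightarrow> 0"
        using lim
      proof eventually_elim
        case (elim x)
        then have "(\<lambda>n. F x * a n x) \<longlonglongrightarrow> F x * 0"
          unfolding a_def by (intro tendsto_intros LIM_zero)
        then show ?case by simp
      qed
      show "integrable lborel (H n)" for n by (rule iH)
      show "0 \<le> H n x" for n x by (simp add: H_def)
      show "(\<integral>x. H n x \<partial>lborel) \<le> 2 powr r * (B + B)" for n
        using Bn[of n] B0 \<phi>(2) i0 by (simp add: H_def)
      show "\<exists>W. integrable lborel W \<and> (\<forall>n x. \<bar>F x * a n x\<bar> \<le> W x + \<delta> * H n x)" if d: "0 < \<delta>" for \<delta>
      proof (intro exI conjI allI)
        let ?c = "(1 / \<delta> powr (1 / r)) powr (r / (r - 1))"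
        show "integrable lborel (\<lambda>x. ?c * \<bar>F x\<bar> powr (r / (r - 1)))" using F by auto
        fix n x
        have "\<bar>F x * a n x\<bar> \<le> ?c * \<bar>F x\<bar> powr (r / (r - 1)) + \<delta> * \<bar>a n x\<bar> powr r"
          using r by (intro Young_delta d) auto
        also have "\<delta> * \<bar>a n x\<bar> powr r \<le> \<delta> * H n x"
          unfolding a_def H_def using d r by (intro mult_left_mono powr_diff_le) auto
        finally show "\<bar>F x * a n x\<bar> \<le> ?c * \<bar>F x\<bar> powr (r / (r - 1)) + \<delta> * H n x" by simp
      qed
    qed
    moreover have "(\<integral>x. F x * a n x \<partial>lborel) = (\<integral>x. F x * \<phi> n x \<partial>lborel) - (\<integral>x. F x * \<phi>0 x \<partial>lborel)" for n
    proof -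
      have "(\<integral>x. F x * a n x \<partial>lborel) = (\<integral>x. F x * \<phi> n x - F x * \<phi>0 x \<partial>lborel)"
        by (rule Bochner_Integration.integral_cong) (auto simp: a_def algebra_simps)
      also have "\<dots> = (\<integral>x. F x * \<phi> n x \<partial>lborel) - (\<integral>x. F x * \<phi>0 x \<partial>lborel)"
        using r F \<phi>(2) i0 by (intro Bochner_Integration.integral_diff integrable_Young[of r]) auto
      finally show ?thesis .
    qed
    ultimately show ?thesis by (simp add: LIM_zero_iff)
  qed
qed

section \<open>Lipschitz functions with bounded support as test functions\<close>

text \<open>Unlike the smooth test functions, this class is closed under truncation, multiplication
  by cut-offs, and the one-sided positive part of a reflected difference. It is shown to contain the
  smooth test functions and to lie inside \<open>dotH\<close>.\<close>

definition lip_cs :: "('a::euclidean_space \<Rightarrow> real) \<Rightarrow> bool" where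
  "lip_cs f \<longleftrightarrow> (\<exists>L. L-lipschitz_on UNIV f) \<and> bounded {x. f x \<noteq> 0}"

text \<open>A common integrable majorant for the energy densities of all functions supported in
  \<open>B\<close> with fixed Lipschitz constant and bound. For fixed \<open>x\<close> the
  substitution \<open>y = x + h\<close> leaves the integral of \<open>integrable_ker\<close> times
  the volume of \<open>B\<close>.\<close>

lemma integrable_ker_dominant:
  fixes B :: "'a::euclidean_space set"
  assumes s: "0 < s" "s < 1" and [measurable]: "B \<in> sets borel" and B: "bounded B"
  shows "integrable lborel2 (\<lambda>p. (indicator B (fst p) + indicator B (snd p)) * (min 1 ((norm (fst p - snd p))\<^sup>2) * ker2 s p))"
proof -
  define m where "m = (\<lambda>h::'a. min 1 ((norm h)\<^sup>2) * ker s h)"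
  have [measurable]: "m \<in> borel_measurable borel" unfolding m_def by measurable
  have m0: "0 \<le> m h" for h by (simp add: m_def)
  have ms: "m (x - y) = m (y - x)" for x y by (simp add: m_def norm_minus_commute ker_commute)
  have mm: "m (- h) = m h" for h by (simp add: m_def)
  have im: "integrable lborel m" unfolding m_def by (rule integrable_ker[OF s])
  have 1: "integrable lborel2 (\<lambda>p. indicator B (fst p) * m (fst p - snd p))"
  proof (rule integrableI_nonneg)
    have "(\<integral>\<^sup>+p. ennreal (indicator B (fst p) * m (fst p - snd p)) \<partial>lborel2)
       = (\<integral>\<^sup>+x. \<integral>\<^sup>+y. ennreal (indicator B x * m (x - y)) \<partial>lborel \<partial>lborel)"
      by (subst lborel.nn_integral_fst[symmetric]) auto
    also have "\<dots> = (\<integral>\<^sup>+x. ennreal (\<integral>h. m h \<partial>lborel) * indicator B x \<partial>lborel)"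
    proof (intro nn_integral_cong)
      fix x
      have "(\<integral>\<^sup>+y. ennreal (indicator B x * m (x - y)) \<partial>lborel) = (\<integral>\<^sup>+h. ennreal (indicator B x * m (x - (x + h))) \<partial>lborel)"
        by (rule nn_integral_lborel_translate[symmetric]) measurable
      also have "\<dots> = (\<integral>\<^sup>+h. indicator B x * ennreal (m h) \<partial>lborel)"
        by (intro nn_integral_cong) (simp add: mm indicator_def)
      also have "\<dots> = indicator B x * (\<integral>\<^sup>+h. ennreal (m h) \<partial>lborel)"
        by (rule nn_integral_cmult) measurable
      also have "(\<integral>\<^sup>+h. ennreal (m h) \<partial>lborel) = ennreal (\<integral>h. m h \<partial>lborel)"
        by (rule nn_integral_eq_integral[OF im]) (simp add: m0)
      finally show "(\<integral>\<^sup>+y. ennreal (indicator B x * m (x - y)) \<partial>lborel) = ennreal (\<integral>h. m h \<partial>lborel) * indicator B x"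
        by (simp add: mult.commute)
    qed
    also have "\<dots> = ennreal (\<integral>h. m h \<partial>lborel) * emeasure lborel B"
      by (simp add: nn_integral_cmult_indicator)
    also have "\<dots> < \<infinity>"
      using emeasure_bounded_finite[OF B] by (simp add: ennreal_mult_less_top)
    finally show "(\<integral>\<^sup>+p. ennreal (indicator B (fst p) * m (fst p - snd p)) \<partial>lborel2) < \<infinity>" .
  qed (auto simp: m0)
  \<comment> \<open>Exchanging the two coordinates is an isometric involution of the product
    space.\<close>
  have sw: "distr lborel2 lborel2 (\<lambda>p. (snd p, fst p)) = (lborel2 :: ('a \<times> 'a) measure)"
  proof -
    have "distr lborel2 lborel2 (\<lambda>p. (snd p, fst p)) = distr lborel borel (\<lambda>p::'a \<times> 'a. (snd p, fst p))"
      unfolding lborel_prod by (rule distr_cong) auto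
    also have "\<dots> = lborel"
      by (rule distr_isometric_involution) (auto simp: dist_prod_def add.commute)
    finally show ?thesis by (simp add: lborel_prod)
  qed
  have "integrable lborel2 (\<lambda>p. indicator B (snd p) * m (snd p - fst p))"
    using measure_preserving_integral(1)[OF sw, of "\<lambda>p. indicator B (fst p) * m (fst p - snd p)"] 1 by simp
  then have 2: "integrable lborel2 (\<lambda>p. indicator B (snd p) * m (fst p - snd p))"
    by (subst ms)
  show ?thesis using Bochner_Integration.integrable_add[OF 1 2] by (simp add: m_def distrib_right)
qed

lemma lip_cs_measurable: "lip_cs f \<Longrightarrow> f \<in> borel_measurable borel"
  unfolding lip_cs_def using borel_measurable_continuous_onI lipschitz_on_continuous_on by blast

text \<open>For nearby points the Lipschitz constant is used, for distant ones the bound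
  \<open>2 * M\<close> on the increment; if both points miss \<open>B\<close> there is nothing to
  estimate.\<close>

lemma lip_bounded_energy_bound:
  fixes f :: "'a::euclidean_space \<Rightarrow> real"
  assumes L: "L-lipschitz_on UNIV f" and M: "\<And>x. \<bar>f x\<bar> \<le> M" and B: "{x. f x \<noteq> 0} \<subseteq> B"
  shows "(f x - f y)\<^sup>2 * ker s (x - y) \<le>
    max (L\<^sup>2) (4 * M\<^sup>2) * ((indicator B x + indicator B y) * (min 1 ((norm (x - y))\<^sup>2) * ker s (x - y)))"
proof (cases "x \<in> B \<or> y \<in> B")
  case True
  let ?C = "max (L\<^sup>2) (4 * M\<^sup>2)"
  have 1: "(f x - f y)\<^sup>2 \<le> L\<^sup>2 * (norm (x - y))\<^sup>2"
  proof -
    have "\<bar>f x - f y\<bar> \<le> L * norm (x - y)"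
      using lipschitz_onD[OF L, of x y] by (simp add: dist_norm)
    then have "\<bar>f x - f y\<bar>\<^sup>2 \<le> (L * norm (x - y))\<^sup>2" by (rule power_mono) simp
    then show ?thesis by (simp add: power_mult_distrib)
  qed
  have 2: "(f x - f y)\<^sup>2 \<le> 4 * M\<^sup>2"
  proof -
    have "\<bar>f x - f y\<bar> \<le> 2 * M" using M[of x] M[of y] by linarith
    then have "\<bar>f x - f y\<bar>\<^sup>2 \<le> (2 * M)\<^sup>2" by (rule power_mono) simp
    then show ?thesis by (simp add: power_mult_distrib)
  qed
  have "(f x - f y)\<^sup>2 \<le> ?C * min 1 ((norm (x - y))\<^sup>2)"
  proof (cases "1 \<le> (norm (x - y))\<^sup>2")
    case True then show ?thesis using 2 by simp
  next
    case False
    have "L\<^sup>2 * (norm (x - y))\<^sup>2 \<le> ?C * (norm (x - y))\<^sup>2" by (intro mult_right_mono) auto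
    with False 1 show ?thesis by (simp add: min_def)
  qed
  then have "(f x - f y)\<^sup>2 * ker s (x - y) \<le> ?C * min 1 ((norm (x - y))\<^sup>2) * ker s (x - y)"
    by (rule mult_right_mono) simp
  also have "\<dots> = ?C * (1 * (min 1 ((norm (x - y))\<^sup>2) * ker s (x - y)))" by simp
  also have "\<dots> \<le> ?C * ((indicator B x + indicator B y) * (min 1 ((norm (x - y))\<^sup>2) * ker s (x - y)))"
    using True by (intro mult_left_mono mult_right_mono) (auto simp: indicator_def le_max_iff_disj)
  finally show ?thesis .
next
  case False
  then have "f x = 0" "f y = 0" using B by auto
  with False show ?thesis by simp
qed

lemma lip_cs_bounded:
  assumes "lip_cs f"
  obtains L M R where "L-lipschitz_on UNIV f" "\<And>x. \<bar>f x\<bar> \<le> M" "0 < R" "{x. f x \<noteq> 0} \<subseteq> cball 0 R"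
proof -
  obtain L where L: "L-lipschitz_on UNIV f" using assms by (auto simp: lip_cs_def)
  obtain R where R: "0 < R" "{x. f x \<noteq> 0} \<subseteq> cball 0 R"
    using assms unfolding lip_cs_def bounded_pos by (force simp: subset_iff)
  have "compact (f ` cball 0 R)"
    using lipschitz_on_continuous_on[OF L] by (intro compact_continuous_image) (auto intro: continuous_on_subset)
  then obtain M where M: "\<And>x. x \<in> cball 0 R \<Longrightarrow> \<bar>f x\<bar> \<le> M" "0 < M"
    using compact_imp_bounded bounded_pos by (metis imageI real_norm_def)
  have "\<bar>f x\<bar> \<le> M" for x using M R by (cases "f x = 0") auto
  with L R that show ?thesis by blast
qed

lemma lip_cs_fin_energy:
  assumes s: "0 < s" "s < 1" and f: "lip_cs f"
  shows "fin_energy s f"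
proof -
  obtain L M R where L: "L-lipschitz_on UNIV f" "\<And>x. \<bar>f x\<bar> \<le> M" "0 < R" "{x. f x \<noteq> 0} \<subseteq> cball 0 R"
    using lip_cs_bounded[OF f] by blast
  have "integrable lborel2 (\<lambda>p. max (L\<^sup>2) (4 * M\<^sup>2) * ((indicator (cball 0 R) (fst p) + indicator (cball 0 R) (snd p)) * (min 1 ((norm (fst p - snd p))\<^sup>2) * ker2 s p)))"
    by (intro integrable_mult_right integrable_ker_dominant s) auto
  then show ?thesis
    by (rule fin_energy_dominated) (use lip_cs_measurable[OF f] lip_bounded_energy_bound[OF L(1,2,4)] in auto)
qed

lemma lip_cs_integrable_powr:
  assumes f: "lip_cs (f :: 'a::euclidean_space \<Rightarrow> real)" and r: "0 < r"
  shows "integrable lborel (\<lambda>x. \<bar>f x\<bar> powr r)"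
proof -
  obtain L M R where L: "L-lipschitz_on UNIV f" "\<And>x. \<bar>f x\<bar> \<le> M" "0 < R" "{x. f x \<noteq> 0} \<subseteq> cball 0 R"
    using lip_cs_bounded[OF f] by blast
  have [measurable]: "f \<in> borel_measurable borel" by (rule lip_cs_measurable[OF f])
  have i: "integrable lborel (\<lambda>x::'a. M powr r * indicator (cball 0 R) x)"
    by (intro integrable_mult_right integrable_real_indicator) (auto simp: emeasure_cball less_top[symmetric] L(3) less_imp_le)
  show ?thesis
  proof (rule Bochner_Integration.integrable_bound[OF i])
    have "\<bar>f x\<bar> powr r \<le> M powr r * indicator (cball 0 R) x" for x
    proof (cases "f x = 0")
      case False
      then have "x \<in> cball 0 R" using L(4) by blast
      then show ?thesis using r L(2)[of x] by (simp add: powr_mono2)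
    qed (auto simp: indicator_def)
    then show "AE x in lborel. norm (\<bar>f x\<bar> powr r) \<le> norm (M powr r * indicator (cball 0 R) x)" by auto
  qed measurable
qed

section \<open>Smooth approximation of Lipschitz functions\<close>

text \<open>The classical flat function together with its quotients by powers of \<open>t\<close>;
  the linear span of this family is closed under differentiation.\<close>

definition flat :: "nat \<Rightarrow> real \<Rightarrow> real" where
  "flat m t = (if 0 < t then exp (- 1 / t) / t ^ m else 0)"

lemma flat_nonneg [simp]: "0 \<le> flat m t"
  by (simp add: flat_def)

lemma flat_add: "flat m t = t ^ k * flat (m + k) t"
  by (simp add: flat_def power_add)

text \<open>The estimate \<open>(1 + x / n) ^ n \<le> exp x\<close> with \<open>x = 1 / t\<close>
  and \<open>n = m + 2\<close> beats the pole of order \<open>m\<close> by two powers of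
  \<open>t\<close>. A quadratic bound is what makes the derivative at \<open>0\<close>
  vanish.\<close>

lemma flat_bound: "flat m t \<le> real (m + 2) ^ (m + 2) * t\<^sup>2"
proof (cases "0 < t")
  case True
  let ?n = "m + 2"
  have "(1 / (t * real ?n)) ^ ?n \<le> (1 + (1 / t) / real ?n) ^ ?n"
    using True by (intro power_mono) auto
  also have "\<dots> \<le> exp (1 / t)"
    using True by (intro exp_ge_one_plus_x_over_n_power_n) (auto intro: order_trans[of _ 0])
  finally have le: "(1 / (t * real ?n)) ^ ?n \<le> exp (1 / t)" .
  have "exp (- 1 / t) = inverse (exp (1 / t))" by (simp add: exp_minus)
  also have "\<dots> \<le> inverse ((1 / (t * real ?n)) ^ ?n)"
    by (intro le_imp_inverse_le le zero_less_power) (use True in auto)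
  also have "\<dots> = (t * real ?n) ^ ?n" by (simp only: power_one_over inverse_eq_divide) simp
  finally have "exp (- 1 / t) \<le> (t * real ?n) ^ ?n" .
  then have "exp (- 1 / t) / t ^ m \<le> (t * real ?n) ^ ?n / t ^ m"
    using True by (intro divide_right_mono) auto
  also have "\<dots> = real ?n ^ ?n * t\<^sup>2"
    using True by (simp add: power_mult_distrib power_add power2_eq_square)
  finally show ?thesis using True by (simp add: flat_def)
qed (simp add: flat_def)

lemma flat_has_derivative:
  "(flat m has_real_derivative (flat (m + 2) t - real m * flat (m + 1) t)) (at t)"
proof -
  consider "0 < t" | "t < 0" | "t = 0" by linarith
  then show ?thesis
  proof cases
    case 1
    have "((\<lambda>t. exp (- 1 / t) / t ^ m) has_real_derivative (flat (m + 2) t - real m * flat (m + 1) t)) (at t)"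
    proof (cases m)
      case 0
      then show ?thesis using 1
        by (auto intro!: derivative_eq_intros simp: flat_def power2_eq_square)
    next
      case (Suc k)
      then show ?thesis using 1
      proof -
        define a e where "a = t ^ k" and "e = exp (- 1 / t)"
        have a: "0 < a" using 1 by (simp add: a_def)
        have d1: "((\<lambda>t. exp (- 1 / t)) has_real_derivative e / t\<^sup>2) (at t)"
          unfolding e_def using 1 by (auto intro!: derivative_eq_intros simp: power2_eq_square)
        have d2: "((\<lambda>t. t ^ Suc k) has_real_derivative real (Suc k) * a) (at t)"
          unfolding a_def using DERIV_power_Suc[of "\<lambda>t. t" 1 t UNIV k] by simp
        have "((\<lambda>t. exp (- 1 / t) / t ^ Suc k) has_real_derivative
           (e / t\<^sup>2 * (t * a) - e * (real (Suc k) * a)) / ((t * a) * (t * a))) (at t)"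
          using DERIV_divide[OF d1 d2] 1 by (simp add: a_def e_def)
        moreover have "flat (m + 2) t = e / (t * t * (t * a))" "flat (m + 1) t = e / (t * (t * a))"
          using 1 Suc by (simp_all add: flat_def a_def e_def)
        moreover have "(e / t\<^sup>2 * (t * a) - e * (real (Suc k) * a)) / ((t * a) * (t * a))
           = e / (t * t * (t * a)) - real (Suc k) * (e / (t * (t * a)))"
          using 1 a by (simp add: field_simps power2_eq_square)
        ultimately show ?thesis using Suc by simp
      qed
    qed
    then show ?thesis
      by (rule has_field_derivative_transform_within_open[where S="{0<..}"]) (use 1 in \<open>auto simp: flat_def\<close>)
  next
    case 2
    have "((\<lambda>t. 0) has_real_derivative (flat (m + 2) t - real m * flat (m + 1) t)) (at t)"
      using 2 by (simp add: flat_def)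
    then show ?thesis
      by (rule has_field_derivative_transform_within_open[where S="{..<0}"]) (use 2 in \<open>auto simp: flat_def\<close>)
  next
    case 3
    have lim0: "((\<lambda>h. real (m + 2) ^ (m + 2) * \<bar>h\<bar>) \<longlongrightarrow> 0) (at 0)"
      by (auto intro!: tendsto_eq_intros)
    have "norm ((flat m (0 + h) - flat m 0) / h) \<le> real (m + 2) ^ (m + 2) * \<bar>h\<bar>" for h
    proof (cases "h = 0")
      case False
      have "flat m h / \<bar>h\<bar> \<le> real (m + 2) ^ (m + 2) * h\<^sup>2 / \<bar>h\<bar>"
        by (intro divide_right_mono flat_bound) simp
      also have "\<dots> = real (m + 2) ^ (m + 2) * \<bar>h\<bar>"
        using False by (simp add: power2_eq_square abs_if field_simps)
      finally show ?thesis by (simp add: flat_def[of _ 0] abs_divide)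
    qed simp
    then have "((\<lambda>h. (flat m (0 + h) - flat m 0) / h) \<longlongrightarrow> 0) (at 0)"
      by (intro Lim_null_comparison[OF always_eventually lim0]) auto
    then have "(flat m has_real_derivative 0) (at 0)" unfolding DERIV_def .
    with 3 show ?thesis by (simp add: flat_def)
  qed
qed

lemma real_polynomial_function_has_derivative:
  fixes Q :: "'a::real_normed_vector \<Rightarrow> real"
  assumes "real_polynomial_function Q"
  shows "\<exists>Q'. (\<forall>x. (Q has_derivative Q' x) (at x)) \<and> (\<forall>b. real_polynomial_function (\<lambda>x. Q' x b))"
  using assms
proof induction
  case (linear f)
  then show ?case
    by (intro exI[of _ "\<lambda>_. f"]) (auto intro: bounded_linear_imp_has_derivative)
next
  case (const c)
  then show ?case by (intro exI[of _ "\<lambda>_ _. 0"]) auto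
next
  case (add f g)
  then obtain f' g' where "\<forall>x. (f has_derivative f' x) (at x)" "\<forall>b. real_polynomial_function (\<lambda>x. f' x b)"
    "\<forall>x. (g has_derivative g' x) (at x)" "\<forall>b. real_polynomial_function (\<lambda>x. g' x b)" by auto
  then show ?case
    by (intro exI[of _ "\<lambda>x b. f' x b + g' x b"]) (auto intro!: has_derivative_add)
next
  case (mult f g)
  then obtain f' g' where *: "\<forall>x. (f has_derivative f' x) (at x)" "\<forall>b. real_polynomial_function (\<lambda>x. f' x b)"
    "\<forall>x. (g has_derivative g' x) (at x)" "\<forall>b. real_polynomial_function (\<lambda>x. g' x b)" by auto
  show ?case
    by (intro exI[of _ "\<lambda>x b. f x * g' x b + f' x b * g x"] conjI allI)
      (use * mult.hyps in \<open>auto intro!: has_derivative_mult real_polynomial_function.intros(3) real_polynomial_function.intros(4)\<close>)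
qed

lemma real_polynomial_inner:
  "real_polynomial_function (\<lambda>x::'a::euclidean_space. x \<bullet> b)"
  "real_polynomial_function (\<lambda>x::'a::euclidean_space. x \<bullet> x)"
proof -
  show "real_polynomial_function (\<lambda>x::'a. x \<bullet> b)" for b
    by (rule real_polynomial_function.intros(1)) (rule bounded_linear_inner_left)
  show "real_polynomial_function (\<lambda>x::'a. x \<bullet> x)"
  proof -
    have "(\<lambda>x::'a. x \<bullet> x) = (\<lambda>x. \<Sum>b\<in>Basis. (x \<bullet> b) * (x \<bullet> b))"
      by (rule ext) (rule euclidean_inner)
    then show ?thesis
    by (elim ssubst) (intro real_polynomial_function_sum real_polynomial_function.intros(4) finite_Basis \<open>\<And>b. real_polynomial_function (\<lambda>x::'a. x \<bullet> b)\<close>)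
  qed
qed

lemma Ck_SucI:
  fixes f :: "'a::euclidean_space \<Rightarrow> real"
  assumes "\<And>x. (f has_derivative D x) (at x)" "\<And>b. b \<in> Basis \<Longrightarrow> Ck k (\<lambda>x. D x b)"
  shows "Ck (Suc k) f"
proof -
  have "frechet_derivative f (at x) = D x" for x
    using frechet_derivative_at[OF assms(1)[of x]] by simp
  then show ?thesis using assms by (auto simp: differentiable_def)
qed

text \<open>A partial derivative of a polynomial times \<open>flat m\<close> is a polynomial times
  \<open>flat (m + 2)\<close>, so the induction on \<open>k\<close> closes once \<open>Q\<close> and
  \<open>m\<close> are left arbitrary.\<close>

lemma Ck_bump:
  fixes Q :: "'a::euclidean_space \<Rightarrow> real"
  assumes "real_polynomial_function Q"
  shows "Ck k (\<lambda>x. Q x * flat m (c - x \<bullet> x))"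
  using assms
proof (induction k arbitrary: Q m)
  case (Suc k)
  obtain Q' where Q': "\<And>x. (Q has_derivative Q' x) (at x)" "\<And>b. real_polynomial_function (\<lambda>x. Q' x b)"
    using real_polynomial_function_has_derivative[OF Suc.prems] by blast
  \<comment> \<open>The polynomial left after rewriting \<open>flat m\<close> and
    \<open>flat (m + 1)\<close> as \<open>t\<^sup>2\<close> and \<open>t\<close> times
    \<open>flat (m + 2)\<close>.\<close>
  define P where "P = (\<lambda>b x. Q' x b * (c - x \<bullet> x)\<^sup>2 + Q x * ((1 - real m * (c - x \<bullet> x)) * (- (2 * (x \<bullet> b)))))"
  show ?case
  proof (rule Ck_SucI)
    fix x :: 'a
    let ?t = "c - x \<bullet> x"
    have t: "((\<lambda>x. c - x \<bullet> x) has_derivative (\<lambda>b. - (2 * (x \<bullet> b)))) (at x)"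
      by (auto intro!: derivative_eq_intros simp: inner_commute)
    have "((\<lambda>x. flat m (c - x \<bullet> x)) has_derivative (\<lambda>b. - (2 * (x \<bullet> b)) * (flat (m + 2) ?t - real m * flat (m + 1) ?t))) (at x)"
      using has_derivative_compose[OF t, of "flat m" "(*) (flat (m + 2) ?t - real m * flat (m + 1) ?t)"] flat_has_derivative[of m ?t]
      by (simp add: has_field_derivative_def mult.commute)
    from has_derivative_mult[OF Q'(1)[of x] this]
    have "((\<lambda>x. Q x * flat m (c - x \<bullet> x)) has_derivative
        (\<lambda>b. Q x * (- (2 * (x \<bullet> b)) * (flat (m + 2) ?t - real m * flat (m + 1) ?t)) + Q' x b * flat m ?t)) (at x)" .
    also have "(\<lambda>b. Q x * (- (2 * (x \<bullet> b)) * (flat (m + 2) ?t - real m * flat (m + 1) ?t)) + Q' x b * flat m ?t)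
        = (\<lambda>b. P b x * flat (m + 2) ?t)"
    proof -
      define t F where "t = ?t" and "F = flat (m + 2) t"
      have F: "flat m t = t\<^sup>2 * F" "flat (m + 1) t = t * F"
        using flat_add[of m t 2] flat_add[of "m + 1" t 1] by (simp_all add: F_def)
      show ?thesis unfolding P_def t_def[symmetric] F F_def[symmetric]
        by (simp add: fun_eq_iff algebra_simps)
    qed
    finally show "((\<lambda>x. Q x * flat m (c - x \<bullet> x)) has_derivative (\<lambda>b. P b x * flat (m + 2) ?t)) (at x)" .
  next
    fix b :: 'a assume "b \<in> Basis"
    have "real_polynomial_function (P b)"
      unfolding P_def by (intro real_polynomial_function.intros(3) real_polynomial_function.intros(4) Q' Suc.prems
          real_polynomial_function_power real_polynomial_function_diff real_polynomial_function_minus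
          real_polynomial_function.intros(2) real_polynomial_inner)
    then show "Ck k (\<lambda>x. P b x * flat (m + 2) (c - x \<bullet> x))" by (rule Suc.IH)
  qed
next
  case 0
  have "isCont (flat m) t" for t
    using flat_has_derivative DERIV_isCont by blast
  then have "continuous_on UNIV (flat m)" by (simp add: continuous_at_imp_continuous_on)
  then have "continuous_on UNIV (\<lambda>x::'a. flat m (c - x \<bullet> x))"
    by (rule continuous_on_compose2) (auto intro!: continuous_intros)
  moreover have "continuous_on UNIV Q"
    using real_polynomial_function_has_derivative[OF 0] by (auto intro: has_derivative_continuous_on)
  ultimately show ?case by (auto intro: continuous_on_mult)
qed

lemma Ck_imp_continuous: "Ck k f \<Longrightarrow> continuous_on UNIV f"
  by (cases k) (auto intro!: differentiable_imp_continuous_on simp: differentiable_on_def)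

text \<open>Differentiation under the integral puts every derivative on \<open>\<rho>\<close>, whose
  partial derivatives are again smooth; hence the induction with \<open>\<rho>\<close> arbitrary. A
  fixed box suffices because the functions to be mollified vanish outside one.\<close>

lemma Ck_convolution:
  fixes \<rho> \<phi> :: "'a::euclidean_space \<Rightarrow> real"
  assumes "\<And>j. Ck j \<rho>" and \<phi>: "continuous_on UNIV \<phi>"
  shows "Ck k (\<lambda>x. integral (cbox a b) (\<lambda>y. \<phi> y * \<rho> (x - y)))"
  using assms(1)
proof (induction k arbitrary: \<rho>)
  case 0
  have c\<rho>: "continuous_on UNIV \<rho>" using Ck_imp_continuous[OF 0[of 0]] .
  have "continuous_on (UNIV \<times> cbox a b) (\<lambda>(x, y). \<phi> y * \<rho> (x - y))"
    unfolding split_beta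
    by (intro continuous_on_mult continuous_on_compose2[OF \<phi>] continuous_on_compose2[OF c\<rho>] continuous_intros) auto
  from integral_continuous_on_param[OF this] show ?case by simp
next
  case (Suc k)
  define D where "D = (\<lambda>z. frechet_derivative \<rho> (at z))"
  define D' where "D' = (\<lambda>z. Blinfun (D z))"
  have dif: "(\<rho> has_derivative D z) (at z)" for z
    using Suc.prems[of "Suc 0"] unfolding D_def by (simp add: frechet_derivative_works)
  have D': "blinfun_apply (D' z) = D z" for z
    unfolding D'_def by (rule bounded_linear_Blinfun_apply) (use dif in \<open>rule has_derivative_bounded_linear\<close>)
  have CD: "Ck j (\<lambda>z. D z i)" if "i \<in> Basis" for i j
    using Suc.prems[of "Suc j"] that by (simp add: D_def)
  have contD: "continuous_on UNIV D'"
    by (rule continuous_on_blinfun_componentwise) (use Ck_imp_continuous[OF CD] in \<open>simp add: D'\<close>)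
  define fx where "fx = (\<lambda>x y. \<phi> y *\<^sub>R D' (x - y))"
  have contfx: "continuous_on (UNIV \<times> cbox a b) (\<lambda>(x, y). fx x y)"
    unfolding split_beta fx_def
    by (intro continuous_on_scaleR continuous_on_compose2[OF \<phi>] continuous_on_compose2[OF contD] continuous_intros) auto
  show ?case
  proof (rule Ck_SucI)
    fix x :: 'a
    have "((\<lambda>x. integral (cbox a b) (\<lambda>y. \<phi> y * \<rho> (x - y))) has_derivative integral (cbox a b) (fx x)) (at x within UNIV)"
    proof (rule leibniz_rule[OF _ _ contfx])
      fix x y :: 'a
      have "((\<lambda>x. \<rho> (x - y)) has_derivative (\<lambda>b. D (x - y) b)) (at x)"
      proof -
        have "((\<lambda>x. x - y) has_derivative (\<lambda>b. b)) (at x)" by (auto intro!: derivative_eq_intros)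
        from has_derivative_compose[OF this dif] show ?thesis .
      qed
      from has_derivative_mult_right[OF this, of "\<phi> y"]
      have "((\<lambda>x. \<phi> y * \<rho> (x - y)) has_derivative (\<lambda>b. \<phi> y * D (x - y) b)) (at x)" .
      also have "(\<lambda>b. \<phi> y * D (x - y) b) = blinfun_apply (fx x y)"
        by (simp add: fun_eq_iff fx_def blinfun.scaleR_left D')
      finally show "((\<lambda>x. \<phi> y * \<rho> (x - y)) has_derivative blinfun_apply (fx x y)) (at x within UNIV)" .
    next
      fix x :: 'a
      have "continuous_on (cbox a b) (\<lambda>y. \<phi> y * \<rho> (x - y))"
        by (intro continuous_on_mult continuous_on_subset[OF \<phi>] continuous_on_compose2[OF Ck_imp_continuous[OF Suc.prems[of 0]]] continuous_intros) auto
      then show "(\<lambda>y. \<phi> y * \<rho> (x - y)) integrable_on cbox a b" by (rule integrable_continuous)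
    qed auto
    then show "((\<lambda>x. integral (cbox a b) (\<lambda>y. \<phi> y * \<rho> (x - y))) has_derivative blinfun_apply (integral (cbox a b) (fx x))) (at x)"
      by simp
  next
    fix i :: 'a assume i: "i \<in> Basis"
    have "blinfun_apply (integral (cbox a b) (fx x)) i = integral (cbox a b) (\<lambda>y. \<phi> y * D (x - y) i)" for x
    proof -
      have "continuous_on (cbox a b) (fx x)"
      proof -
        have "continuous_on (cbox a b) (\<lambda>y. case (x, y) of (x, y) \<Rightarrow> fx x y)"
          by (rule continuous_on_compose2[OF contfx]) (auto intro!: continuous_intros)
        then show ?thesis by simp
      qed
      then have "fx x integrable_on cbox a b" by (rule integrable_continuous)
      then show ?thesis by (simp add: blinfun_apply_integral fx_def blinfun.scaleR_left D')
    qed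
    then show "Ck k (\<lambda>x. blinfun_apply (integral (cbox a b) (fx x)) i)"
      using Suc.IH[OF CD[OF i]] by simp
  qed
qed

lemma mollifier_exists:
  assumes "0 < \<delta>"
  obtains \<rho> :: "'a::euclidean_space \<Rightarrow> real" where "\<And>k. Ck k \<rho>" "\<And>x. 0 \<le> \<rho> x"
    "\<And>x. \<delta> \<le> norm x \<Longrightarrow> \<rho> x = 0" "integrable lborel \<rho>" "(\<integral>x. \<rho> x \<partial>lborel) = 1"
proof -
  define f where "f = (\<lambda>x::'a. flat 0 (\<delta>\<^sup>2 - x \<bullet> x))"
  have Ckf: "Ck k (\<lambda>x. c * f x)" for k c
    unfolding f_def by (rule Ck_bump) auto
  have cf: "continuous_on UNIV f" using Ck_imp_continuous[OF Ckf[of 0 1]] by simp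
  then have [measurable]: "f \<in> borel_measurable borel" by (rule borel_measurable_continuous_onI)
  have f0: "0 \<le> f x" for x by (simp add: f_def)
  have fz: "f x = 0" if "\<delta> \<le> norm x" for x
  proof -
    have "\<delta>\<^sup>2 \<le> x \<bullet> x" using that assms by (metis abs_le_square_iff abs_norm_cancel abs_of_pos power2_norm_eq_inner)
    then show ?thesis by (simp add: f_def flat_def)
  qed
  have fp: "0 < f x" if "norm x < \<delta>" for x
  proof -
    have "x \<bullet> x < \<delta>\<^sup>2" using that assms by (metis norm_ge_zero power2_norm_eq_inner power_strict_mono zero_less_numeral)
    then show ?thesis by (simp add: f_def flat_def)
  qed
  have "integrable lborel (\<lambda>x. indicator (cball 0 \<delta>) x *\<^sub>R f x)"
    by (rule borel_integrable_compact) (auto intro: continuous_on_subset[OF cf])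
  also have "(\<lambda>x. indicator (cball 0 \<delta>) x *\<^sub>R f x) = f"
    using fz by (auto simp: fun_eq_iff indicator_def)
  finally have fi: "integrable lborel f" .
  have "(\<integral>x. f x \<partial>lborel) \<noteq> 0"
  proof
    assume "(\<integral>x. f x \<partial>lborel) = 0"
    then have "AE x in lborel. f x = 0"
      using integral_nonneg_eq_0_iff_AE[OF fi] f0 by simp
    then have "AE x in lborel. x \<notin> ball (0::'a) \<delta>"
    proof eventually_elim
      case (elim x)
      then show ?case using fp[of x] by auto
    qed
    then have "ball 0 \<delta> \<in> null_sets (lborel :: 'a measure)"
      by (subst (asm) AE_iff_null_sets[symmetric]) auto
    moreover have "0 < unit_ball_vol (real DIM('a))" by simp
    then have "unit_ball_vol (real DIM('a)) \<noteq> 0" by linarith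
    ultimately show False using assms emeasure_ball[of \<delta> "0::'a"] by (auto simp: null_sets_def)
  qed
  moreover have "0 \<le> (\<integral>x. f x \<partial>lborel)" by (intro integral_nonneg_AE) (simp add: f0)
  ultimately have I: "0 < (\<integral>x. f x \<partial>lborel)" by simp
  show thesis
  proof (rule that[of "\<lambda>x. 1 / (\<integral>x. f x \<partial>lborel) * f x"])
    show "(\<integral>x. 1 / (\<integral>x. f x \<partial>lborel) * f x \<partial>lborel) = 1"
      using I by (subst integral_mult_right_zero) simp
    show "Ck k (\<lambda>x. 1 / (\<integral>x. f x \<partial>lborel) * f x)" for k by (rule Ckf)
    show "0 \<le> 1 / (\<integral>x. f x \<partial>lborel) * f x" for x using f0 I by simp
    show "\<delta> \<le> norm x \<Longrightarrow> 1 / (\<integral>x. f x \<partial>lborel) * f x = 0" for x using fz by simp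
    show "integrable lborel (\<lambda>x. 1 / (\<integral>x. f x \<partial>lborel) * f x)" using fi by simp
  qed
qed

text \<open>Convolution with a probability density averages translates of \<open>\<phi>\<close>, so
  the Lipschitz constant is preserved exactly and the support grows by no more than
  \<open>\<delta>\<close>.\<close>

lemma lip_cs_mollify:
  fixes \<phi> :: "'a::euclidean_space \<Rightarrow> real"
  assumes L: "L-lipschitz_on UNIV \<phi>" and R: "0 < R" "{x. \<phi> x \<noteq> 0} \<subseteq> cball 0 R" and d: "0 < \<delta>"
  obtains \<psi> where "test_function \<psi>" "L-lipschitz_on UNIV \<psi>" "\<And>x. \<bar>\<psi> x - \<phi> x\<bar> \<le> L * \<delta>"
    "{x. \<psi> x \<noteq> 0} \<subseteq> cball 0 (R + \<delta>)"
proof -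
  obtain \<rho> :: "'a \<Rightarrow> real" where \<rho>: "\<And>k. Ck k \<rho>" "\<And>x. 0 \<le> \<rho> x"
    "\<And>x. \<delta> \<le> norm x \<Longrightarrow> \<rho> x = 0" "integrable lborel \<rho>" "(\<integral>x. \<rho> x \<partial>lborel) = 1"
    using mollifier_exists[OF d] by blast
  have c\<phi>: "continuous_on UNIV \<phi>" using L by (rule lipschitz_on_continuous_on)
  have c\<rho>: "continuous_on UNIV \<rho>" using \<rho>(1)[of 0] by simp
  have lip: "lip_cs \<phi>" unfolding lip_cs_def using L R(2) bounded_cball bounded_subset by blast
  have [measurable]: "\<phi> \<in> borel_measurable borel" "\<rho> \<in> borel_measurable borel"
    using c\<phi> c\<rho> by (auto intro: borel_measurable_continuous_onI)
  obtain M where M: "\<And>x. \<bar>\<phi> x\<bar> \<le> M" using lip_cs_bounded[OF lip] by metis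
  obtain a where a: "cball (0::'a) R \<subseteq> cbox (- a) a"
    using bounded_subset_cbox_symmetric[OF bounded_cball] by blast
  define \<psi> where "\<psi> = (\<lambda>x. integral (cbox (- a) a) (\<lambda>y. \<phi> y * \<rho> (x - y)))"
  have int: "integrable lborel (\<lambda>z. \<phi> (x - z) * \<rho> z)" for x
  proof (rule Bochner_Integration.integrable_bound)
    show "integrable lborel (\<lambda>z. M * \<rho> z)" using \<rho>(4) by simp
    show "AE z in lborel. norm (\<phi> (x - z) * \<rho> z) \<le> norm (M * \<rho> z)"
      using M by (intro AE_I2) (simp add: abs_mult \<rho>(2), intro mult_right_mono order_trans[OF M abs_ge_self] \<rho>(2))
  qed measurable
  have \<psi>: "\<psi> x = (\<integral>z. \<phi> (x - z) * \<rho> z \<partial>lborel)" for x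
  proof -
    have T: "distr lborel lborel (\<lambda>z. x - z) = (lborel :: 'a measure)"
      by (rule distr_isometric_involution2(1)) (auto simp: dist_norm norm_minus_commute)
    have i: "integrable lborel (\<lambda>y. \<phi> y * \<rho> (x - y))"
      using measure_preserving_integral(1)[OF T, of "\<lambda>z. \<phi> (x - z) * \<rho> z"] int[of x] by simp
    have "\<psi> x = integral UNIV (\<lambda>y. if y \<in> cbox (- a) a then \<phi> y * \<rho> (x - y) else 0)"
      unfolding \<psi>_def by (rule Henstock_Kurzweil_Integration.integral_restrict_UNIV[symmetric])
    also have "(\<lambda>y. if y \<in> cbox (- a) a then \<phi> y * \<rho> (x - y) else 0) = (\<lambda>y. \<phi> y * \<rho> (x - y))"
      using R(2) a by (auto simp: fun_eq_iff)
    also have "integral UNIV (\<lambda>y. \<phi> y * \<rho> (x - y)) = (\<integral>y. \<phi> y * \<rho> (x - y) \<partial>lborel)"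
      by (rule integral_lborel[OF i])
    also have "\<dots> = (\<integral>z. \<phi> (x - z) * \<rho> (x - (x - z)) \<partial>lborel)"
      by (rule measure_preserving_integral(2)[OF T, symmetric]) measurable
    finally show ?thesis by simp
  qed
  have L0: "0 \<le> L" using L by (rule lipschitz_on_nonneg)
  \<comment> \<open>One estimate with two uses: with \<open>g\<close> a translate of
    \<open>\<phi>\<close> it gives the Lipschitz bound, with \<open>g\<close> constant the distance
    from \<open>\<psi>\<close> to \<open>\<phi>\<close>.\<close>
  have diff: "\<bar>\<psi> x - (\<integral>z. g z * \<rho> z \<partial>lborel)\<bar> \<le> K"
    if "integrable lborel (\<lambda>z. g z * \<rho> z)" "\<And>z. norm z < \<delta> \<Longrightarrow> \<bar>\<phi> (x - z) - g z\<bar> \<le> K" for x g K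
  proof -
    have "\<psi> x - (\<integral>z. g z * \<rho> z \<partial>lborel) = (\<integral>z. (\<phi> (x - z) - g z) * \<rho> z \<partial>lborel)"
      using int[of x] that(1) by (simp add: \<psi> left_diff_distrib)
    also have "\<bar>\<dots>\<bar> \<le> (\<integral>z. K * \<rho> z \<partial>lborel)"
    proof (rule integral_abs_bound_integral)
      show "integrable lborel (\<lambda>z. (\<phi> (x - z) - g z) * \<rho> z)"
        using Bochner_Integration.integrable_diff[OF int[of x] that(1)] by (simp add: left_diff_distrib)
      show "integrable lborel (\<lambda>z. K * \<rho> z)" using \<rho>(4) by simp
      fix z
      show "\<bar>(\<phi> (x - z) - g z) * \<rho> z\<bar> \<le> K * \<rho> z"
      proof (cases "norm z < \<delta>")
        case True
        then show ?thesis using that(2)[OF True] \<rho>(2)[of z] by (simp add: abs_mult mult_right_mono)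
      qed (simp add: \<rho>(3))
    qed
    also have "\<dots> = K" using \<rho>(5) by simp
    finally show ?thesis .
  qed
  show thesis
  proof (rule that[of \<psi>])
    show sub: "{x. \<psi> x \<noteq> 0} \<subseteq> cball 0 (R + \<delta>)"
    proof
      fix x assume x: "x \<in> {x. \<psi> x \<noteq> 0}"
      show "x \<in> cball 0 (R + \<delta>)"
      proof (rule ccontr)
        assume "x \<notin> cball 0 (R + \<delta>)"
        then have "\<phi> (x - z) = 0" if "norm z < \<delta>" for z
        proof -
          have "norm x - norm z \<le> norm (x - z)" by (rule norm_triangle_ineq2)
          then have "x - z \<notin> cball 0 R" using that \<open>x \<notin> _\<close> by auto
          then show ?thesis using R(2) by blast
        qed
        then have "(\<lambda>z. \<phi> (x - z) * \<rho> z) = (\<lambda>z. 0)" using \<rho>(3) by (auto simp: fun_eq_iff not_less[symmetric])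
        then show False using x by (simp add: \<psi>)
      qed
    qed
    have "bounded {x. \<psi> x \<noteq> 0}" using sub bounded_cball bounded_subset by blast
    then have "compact (closure {x. \<psi> x \<noteq> 0})" by (simp add: compact_eq_bounded_closed bounded_closure)
    then show "test_function \<psi>"
      unfolding test_function_def \<psi>_def using Ck_convolution[OF \<rho>(1) c\<phi>] by blast
    show "L-lipschitz_on UNIV \<psi>"
    proof (rule lipschitz_onI)
      fix x y :: 'a
      have "\<bar>\<psi> x - (\<integral>z. \<phi> (y - z) * \<rho> z \<partial>lborel)\<bar> \<le> L * dist x y"
      proof (rule diff[OF int])
        show "\<bar>\<phi> (x - z) - \<phi> (y - z)\<bar> \<le> L * dist x y" for z
          using lipschitz_onD[OF L, of "x - z" "y - z"] by (simp add: dist_norm)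
      qed
      then show "dist (\<psi> x) (\<psi> y) \<le> L * dist x y" by (simp add: \<psi>[of y] dist_norm)
    qed fact
    show "\<bar>\<psi> x - \<phi> x\<bar> \<le> L * \<delta>" for x
    proof -
      have "\<bar>\<psi> x - (\<integral>z. \<phi> x * \<rho> z \<partial>lborel)\<bar> \<le> L * \<delta>"
      proof (rule diff)
        fix z :: 'a assume z: "norm z < \<delta>"
        have "\<bar>\<phi> (x - z) - \<phi> x\<bar> \<le> L * norm z"
          using lipschitz_onD[OF L, of "x - z" x] by (simp add: dist_norm)
        also have "\<dots> \<le> L * \<delta>" using z L0 by (intro mult_left_mono) auto
        finally show "\<bar>\<phi> (x - z) - \<phi> x\<bar> \<le> L * \<delta>" .
      qed (use \<rho>(4) in simp)
      then show ?thesis using \<rho>(5) by simp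
    qed
  qed
qed

section \<open>Lipschitz functions and the solution space\<close>

lemma frac_form_eq: "frac_form s u v = frac_const DIM('a) s / 2 * form s u (v :: 'a::euclidean_space \<Rightarrow> real)"
  by (simp add: frac_form_def form_def ker_def case_prod_unfold)

lemma finite_frac_energy_eq:
  "u \<in> borel_measurable borel \<Longrightarrow> finite_frac_energy s u \<longleftrightarrow> fin_energy s (u :: 'a::euclidean_space \<Rightarrow> real)"
  by (simp add: finite_frac_energy_def fin_energy_def ker_def case_prod_unfold)

lemma dotH_norm_eq: "dotH_norm s u = sqrt (frac_const DIM('a) s / 2 * form s u (u :: 'a::euclidean_space \<Rightarrow> real))"
  by (simp add: dotH_norm_def form_self ker_def case_prod_unfold)

lemma lip_cs_diff: "lip_cs f \<Longrightarrow> lip_cs g \<Longrightarrow> lip_cs (\<lambda>x. f x - g x)"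
proof -
  assume "lip_cs f" "lip_cs g"
  then obtain L M where L: "L-lipschitz_on UNIV f" "M-lipschitz_on UNIV g"
    and b: "bounded ({x. f x \<noteq> 0} \<union> {x. g x \<noteq> 0})" by (auto simp: lip_cs_def)
  have "bounded {x. f x - g x \<noteq> 0}" by (rule bounded_subset[OF b]) auto
  with lipschitz_on_diff[OF L] show ?thesis by (auto simp: lip_cs_def)
qed

text \<open>Mollifications at scale \<open>1 / (n + 1)\<close> differ from \<open>\<phi>\<close> by
  functions with Lipschitz constant \<open>L + L\<close>, bound \<open>L\<close> and common support
  in a ball of radius \<open>R + 1\<close>. Dominated convergence then applies to the energy and to
  the Lebesgue norm.\<close>

lemma lip_cs_dotH:
  fixes \<phi> :: "'a::euclidean_space \<Rightarrow> real"
  assumes s: "0 < s" "s < 1" "2 * s < real DIM('a)" and \<phi>: "lip_cs \<phi>"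
  shows "dotH s \<phi>"
proof -
  let ?r = "crit_exp DIM('a) s"
  have r: "2 < ?r" using crit_exp_gt_2 s by blast
  obtain L M R where L: "L-lipschitz_on UNIV \<phi>" "\<And>x. \<bar>\<phi> x\<bar> \<le> M" "0 < R" "{x. \<phi> x \<noteq> 0} \<subseteq> cball 0 R"
    using lip_cs_bounded[OF \<phi>] by blast
  have L0: "0 \<le> L" using L(1) by (rule lipschitz_on_nonneg)
  have ex: "\<exists>\<psi>. test_function \<psi> \<and> L-lipschitz_on UNIV \<psi> \<and> (\<forall>x. \<bar>\<psi> x - \<phi> x\<bar> \<le> L * (1 / real (Suc n))) \<and>
    {x. \<psi> x \<noteq> 0} \<subseteq> cball 0 (R + 1 / real (Suc n))" for n
  proof -
    have "0 < 1 / real (Suc n)" by simp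
    then obtain \<psi> where "test_function \<psi>" "L-lipschitz_on UNIV \<psi>" "\<And>x. \<bar>\<psi> x - \<phi> x\<bar> \<le> L * (1 / real (Suc n))"
      "{x. \<psi> x \<noteq> 0} \<subseteq> cball 0 (R + 1 / real (Suc n))"
      by (rule lip_cs_mollify[OF L(1,3,4)]) (rule that)
    then show ?thesis by blast
  qed
  then have "\<forall>n. \<exists>\<psi>. test_function \<psi> \<and> L-lipschitz_on UNIV \<psi> \<and> (\<forall>x. \<bar>\<psi> x - \<phi> x\<bar> \<le> L * (1 / real (Suc n))) \<and>
    {x. \<psi> x \<noteq> 0} \<subseteq> cball 0 (R + 1 / real (Suc n))" by blast
  from choice[OF this] obtain \<psi> where "\<forall>n. test_function (\<psi> n) \<and> L-lipschitz_on UNIV (\<psi> n) \<and> (\<forall>x. \<bar>\<psi> n x - \<phi> x\<bar> \<le> L * (1 / real (Suc n))) \<and>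
    {x. \<psi> n x \<noteq> 0} \<subseteq> cball 0 (R + 1 / real (Suc n))" by blast
  then have \<psi>: "\<And>n. test_function (\<psi> n)" "\<And>n. L-lipschitz_on UNIV (\<psi> n)"
    "\<And>n x. \<bar>\<psi> n x - \<phi> x\<bar> \<le> L * (1 / real (Suc n))" "\<And>n. {x. \<psi> n x \<noteq> 0} \<subseteq> cball 0 (R + 1 / real (Suc n))"
    by blast+
  define w where "w = (\<lambda>n x. \<phi> x - \<psi> n x)"
  let ?B = "cball (0::'a) (R + 1)"
  have lw: "(L + L)-lipschitz_on UNIV (w n)" for n
    unfolding w_def by (intro lipschitz_on_diff L \<psi>)
  have wb: "\<bar>w n x\<bar> \<le> L * (1 / real (Suc n))" for n x
    using \<psi>(3)[of n x] by (simp add: w_def abs_minus_commute)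
  have wL: "\<bar>w n x\<bar> \<le> L" for n x
    by (rule order_trans[OF wb]) (use L0 in \<open>simp add: field_simps\<close>)
  have ws: "{x. w n x \<noteq> 0} \<subseteq> ?B" for n
  proof
    fix x assume "x \<in> {x. w n x \<noteq> 0}"
    then have "\<phi> x \<noteq> 0 \<or> \<psi> n x \<noteq> 0" by (auto simp: w_def)
    then have "norm x \<le> R + 1 / real (Suc n) \<or> norm x \<le> R" using L(4) \<psi>(4)[of n] by force
    moreover have "1 / real (Suc n) \<le> 1" by simp
    ultimately show "x \<in> ?B" unfolding mem_cball_0 by linarith
  qed
  have lcw: "lip_cs (w n)" for n
    unfolding lip_cs_def using lw ws bounded_subset[OF bounded_cball] by blast
  have [measurable]: "w n \<in> borel_measurable borel" for n by (rule lip_cs_measurable[OF lcw])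
  have wt: "(\<lambda>n. w n x) \<longlonglongrightarrow> 0" for x
  proof (rule Lim_null_comparison[OF always_eventually])
    show "\<forall>n. norm (w n x) \<le> L * (1 / real (Suc n))" using wb by simp
    show "(\<lambda>n. L * (1 / real (Suc n))) \<longlonglongrightarrow> 0"
      using tendsto_mult_right_zero[OF LIMSEQ_inverse_real_of_nat] by (simp add: inverse_eq_divide)
  qed
  have E: "(\<lambda>n. form s (w n) (w n)) \<longlonglongrightarrow> 0"
  proof -
    let ?G = "\<lambda>p. max ((L + L)\<^sup>2) (4 * L\<^sup>2) * ((indicator ?B (fst p) + indicator ?B (snd p)) * (min 1 ((norm (fst p - snd p))\<^sup>2) * ker2 s p))"
    have "(\<lambda>n. \<integral>p. (dif (w n) p)\<^sup>2 * ker2 s p \<partial>lborel2) \<longlonglongrightarrow> (\<integral>p. 0 \<partial>(lborel2 :: ('a \<times> 'a) measure))"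
    proof (rule integral_dominated_convergence[where w="?G"])
      show "integrable lborel2 ?G"
        by (intro integrable_mult_right integrable_ker_dominant s) auto
      show "AE p in lborel2. (\<lambda>n. (dif (w n) p)\<^sup>2 * ker2 s p) \<longlonglongrightarrow> 0"
      proof (rule AE_I2)
        fix p :: "'a \<times> 'a"
        have "(\<lambda>n. (dif (w n) p)\<^sup>2 * ker2 s p) \<longlonglongrightarrow> (0 - 0)\<^sup>2 * ker2 s p"
          by (intro tendsto_intros wt)
        then show "(\<lambda>n. (dif (w n) p)\<^sup>2 * ker2 s p) \<longlonglongrightarrow> 0" by simp
      qed
      show "AE p in lborel2. norm ((dif (w n) p)\<^sup>2 * ker2 s p) \<le> ?G p" for n
        using lip_bounded_energy_bound[OF lw[of n] wL ws] by (intro AE_I2) simp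
    qed measurable
    then show ?thesis by (simp add: form_self)
  qed
  have P: "(\<lambda>n. \<integral>x. \<bar>w n x\<bar> powr ?r \<partial>lborel) \<longlonglongrightarrow> 0"
  proof -
    have "(\<lambda>n. \<integral>x. \<bar>w n x\<bar> powr ?r \<partial>lborel) \<longlonglongrightarrow> (\<integral>x. 0 \<partial>(lborel :: 'a measure))"
    proof (rule integral_dominated_convergence[where w="\<lambda>x. L powr ?r * indicator ?B x"])
      show "integrable lborel (\<lambda>x. L powr ?r * indicator ?B x :: real)"
        by (intro integrable_mult_right integrable_real_indicator) (use L(3) in \<open>auto simp: emeasure_cball less_top[symmetric]\<close>)
      show "AE x in lborel. (\<lambda>n. \<bar>w n x\<bar> powr ?r) \<longlonglongrightarrow> 0"
      proof (rule AE_I2)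
        fix x
        have "(\<lambda>n. \<bar>w n x\<bar> powr ?r) \<longlonglongrightarrow> 0 powr ?r"
          using r by (intro tendsto_powr' tendsto_rabs_zero wt tendsto_const) auto
        then show "(\<lambda>n. \<bar>w n x\<bar> powr ?r) \<longlonglongrightarrow> 0" by simp
      qed
      show "AE x in lborel. norm (\<bar>w n x\<bar> powr ?r) \<le> L powr ?r * indicator ?B x" for n
      proof (rule AE_I2)
        fix x show "norm (\<bar>w n x\<bar> powr ?r) \<le> L powr ?r * indicator ?B x"
        proof (cases "w n x = 0")
          case False
          then have "x \<in> ?B" using ws by blast
          then show ?thesis using r wL[of n x] by (simp add: powr_mono2)
        qed (simp add: indicator_def)
      qed
    qed measurable
    then show ?thesis by simp
  qed
  have N: "(\<lambda>n. dotH_norm s (w n) + Lp_norm ?r (w n)) \<longlonglongrightarrow> 0"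
  proof -
    have "(\<lambda>n. sqrt (frac_const DIM('a) s / 2 * form s (w n) (w n)) + (\<integral>x. \<bar>w n x\<bar> powr ?r \<partial>lborel) powr (1 / ?r)) \<longlonglongrightarrow> sqrt (frac_const DIM('a) s / 2 * 0) + 0 powr (1 / ?r)"
      using r by (intro tendsto_intros E tendsto_powr' P) (auto intro!: always_eventually integral_nonneg_AE)
    then show ?thesis by (simp add: dotH_norm_eq Lp_norm_def)
  qed
  have fe: "fin_energy s \<phi>" by (rule lip_cs_fin_energy[OF s(1,2) \<phi>])
  show ?thesis unfolding dotH_def
  proof (intro conjI exI[of _ \<psi>])
    show "in_Lp ?r \<phi>"
      unfolding in_Lp_def using lip_cs_measurable[OF \<phi>] lip_cs_integrable_powr[OF \<phi>, of ?r] r by simp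
    show "finite_frac_energy s \<phi>"
      using fe by (simp add: finite_frac_energy_eq fin_energy_measurable)
  qed (use \<psi>(1) N in \<open>auto simp: w_def\<close>)
qed

text \<open>Continuous partial derivatives with compact support are bounded, and the operator norm
  of the derivative is at most the sum of these bounds over the basis. The approximants in the
  definition of \<open>dotH\<close> thus belong to \<open>lip_cs\<close>.\<close>

lemma test_function_lip_cs:
  fixes f :: "'a::euclidean_space \<Rightarrow> real"
  assumes "test_function f"
  shows "lip_cs f"
proof -
  define D where "D = (\<lambda>x. frechet_derivative f (at x))"
  have Ck: "Ck (Suc 0) f" and cpt: "compact (closure {x. f x \<noteq> 0})"
    using assms unfolding test_function_def by blast+
  have dif: "(f has_derivative D x) (at x)" for x
    using Ck unfolding D_def by (simp add: frechet_derivative_works)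
  have cD: "continuous_on UNIV (\<lambda>x. D x b)" if "b \<in> Basis" for b
    using Ck that by (simp add: D_def)
  have Dz: "D x = (\<lambda>_. 0)" if "x \<notin> closure {x. f x \<noteq> 0}" for x
  proof -
    have "(f has_derivative (\<lambda>_. 0)) (at x)"
    proof (rule has_derivative_transform_within_open)
      show "((\<lambda>_. 0) has_derivative (\<lambda>_. 0)) (at x)" by simp
      show "open (- closure {x. f x \<noteq> 0})" by (intro open_Compl closed_closure)
      show "x \<in> - closure {x. f x \<noteq> 0}" using that by simp
      show "\<And>x. x \<in> - closure {x. f x \<noteq> 0} \<Longrightarrow> 0 = f x" using closure_subset[of "{x. f x \<noteq> 0}"] by auto
    qed
    from has_derivative_unique[OF dif this] show ?thesis .
  qed
  have "\<exists>M. \<forall>x. norm (D x b) \<le> M" if b: "b \<in> Basis" for b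
  proof -
    have "compact ((\<lambda>x. D x b) ` closure {x. f x \<noteq> 0})"
      by (intro compact_continuous_image cpt continuous_on_subset[OF cD[OF b]]) simp
    then obtain M where "0 < M" "\<forall>y\<in>(\<lambda>x. D x b) ` closure {x. f x \<noteq> 0}. norm y \<le> M"
      using compact_imp_bounded bounded_pos by blast
    then have M: "0 < M" "\<And>x. x \<in> closure {x. f x \<noteq> 0} \<Longrightarrow> norm (D x b) \<le> M" by auto
    have "norm (D x b) \<le> M" for x using M Dz[of x] by (cases "x \<in> closure {x. f x \<noteq> 0}") auto
    then show ?thesis by blast
  qed
  then have "\<exists>M. \<forall>b\<in>Basis. \<forall>x. norm (D x b) \<le> M b" by (intro bchoice) blast
  then obtain M where M: "\<And>b x. b \<in> Basis \<Longrightarrow> norm (D x b) \<le> M b" by blast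
  define L where "L = (\<Sum>b\<in>Basis. M b)"
  have L0: "0 \<le> L" unfolding L_def by (intro sum_nonneg) (rule order_trans[OF norm_ge_zero M])
  have on: "onorm (D x) \<le> L" for x
    unfolding L_def by (rule order_trans[OF onorm_componentwise[OF has_derivative_bounded_linear[OF dif]]])
      (intro sum_mono M)
  have "L-lipschitz_on UNIV f"
  proof (rule lipschitz_onI[OF _ L0])
    fix x y
    show "dist (f x) (f y) \<le> L * dist x y"
      unfolding dist_norm by (rule differentiable_bound[of UNIV f D]) (use dif on in auto)
  qed
  moreover have "bounded {x. f x \<noteq> 0}"
    using compact_imp_bounded[OF cpt] closure_subset bounded_subset by blast
  ultimately show ?thesis by (auto simp: lip_cs_def)
qed

section \<open>Upper bound and Hoelder continuity\<close>

lemma frac_const_pos: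
  assumes "0 < s" "s < 1" "0 < n"
  shows "0 < frac_const n s"
  using assms by (simp add: frac_const_def Gamma_real_pos add_pos_pos)

text \<open>Weaker than approximation in norm, but just what \<open>weak_limit\<close> consumes. It
  survives Lipschitz truncation of the approximants and a change of \<open>u\<close> on a null
  set.\<close>

definition lip_approx :: "real \<Rightarrow> ('a::euclidean_space \<Rightarrow> real) \<Rightarrow> bool" where
  "lip_approx s u \<longleftrightarrow> u \<in> borel_measurable borel \<and>
     (\<exists>\<psi> A. (\<forall>n. lip_cs (\<psi> n)) \<and> (\<forall>n. form s (\<psi> n) (\<psi> n) \<le> A) \<and>
        (AE x in lborel. (\<lambda>n::nat. \<psi> n x) \<longlonglongrightarrow> u x))"

text \<open>Norm convergence bounds the energies of the approximants, and convergence in the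
  critical Lebesgue space yields a subsequence that converges almost everywhere.\<close>

lemma dotH_lip_approx:
  fixes u :: "'a::euclidean_space \<Rightarrow> real"
  assumes s: "0 < s" "s < 1" "2 * s < real DIM('a)" and u: "dotH s u"
  shows "fin_energy s u" "integrable lborel (\<lambda>x. \<bar>u x\<bar> powr crit_exp DIM('a) s)" "lip_approx s u"
proof -
  let ?r = "crit_exp DIM('a) s"
  have r: "2 < ?r" using crit_exp_gt_2 s by blast
  have um: "u \<in> borel_measurable borel" and ir: "integrable lborel (\<lambda>x. \<bar>u x\<bar> powr ?r)"
    using u by (auto simp: dotH_def in_Lp_def)
  then show "integrable lborel (\<lambda>x. \<bar>u x\<bar> powr ?r)" by simp
  show fe: "fin_energy s u" using u um by (auto simp: dotH_def finite_frac_energy_eq)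
  have [measurable]: "u \<in> borel_measurable borel" by fact
  obtain \<psi> :: "nat \<Rightarrow> 'a \<Rightarrow> real" where \<psi>: "\<And>n. test_function (\<psi> n)"
    and lim: "(\<lambda>n. dotH_norm s (\<lambda>x. u x - \<psi> n x) + Lp_norm ?r (\<lambda>x. u x - \<psi> n x)) \<longlonglongrightarrow> 0"
    using u by (auto simp: dotH_def)
  define w where "w = (\<lambda>n x. u x - \<psi> n x)"
  have lc: "lip_cs (\<psi> n)" for n using \<psi> by (rule test_function_lip_cs)
  have [measurable]: "\<psi> n \<in> borel_measurable borel" for n using lip_cs_measurable[OF lc] .
  have fp: "fin_energy s (\<psi> n)" for n using lip_cs_fin_energy[OF s(1,2) lc] .
  have fw: "fin_energy s (w n)" for n unfolding w_def by (rule fin_energy_diff[OF fe fp])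
  have c: "0 < frac_const DIM('a) s / 2" using frac_const_pos[OF s(1,2)] by simp
  have d0: "0 \<le> dotH_norm s (w n)" "0 \<le> Lp_norm ?r (w n)" for n
    using c form_nonneg[of s "w n"] by (simp_all add: dotH_norm_eq Lp_norm_def)
  have l1: "(\<lambda>n. dotH_norm s (w n)) \<longlonglongrightarrow> 0" and l2: "(\<lambda>n. Lp_norm ?r (w n)) \<longlonglongrightarrow> 0"
    by (rule tendsto_sandwich[OF _ _ tendsto_const lim]; use d0 in \<open>auto simp: w_def\<close>)+
  have "(\<lambda>n. (dotH_norm s (w n))\<^sup>2) \<longlonglongrightarrow> 0\<^sup>2" by (intro tendsto_power l1)
  moreover have "(dotH_norm s (w n))\<^sup>2 = frac_const DIM('a) s / 2 * form s (w n) (w n)" for n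
    unfolding dotH_norm_eq using c form_nonneg[of s "w n"] by (intro real_sqrt_pow2) simp
  ultimately have "(\<lambda>n. 2 / frac_const DIM('a) s * (frac_const DIM('a) s / 2 * form s (w n) (w n))) \<longlonglongrightarrow> 2 / frac_const DIM('a) s * 0"
    by (intro tendsto_mult tendsto_const) simp
  then have "(\<lambda>n. form s (w n) (w n)) \<longlonglongrightarrow> 0" using c by simp
  then have "Bseq (\<lambda>n. form s (w n) (w n))" using convergent_imp_Bseq convergentI by blast
  then obtain A where A: "\<And>n. form s (w n) (w n) \<le> A"
    unfolding Bseq_def by (metis abs_le_D1 real_norm_def)
  have E: "form s (\<psi> n) (\<psi> n) \<le> 2 * form s u u + 2 * A" for n
  proof -
    have "form s (\<lambda>x. u x - w n x) (\<lambda>x. u x - w n x) \<le> 2 * form s u u + 2 * form s (w n) (w n)"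
      by (rule form_diff_le[OF fe fw])
    then show ?thesis using A[of n] by (simp add: w_def)
  qed
  have ip: "integrable lborel (\<lambda>x. \<bar>\<psi> n x\<bar> powr ?r)" for n
    using lip_cs_integrable_powr[OF lc] r by simp
  have iw: "integrable lborel (\<lambda>x. \<bar>w n x\<bar> powr ?r)" for n
  proof (rule Bochner_Integration.integrable_bound)
    show "integrable lborel (\<lambda>x. 2 powr ?r * (\<bar>u x\<bar> powr ?r + \<bar>\<psi> n x\<bar> powr ?r))" using ir ip by simp
    show "AE x in lborel. norm (\<bar>w n x\<bar> powr ?r) \<le> norm (2 powr ?r * (\<bar>u x\<bar> powr ?r + \<bar>\<psi> n x\<bar> powr ?r))"
      using powr_diff_le[of ?r "u x" "\<psi> n x" for x] r unfolding w_def
      by (intro AE_I2) (simp add: abs_of_nonneg)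
  qed (simp add: w_def)
  have "(\<lambda>n. (Lp_norm ?r (w n)) powr ?r) \<longlonglongrightarrow> 0 powr ?r"
    using r by (intro tendsto_powr' l2 tendsto_const) (auto intro: always_eventually d0)
  moreover have "(Lp_norm ?r (w n)) powr ?r = (\<integral>x. \<bar>w n x\<bar> powr ?r \<partial>lborel)" for n
    using r by (simp add: Lp_norm_def powr_powr integral_nonneg_AE)
  ultimately have "(\<lambda>n. \<integral>x. norm (\<bar>w n x\<bar> powr ?r) \<partial>lborel) \<longlonglongrightarrow> 0" by simp
  from tendsto_L1_AE_subseq[OF iw this] obtain k where k: "strict_mono k"
    "AE x in lborel. (\<lambda>n. \<bar>w (k n) x\<bar> powr ?r) \<longlonglongrightarrow> 0" by metis
  have "AE x in lborel. (\<lambda>n. \<psi> (k n) x) \<longlonglongrightarrow> u x"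
    using k(2)
  proof eventually_elim
    case (elim x)
    have "(\<lambda>n. (\<bar>w (k n) x\<bar> powr ?r) powr (1 / ?r)) \<longlonglongrightarrow> 0 powr (1 / ?r)"
      using r by (intro tendsto_powr' elim tendsto_const) auto
    then have "(\<lambda>n. \<bar>w (k n) x\<bar>) \<longlonglongrightarrow> 0" using r by (simp add: powr_powr)
    then have "(\<lambda>n. w (k n) x) \<longlonglongrightarrow> 0" by (simp add: tendsto_rabs_zero_iff)
    then have "(\<lambda>n. u x - w (k n) x) \<longlonglongrightarrow> u x - 0" by (intro tendsto_intros)
    then show ?case by (simp add: w_def)
  qed
  then show "lip_approx s u"
    unfolding lip_approx_def using um lc E
    by (intro conjI exI[of _ "\<lambda>n. \<psi> (k n)"] exI[of _ "2 * form s u u + 2 * A"]) auto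
qed

lemma lip_cs_compose:
  assumes f: "lip_cs f" and T: "M-lipschitz_on UNIV T" "T 0 = (0::real)"
  shows "lip_cs (\<lambda>x. T (f x))"
proof -
  obtain L where L: "L-lipschitz_on UNIV f" and b: "bounded {x. f x \<noteq> 0}"
    using f by (auto simp: lip_cs_def)
  have "(M * L)-lipschitz_on UNIV (\<lambda>x. T (f x))"
    by (rule lipschitz_on_compose2[OF L]) (rule lipschitz_on_subset[OF T(1)], simp)
  moreover have "bounded {x. T (f x) \<noteq> 0}" by (rule bounded_subset[OF b]) (use T(2) in auto)
  ultimately show ?thesis by (auto simp: lip_cs_def)
qed

lemma powr_diff_bounds:
  fixes t :: real
  assumes "0 \<le> t" "t \<le> 1" "1 \<le> r" "r - 1 \<le> p" "p \<le> q"
  shows "0 \<le> t powr p - t powr q" "t powr p - t powr q \<le> t powr (r - 1)"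
proof -
  have "t powr q \<le> t powr p" "t powr p \<le> t powr (r - 1)"
    using assms by (cases "t = 0"; simp add: powr_mono')+
  moreover have "0 \<le> t powr q" by simp
  ultimately show "0 \<le> t powr p - t powr q" "t powr p - t powr q \<le> t powr (r - 1)" by linarith+
qed

text \<open>The conjugate exponent \<open>r / (r - 1)\<close> applied to
  \<open>\<bar>u\<bar> powr (r - 1)\<close> gives back \<open>\<bar>u\<bar> powr r\<close>. Growth
  of this order places a nonlinearity in the dual of the critical Lebesgue space.\<close>

lemma integrable_conj_exp:
  fixes F u :: "'a::euclidean_space \<Rightarrow> real"
  assumes r: "1 < r" and [measurable]: "F \<in> borel_measurable borel"
    and u: "integrable lborel (\<lambda>x. \<bar>u x\<bar> powr r)" and le: "AE x in lborel. \<bar>F x\<bar> \<le> c * \<bar>u x\<bar> powr (r - 1)"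
  shows "integrable lborel (\<lambda>x. \<bar>F x\<bar> powr (r / (r - 1)))"
proof (rule Bochner_Integration.integrable_bound)
  show "integrable lborel (\<lambda>x. \<bar>c\<bar> powr (r / (r - 1)) * \<bar>u x\<bar> powr r)" using u by simp
  show "AE x in lborel. norm (\<bar>F x\<bar> powr (r / (r - 1))) \<le> norm (\<bar>c\<bar> powr (r / (r - 1)) * \<bar>u x\<bar> powr r)"
    using le
  proof eventually_elim
    case (elim x)
    have "\<bar>F x\<bar> \<le> \<bar>c\<bar> * \<bar>u x\<bar> powr (r - 1)"
      by (rule order_trans[OF elim]) (intro mult_right_mono, auto)
    then have "\<bar>F x\<bar> powr (r / (r - 1)) \<le> (\<bar>c\<bar> * \<bar>u x\<bar> powr (r - 1)) powr (r / (r - 1))"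
      using r by (intro powr_mono2) auto
    also have "\<dots> = \<bar>c\<bar> powr (r / (r - 1)) * \<bar>u x\<bar> powr r"
      using r by (simp add: powr_mult powr_powr)
    finally show ?case by simp
  qed
qed measurable

text \<open>
  Testing with \<open>(u - 1)\<^sup>+\<close>, where the right-hand side \<open>u\<^sup>p - u\<^sup>q\<close> is nonpositive, gives
  \<open>u \<le> 1\<close>; no iteration is needed since \<open>p < q\<close>.
\<close>

lemma weak_solution_le_1:
  fixes u :: "'a::euclidean_space \<Rightarrow> real" and s p q :: real
  defines "r \<equiv> crit_exp DIM('a) s"
  assumes s: "0 < s" "s < 1" "2 * s < real DIM('a)" and pq: "r - 1 \<le> p" "p < q"
    and sol: "weak_solution s p q u"
  shows "AE x in lborel. u x \<le> 1"
proof -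
  let ?C = "frac_const DIM('a) s / 2"
  have C: "0 < ?C" using frac_const_pos[OF s(1,2)] by simp
  have r: "2 < r" unfolding r_def using crit_exp_gt_2 s by blast
  have dH: "dotH s u" and pos: "\<And>x. 0 < u x" using sol by (auto simp: weak_solution_def)
  have fe: "fin_energy s u" and ir: "integrable lborel (\<lambda>x. \<bar>u x\<bar> powr r)" and la: "lip_approx s u"
    using dotH_lip_approx[OF s dH] by (auto simp: r_def)
  have [measurable]: "u \<in> borel_measurable borel" using fe by (rule fin_energy_measurable)
  obtain \<psi> A where \<psi>: "\<And>n::nat. lip_cs (\<psi> n)" "\<And>n. form s (\<psi> n) (\<psi> n) \<le> A"
    "AE x in lborel. (\<lambda>n. \<psi> n x) \<longlonglongrightarrow> u x" using la unfolding lip_approx_def by auto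
  define T where "T = (\<lambda>t::real. max 0 (t - 1))"
  have T1: "\<bar>T a - T b\<bar> \<le> \<bar>a - b\<bar>" for a b by (auto simp: T_def max_def)
  have Tl: "1-lipschitz_on UNIV T" by (rule lipschitz_onI) (use T1 in \<open>auto simp: dist_real_def\<close>)
  \<comment> \<open>The Lipschitz approximants are truncated rather than \<open>u\<close>, so that
    each test is visibly admissible.\<close>
  define \<phi> where "\<phi> = (\<lambda>n x. T (\<psi> n x))"
  have lc: "lip_cs (\<phi> n)" for n unfolding \<phi>_def by (rule lip_cs_compose[OF \<psi>(1) Tl]) (simp add: T_def)
  have fp: "fin_energy s (\<phi> n)" for n by (rule lip_cs_fin_energy[OF s(1,2) lc])
  have ip: "integrable lborel (\<lambda>x. \<bar>\<phi> n x\<bar> powr r)" for n using lip_cs_integrable_powr[OF lc] r by simp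
  have Ep: "form s (\<phi> n) (\<phi> n) \<le> A" for n
  proof -
    have "form s (\<phi> n) (\<phi> n) \<le> 1 * form s (\<psi> n) (\<psi> n)"
      by (rule form_le_of_dif_le[OF lip_cs_fin_energy[OF s(1,2) \<psi>(1)] fp])
        (use T1 in \<open>simp add: \<phi>_def abs_le_square_iff\<close>)
    then show ?thesis using \<psi>(2)[of n] by simp
  qed
  define \<phi>0 where "\<phi>0 = (\<lambda>x. T (u x))"
  have [measurable]: "\<phi>0 \<in> borel_measurable borel" by (simp add: \<phi>0_def T_def)
  have limp: "AE x in lborel. (\<lambda>n. \<phi> n x) \<longlonglongrightarrow> \<phi>0 x"
    using \<psi>(3) by eventually_elim (auto simp: \<phi>_def \<phi>0_def T_def intro!: tendsto_intros)
  note wl = weak_limit[OF s(1,3) fp ip[unfolded r_def] Ep limp \<open>\<phi>0 \<in> borel_measurable borel\<close>, folded r_def]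
  \<comment> \<open>Only the part on \<open>{u < 1}\<close> is bounded by
    \<open>u powr (r - 1)\<close> and can pass to the limit. On the rest
    \<open>u powr p - u powr q\<close> is nonpositive and \<open>\<phi> n\<close> is nonnegative, so
    that part is dropped before the limit. In the limit \<open>F\<close> and \<open>\<phi>0\<close>
    have disjoint supports.\<close>
  define F where "F = (\<lambda>x. indicator {x. u x < 1} x * (u x powr q - u x powr p))"
  have [measurable]: "F \<in> borel_measurable borel" unfolding F_def by measurable
  have F: "\<bar>F x\<bar> \<le> 1 * \<bar>u x\<bar> powr (r - 1)" for x
    using powr_diff_bounds[of "u x" r p q] pos[of x] pq r by (simp add: F_def indicator_def)
  have iF: "integrable lborel (\<lambda>x. \<bar>F x\<bar> powr (r / (r - 1)))"
    by (rule integrable_conj_exp[OF _ _ ir, of _ 1]) (use r F in auto)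
  have limF: "(\<lambda>n. \<integral>x. F x * \<phi> n x \<partial>lborel) \<longlonglongrightarrow> (\<integral>x. F x * \<phi>0 x \<partial>lborel)"
    by (rule wl(4)[OF _ iF]) measurable
  have F0: "(\<integral>x. F x * \<phi>0 x \<partial>lborel) = 0"
  proof -
    have "(\<lambda>x. F x * \<phi>0 x) = (\<lambda>x. 0)"
      by (auto simp: fun_eq_iff F_def \<phi>0_def T_def indicator_def)
    then show ?thesis by simp
  qed
  have limB: "(\<lambda>n. ?C * form s u (\<phi> n)) \<longlonglongrightarrow> ?C * form s u \<phi>0"
    by (intro tendsto_mult tendsto_const wl(3) fe)
  have le: "?C * form s u (\<phi> n) \<le> - (\<integral>x. F x * \<phi> n x \<partial>lborel)" for n
  proof -
    have "dotH s (\<phi> n)" by (rule lip_cs_dotH[OF s lc])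
    then have i: "integrable lborel (\<lambda>x. u x powr p * \<phi> n x)" "integrable lborel (\<lambda>x. u x powr q * \<phi> n x)"
      and eq: "?C * form s u (\<phi> n) = (\<integral>x. u x powr p * \<phi> n x \<partial>lborel) - (\<integral>x. u x powr q * \<phi> n x \<partial>lborel)"
      using sol by (auto simp: weak_solution_def frac_form_eq)
    have "?C * form s u (\<phi> n) = (\<integral>x. u x powr p * \<phi> n x - u x powr q * \<phi> n x \<partial>lborel)"
      using i eq by simp
    also have "\<dots> \<le> (\<integral>x. - (F x * \<phi> n x) \<partial>lborel)"
    proof (rule integral_mono)
      show "integrable lborel (\<lambda>x. u x powr p * \<phi> n x - u x powr q * \<phi> n x)" using i by simp
      have "integrable lborel (\<lambda>x. F x * \<phi> n x)"
        by (rule integrable_Young[of r]) (use r iF ip fin_energy_measurable[OF fp] in auto)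
      then show "integrable lborel (\<lambda>x. - (F x * \<phi> n x))" by simp
      fix x
      show "u x powr p * \<phi> n x - u x powr q * \<phi> n x \<le> - (F x * \<phi> n x)"
      proof (cases "u x < 1")
        case True then show ?thesis by (simp add: F_def algebra_simps)
      next
        case False
        then have "u x powr p \<le> u x powr q" using pq by (intro powr_mono) auto
        moreover have "0 \<le> \<phi> n x" by (simp add: \<phi>_def T_def)
        ultimately show ?thesis using False by (simp add: F_def mult_right_mono)
      qed
    qed
    finally show ?thesis by simp
  qed
  have "?C * form s u \<phi>0 \<le> - (\<integral>x. F x * \<phi>0 x \<partial>lborel)"
    by (rule LIMSEQ_le[OF limB tendsto_minus[OF limF]]) (use le in auto)
  then have "form s u \<phi>0 \<le> 0" using F0 C by (simp add: mult_le_0_iff)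
  \<comment> \<open>\<open>T\<close> is nondecreasing with slope at most \<open>1\<close>, so each
    squared increment of \<open>\<phi>0\<close> is at most the product of the increments of
    \<open>u\<close> and \<open>\<phi>0\<close>.\<close>
  moreover have "form s \<phi>0 \<phi>0 \<le> form s u \<phi>0"
    unfolding form_def
  proof (rule integral_mono)
    show "integrable lborel2 (\<lambda>p. dif \<phi>0 p * dif \<phi>0 p * ker2 s p)" by (intro form_integrable wl(1))
    show "integrable lborel2 (\<lambda>p. dif u p * dif \<phi>0 p * ker2 s p)" by (intro form_integrable wl(1) fe)
    have TT: "(T a - T b) * (T a - T b) \<le> (a - b) * (T a - T b)" for a b
      unfolding T_def by (cases "a \<le> 1"; cases "b \<le> 1")
        (auto simp: max_def mult_right_mono mult_left_mono_neg intro: mult_right_mono mult_right_mono_neg)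
    show "dif \<phi>0 p * dif \<phi>0 p * ker2 s p \<le> dif u p * dif \<phi>0 p * ker2 s p" for p
      using mult_right_mono[OF TT[of "u (fst p)" "u (snd p)"], of "ker2 s p"] by (simp add: \<phi>0_def)
  qed
  ultimately have "form s \<phi>0 \<phi>0 = 0" using form_nonneg[of s \<phi>0] by linarith
  then have "(\<integral>x. \<bar>\<phi>0 x\<bar> powr r \<partial>lborel) powr (2 / r) \<le> 0"
    using Sobolev_inequality[OF s(1,3) wl(1)] wl(2) by (simp add: r_def)
  then have "(\<integral>x. \<bar>\<phi>0 x\<bar> powr r \<partial>lborel) powr (2 / r) = 0" by (simp add: antisym)
  then have "(\<integral>x. \<bar>\<phi>0 x\<bar> powr r \<partial>lborel) = 0" by simp
  then have "AE x in lborel. \<bar>\<phi>0 x\<bar> powr r = 0"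
    using integral_nonneg_eq_0_iff_AE[OF wl(2)] by simp
  then show ?thesis
    by eventually_elim (auto simp: \<phi>0_def T_def max_def split: if_splits)
qed

lemma form_cong_AE:
  fixes u v :: "'a::euclidean_space \<Rightarrow> real"
  assumes [measurable]: "u \<in> borel_measurable borel" "v \<in> borel_measurable borel" "\<phi> \<in> borel_measurable borel"
    and eq: "AE x in lborel. u x = v x"
  shows "form s u \<phi> = form s v \<phi>" "fin_energy s u \<longleftrightarrow> fin_energy s v"
proof -
  have e2: "AE p in lborel2. dif u p = dif v p"
    using AE_lborel2[OF eq] by eventually_elim simp
  show "form s u \<phi> = form s v \<phi>"
    unfolding form_def by (rule integral_cong_AE) (use e2 in \<open>auto elim!: eventually_mono\<close>)
  have "integrable lborel2 (\<lambda>p. (dif u p)\<^sup>2 * ker2 s p) \<longleftrightarrow> integrable lborel2 (\<lambda>p. (dif v p)\<^sup>2 * ker2 s p)"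
    by (rule integrable_cong_AE) (use e2 in \<open>auto elim!: eventually_mono\<close>)
  then show "fin_energy s u \<longleftrightarrow> fin_energy s v" by (simp add: fin_energy_def)
qed

lemma lborel_translate:
  fixes g :: "'a::euclidean_space \<Rightarrow> real"
  assumes [measurable]: "g \<in> borel_measurable borel"
  shows "integrable lborel (\<lambda>y. g (c + y)) \<longleftrightarrow> integrable lborel g"
    "(\<integral>y. g (c + y) \<partial>lborel) = (\<integral>y. g y \<partial>lborel)"
  using measure_preserving_integral[OF distr_translate_lborel[of c], of g] by auto

lemma integral_tail_small:
  fixes g :: "'a::euclidean_space \<Rightarrow> real"
  assumes g: "integrable lborel g" and c: "0 < c"
  shows "\<exists>n::nat. (\<integral>y. indicator (- cball 0 (real n)) y * g y \<partial>lborel) < c"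
proof -
  have "(\<lambda>n. \<integral>y. indicator (- cball 0 (real n)) y * g y \<partial>lborel) \<longlonglongrightarrow> (\<integral>y. 0 \<partial>(lborel :: 'a measure))"
  proof (rule integral_dominated_convergence[where w="\<lambda>y. \<bar>g y\<bar>"])
    show "AE y in lborel. (\<lambda>n. indicator (- cball 0 (real n)) y * g y) \<longlonglongrightarrow> 0"
    proof (rule AE_I2)
      fix y :: 'a
      obtain n0 where "norm y \<le> real n0" using real_arch_simple by blast
      then have "indicator (- cball 0 (real n)) y * g y = 0" if "n0 \<le> n" for n
        using that order_trans[of "norm y" "real n0" "real n"] by simp
      then have "\<forall>\<^sub>F n in sequentially. indicator (- cball 0 (real n)) y * g y = 0"
        by (auto simp: eventually_sequentially)
      then show "(\<lambda>n. indicator (- cball 0 (real n)) y * g y) \<longlonglongrightarrow> 0" by (rule tendsto_eventually)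
    qed
  qed (use g in \<open>auto simp: indicator_def\<close>)
  then have "(\<lambda>n. \<integral>y. indicator (- cball 0 (real n)) y * g y \<partial>lborel) \<longlonglongrightarrow> 0" by simp
  from LIMSEQ_D[OF this c] show ?thesis by (auto simp: abs_less_iff)
qed

lemma null_set_not_ball:
  fixes x :: "'a::euclidean_space"
  assumes "AE y in lborel. P y" "0 < e"
  shows "\<exists>y\<in>ball x e. P y"
proof (rule ccontr)
  assume "\<not> ?thesis"
  then have "AE y in lborel. y \<notin> ball x e"
    using assms(1) by (auto elim!: eventually_mono)
  then have "ball x e \<in> null_sets (lborel :: 'a measure)"
    by (subst (asm) AE_iff_null_sets[symmetric]) auto
  moreover have "0 < unit_ball_vol (real DIM('a))" by simp
  then have "unit_ball_vol (real DIM('a)) \<noteq> 0" by linarith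
  ultimately show False using assms(2) emeasure_ball[of e x] by (auto simp: null_sets_def)
qed

text \<open>Scaling removes the normalization of the tests, cut-offs of the distance to a compact
  set recover its indicator, and inner regularity finds a compact set of positive measure inside any
  non-null superlevel set.\<close>

lemma AE_le_of_lip_cs_tests:
  fixes G :: "'a::euclidean_space \<Rightarrow> real"
  assumes [measurable]: "G \<in> borel_measurable borel" and Gb: "\<And>x. \<bar>G x\<bar> \<le> M"
    and le: "\<And>\<rho>. lip_cs \<rho> \<Longrightarrow> (\<And>x. 0 \<le> \<rho> x) \<Longrightarrow> (\<integral>x. \<rho> x \<partial>lborel) = 1 \<Longrightarrow> (\<integral>x. G x * \<rho> x \<partial>lborel) \<le> c"
  shows "AE x in lborel. G x \<le> c"
proof (rule ccontr)
  have lci: "integrable lborel \<rho>" if "lip_cs \<rho>" "\<And>x. 0 \<le> \<rho> x" for \<rho> :: "'a \<Rightarrow> real"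
    using lip_cs_integrable_powr[OF that(1), of 1] that(2) by simp
  have test: "(\<integral>x. (G x - c) * \<rho> x \<partial>lborel) \<le> 0" if \<rho>: "lip_cs \<rho>" "\<And>x. 0 \<le> \<rho> x" for \<rho>
  proof -
    define I where "I = (\<integral>x. \<rho> x \<partial>lborel)"
    have [measurable]: "\<rho> \<in> borel_measurable borel" by (rule lip_cs_measurable[OF \<rho>(1)])
    have i: "integrable lborel \<rho>" by (rule lci[OF \<rho>])
    have iG: "integrable lborel (\<lambda>x. G x * \<rho> x)"
    proof (rule Bochner_Integration.integrable_bound)
      show "integrable lborel (\<lambda>x. M * \<rho> x)" using i by simp
      show "AE x in lborel. norm (G x * \<rho> x) \<le> norm (M * \<rho> x)"
        using mult_right_mono[OF order_trans[OF Gb abs_ge_self]] \<rho>(2) by (auto simp: abs_mult)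
    qed measurable
    have I0: "0 \<le> I" unfolding I_def by (intro integral_nonneg_AE) (simp add: \<rho>)
    show ?thesis
    proof (cases "I = 0")
      case True
      then have "AE x in lborel. \<rho> x = 0" using integral_nonneg_eq_0_iff_AE[OF i] \<rho>(2) by (simp add: I_def)
      then have "(\<integral>x. (G x - c) * \<rho> x \<partial>lborel) = (\<integral>x. 0 \<partial>(lborel::'a measure))"
        by (intro integral_cong_AE) auto
      then show ?thesis by simp
    next
      case False
      with I0 have I: "0 < I" by simp
      have "(\<integral>x. G x * (1 / I * \<rho> x) \<partial>lborel) \<le> c"
      proof (rule le)
        have "(\<bar>1 / I\<bar>)-lipschitz_on UNIV (\<lambda>t::real. 1 / I * t)"
          by (rule lipschitz_onI) (simp_all add: dist_real_def abs_mult flip: right_diff_distrib add: diff_divide_distrib[symmetric])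
        then show "lip_cs (\<lambda>x. 1 / I * \<rho> x)" by (rule lip_cs_compose[OF \<rho>(1)]) simp
        show "(\<integral>x. 1 / I * \<rho> x \<partial>lborel) = 1"
          using I by (subst integral_mult_right_zero) (simp add: I_def)
      qed (use \<rho>(2) I in simp)
      also have "(\<integral>x. G x * (1 / I * \<rho> x) \<partial>lborel) = (\<integral>x. 1 / I * (G x * \<rho> x) \<partial>lborel)"
        by (intro Bochner_Integration.integral_cong) auto
      also have "\<dots> = 1 / I * (\<integral>x. G x * \<rho> x \<partial>lborel)"
        by (rule integral_mult_right_zero)
      finally have "(\<integral>x. G x * \<rho> x \<partial>lborel) \<le> c * I" using I by (simp add: field_simps)
      moreover have "(\<integral>x. (G x - c) * \<rho> x \<partial>lborel) = (\<integral>x. G x * \<rho> x \<partial>lborel) - c * I"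
        using iG i by (simp add: left_diff_distrib I_def)
      ultimately show ?thesis by simp
    qed
  qed
  have cpt: "(\<integral>x. (G x - c) * indicator K x \<partial>lborel) \<le> 0" if K: "compact K" for K
  proof (cases "K = {}")
    case False
    define \<rho> where "\<rho> = (\<lambda>n x. max 0 (1 - real n * infdist x K))"
    obtain R where R: "K \<subseteq> cball 0 R" using compact_imp_bounded[OF K] bounded_subset_ballI
      by (metis bounded_iff mem_cball_0 subsetI)
    have inf1: "\<bar>infdist x K - infdist y K\<bar> \<le> dist x y" for x y
      using infdist_triangle[of x K y] infdist_triangle[of y K x] by (simp add: dist_commute abs_le_iff)
    have supp: "x \<in> cball 0 (R + 1)" if "1 \<le> n" "\<rho> n x \<noteq> 0" for n x
    proof -
      have "real n * infdist x K < 1" using that by (auto simp: \<rho>_def max_def split: if_splits)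
      moreover have "infdist x K \<le> real n * infdist x K"
        using that(1) infdist_nonneg[of x K] by (simp add: mult_le_cancel_right1)
      ultimately have "infdist x K < 1" by linarith
      moreover obtain y where y: "y \<in> K" "infdist x K = dist x y"
        using infdist_attains_inf[OF compact_imp_closed[OF K] False] by blast
      ultimately have "dist x y < 1" by simp
      moreover have "norm y \<le> R" using R y by auto
      ultimately show ?thesis using norm_triangle_sub[of x y] by (simp add: dist_norm)
    qed
    have lc: "lip_cs (\<rho> n)" if n: "1 \<le> n" for n
      unfolding lip_cs_def
    proof
      have "(real n)-lipschitz_on UNIV (\<rho> n)"
      proof (rule lipschitz_onI)
        fix x y
        have "\<bar>\<rho> n x - \<rho> n y\<bar> \<le> \<bar>real n * infdist x K - real n * infdist y K\<bar>"
          unfolding \<rho>_def by (auto simp: max_def)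
        also have "\<dots> = real n * \<bar>infdist x K - infdist y K\<bar>"
          by (simp add: abs_mult flip: right_diff_distrib)
        also have "\<dots> \<le> real n * dist x y" using inf1 by (intro mult_left_mono) auto
        finally show "dist (\<rho> n x) (\<rho> n y) \<le> real n * dist x y" by (simp add: dist_real_def)
      qed simp
      then show "\<exists>L. L-lipschitz_on UNIV (\<rho> n)" by blast
      show "bounded {x. \<rho> n x \<noteq> 0}"
        by (rule bounded_subset[OF bounded_cball[of 0 "R + 1"]]) (use supp[OF n] in auto)
    qed
    have mr [measurable]: "\<rho> n \<in> borel_measurable borel" for n
    proof -
      have "continuous_on UNIV (\<rho> n)" unfolding \<rho>_def by (intro continuous_intros)
      then show ?thesis by (rule borel_measurable_continuous_onI)
    qed
    have [measurable]: "K \<in> sets borel" using K by (simp add: borel_compact)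
    have "(\<lambda>n. \<integral>x. (G x - c) * \<rho> (Suc n) x \<partial>lborel) \<longlonglongrightarrow> (\<integral>x. (G x - c) * indicator K x \<partial>lborel)"
    proof (rule integral_dominated_convergence[where w="\<lambda>x. (M + \<bar>c\<bar>) * indicator (cball 0 (R + 1)) x"])
      show "integrable lborel (\<lambda>x. (M + \<bar>c\<bar>) * indicator (cball (0::'a) (R + 1)) x :: real)"
        using emeasure_bounded_finite[OF bounded_cball[of "0::'a" "R + 1"]]
        by (intro integrable_mult_right integrable_real_indicator) auto
      show "AE x in lborel. (\<lambda>n. (G x - c) * \<rho> (Suc n) x) \<longlonglongrightarrow> (G x - c) * indicator K x"
      proof (intro AE_I2 tendsto_mult tendsto_const)
        fix x
        show "(\<lambda>n. \<rho> (Suc n) x) \<longlonglongrightarrow> indicator K x"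
        proof (cases "x \<in> K")
          case True then show ?thesis by (simp add: \<rho>_def)
        next
          case False
          then have "0 < infdist x K"
            using in_closed_iff_infdist_zero[OF compact_imp_closed[OF K] \<open>K \<noteq> {}\<close>] infdist_nonneg[of x K] by fastforce
          then obtain n0 where n0: "1 < real n0 * infdist x K"
            using reals_Archimedean3 by blast
          have "\<rho> (Suc n) x = 0" if "n0 \<le> n" for n
          proof -
            have "real n0 * infdist x K \<le> real (Suc n) * infdist x K"
              using that by (intro mult_right_mono) (auto simp: infdist_nonneg)
            then show ?thesis using n0 by (simp add: \<rho>_def)
          qed
          then have "\<forall>\<^sub>F n in sequentially. \<rho> (Suc n) x = 0" by (auto simp: eventually_sequentially)
          then show ?thesis using False by (simp add: tendsto_eventually)
        qed
      qed
      show "AE x in lborel. norm ((G x - c) * \<rho> (Suc n) x) \<le> (M + \<bar>c\<bar>) * indicator (cball 0 (R + 1)) x" for n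
      proof (rule AE_I2)
        fix x
        show "norm ((G x - c) * \<rho> (Suc n) x) \<le> (M + \<bar>c\<bar>) * indicator (cball 0 (R + 1)) x"
        proof (cases "\<rho> (Suc n) x = 0")
          case False
          then have x: "x \<in> cball 0 (R + 1)" by (rule supp[rotated]) simp
          have "\<bar>G x - c\<bar> \<le> M + \<bar>c\<bar>" using Gb[of x] by linarith
          moreover have "0 \<le> \<rho> (Suc n) x" "\<rho> (Suc n) x \<le> 1"
            by (auto simp: \<rho>_def infdist_nonneg)
          ultimately have "\<bar>G x - c\<bar> * \<rho> (Suc n) x \<le> (M + \<bar>c\<bar>) * 1"
            by (intro mult_mono) auto
          then show ?thesis using x \<open>0 \<le> \<rho> (Suc n) x\<close> by (simp add: abs_mult)
        next
          case True
          have "0 \<le> M + \<bar>c\<bar>" using Gb[of x] by linarith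
          then show ?thesis using True by (simp add: indicator_def)
        qed
      qed
    qed measurable
    then show ?thesis
      by (rule LIMSEQ_le_const2) (intro exI[of _ 0] allI impI test lc, auto simp: \<rho>_def)
  qed simp
  assume "\<not> (AE x in lborel. G x \<le> c)"
  then have nz: "{x. c < G x} \<notin> null_sets lborel"
    by (subst (asm) AE_iff_null[OF _]) (auto simp: not_le)
  \<comment> \<open>A fixed margin above \<open>c\<close> and boundedness are secured together: the
    superlevel set is covered by countably many such pieces, so one of them is not null.\<close>
  have "\<exists>n. {x. c + 1 / real (Suc n) < G x} \<inter> cball 0 (real n) \<notin> null_sets lborel"
  proof (rule ccontr)
    assume "\<not> ?thesis"
    then have "(\<Union>n. {x. c + 1 / real (Suc n) < G x} \<inter> cball 0 (real n)) \<in> null_sets lborel"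
      by (intro null_sets_UN) auto
    moreover have "{x. c < G x} \<subseteq> (\<Union>n. {x. c + 1 / real (Suc n) < G x} \<inter> cball 0 (real n))"
    proof
      fix x assume "x \<in> {x. c < G x}"
      then have "0 < G x - c" by simp
      then obtain n1 where n1: "1 / real (Suc n1) < G x - c" using nat_approx_posE by blast
      obtain n2 where n2: "norm x \<le> real n2" using real_arch_simple by blast
      define n where "n = max n1 n2"
      have "1 / real (Suc n) \<le> 1 / real (Suc n1)" by (simp add: n_def frac_le)
      then have "c + 1 / real (Suc n) < G x" using n1 by linarith
      moreover have "norm x \<le> real n" using n2 by (simp add: n_def)
      ultimately show "x \<in> (\<Union>n. {x. c + 1 / real (Suc n) < G x} \<inter> cball 0 (real n))"
        by (intro UN_I[of n]) auto
    qed
    ultimately have "{x. c < G x} \<in> null_sets lborel"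
      using null_sets_subset[of _ lborel "{x. c < G x}"] by simp
    with nz show False by simp
  qed
  then obtain n where n: "{x. c + 1 / real (Suc n) < G x} \<inter> cball 0 (real n) \<notin> null_sets lborel" by blast
  define S where "S = {x. c + 1 / real (Suc n) < G x} \<inter> cball (0::'a) (real n)"
  have Sm [measurable]: "S \<in> sets borel" unfolding S_def by measurable
  have Sp: "0 < emeasure lborel S" using n by (auto simp: S_def null_sets_def zero_less_iff_neq_zero)
  have Sf: "emeasure lborel S < \<infinity>" by (intro emeasure_bounded_finite bounded_subset[OF bounded_cball[of 0 "real n"]]) (auto simp: S_def)
  have "S \<in> sets lebesgue" by simp
  have mp: "0 < measure lborel S" using Sp Sf by (simp add: measure_def enn2real_positive_iff)
  \<comment> \<open>The part removed has measure below that of \<open>S\<close>, so the closed set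
    cannot be null.\<close>
  obtain T where T: "closed T" "T \<subseteq> S" "S - T \<in> lmeasurable" "emeasure lebesgue (S - T) < ennreal (measure lborel S)"
    using sets_lebesgue_inner_closed[OF \<open>S \<in> sets lebesgue\<close> mp] by metis
  have cT: "compact T"
    using T(1,2) bounded_subset[OF bounded_cball[of 0 "real n"]] by (auto simp: compact_eq_bounded_closed S_def)
  have Tm [measurable]: "T \<in> sets borel" using T(1) by simp
  have Tf: "emeasure lborel T < \<infinity>" by (intro emeasure_bounded_finite compact_imp_bounded cT)
  have "0 < emeasure lborel T"
  proof (rule ccontr)
    assume "\<not> ?thesis"
    then have "T \<in> null_sets lborel" by (simp add: null_sets_def)
    then have "emeasure lborel (S - T) = emeasure lborel S"
      by (rule emeasure_Diff_null_set) simp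
    then have "emeasure lebesgue (S - T) = emeasure lborel S" by (simp add: emeasure_completion)
    also have "\<dots> = ennreal (measure lborel S)" using Sf by (simp add: emeasure_eq_ennreal_measure less_top)
    finally show False using T(4) by simp
  qed
  then have mT: "0 < measure lborel T" using Tf by (simp add: measure_def enn2real_positive_iff)
  have "1 / real (Suc n) * measure lborel T = (\<integral>x. 1 / real (Suc n) * indicator T x \<partial>lborel)"
    by simp
  also have "\<dots> \<le> (\<integral>x. (G x - c) * indicator T x \<partial>lborel)"
  proof (rule integral_mono)
    show "integrable lborel (\<lambda>x. 1 / real (Suc n) * indicator T x :: real)"
      using Tf by (intro integrable_mult_right integrable_real_indicator) auto
    show "integrable lborel (\<lambda>x. (G x - c) * indicator T x)"
    proof (rule Bochner_Integration.integrable_bound)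
      show "integrable lborel (\<lambda>x. (M + \<bar>c\<bar>) * indicator T x :: real)"
        using Tf by (intro integrable_mult_right integrable_real_indicator) auto
      have "\<bar>G x - c\<bar> \<le> \<bar>M + \<bar>c\<bar>\<bar>" for x using Gb[of x] by linarith
      then show "AE x in lborel. norm ((G x - c) * indicator T x) \<le> norm ((M + \<bar>c\<bar>) * indicator T x)"
        by (intro AE_I2) (simp add: indicator_def)
    qed measurable
    show "1 / real (Suc n) * indicator T x \<le> (G x - c) * indicator T x" for x
      using T(2) by (auto simp: indicator_def S_def)
  qed
  also have "\<dots> \<le> 0" by (rule cpt[OF cT])
  finally have "1 / real (Suc n) * measure lborel T \<le> 0" .
  moreover have "0 < 1 / real (Suc n) * measure lborel T" using mT by simp
  ultimately show False by linarith
qed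

section \<open>Hoelder regularity by doubling variables\<close>

text \<open>The right-hand side is a bounded function not tied to \<open>u\<close>, and the bounds
  hold at every point. Integrability of \<open>u powr r\<close> serves to make averages of
  \<open>u\<close> decay at infinity.\<close>

locale bounded_solution =
  fixes s C r :: real and u f :: "'a::euclidean_space \<Rightarrow> real"
  assumes s: "0 < s" "s < 1" and C: "0 < C" and r: "1 < r"
    and u_meas [measurable]: "u \<in> borel_measurable borel"
    and u_nonneg: "\<And>x. 0 \<le> u x" and u_le_1: "\<And>x. u x \<le> 1"
    and u_int: "integrable lborel (\<lambda>x. u x powr r)"
    and u_energy: "fin_energy s u"
    and f_meas [measurable]: "f \<in> borel_measurable borel" and f_bound: "\<And>x. \<bar>f x\<bar> \<le> 1"
    and eq: "\<And>\<phi>. lip_cs \<phi> \<Longrightarrow> C * form s u \<phi> = (\<integral>x. f x * \<phi> x \<partial>lborel)"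
begin

context
  fixes \<rho> :: "'a \<Rightarrow> real"
  assumes \<rho>_lip: "lip_cs \<rho>" and \<rho>_nonneg: "\<And>x. 0 \<le> \<rho> x" and \<rho>_int: "(\<integral>x. \<rho> x \<partial>lborel) = 1"
begin

text \<open>A correlation rather than a convolution: the weight \<open>\<rho> (y - x)\<close>, as a
  function of \<open>y\<close>, is itself the test function to insert into the equation.\<close>

definition avg :: "'a \<Rightarrow> real" where
  "avg x = (\<integral>y. u y * \<rho> (y - x) \<partial>lborel)"

lemma \<rho>_meas [measurable]: "\<rho> \<in> borel_measurable borel"
  by (rule lip_cs_measurable[OF \<rho>_lip])

lemma \<rho>_integrable: "integrable lborel \<rho>"
  using lip_cs_integrable_powr[OF \<rho>_lip, of 1] \<rho>_nonneg by simp

lemma \<rho>_shift: "integrable lborel (\<lambda>y. \<rho> (y - x))" "(\<integral>y. \<rho> (y - x) \<partial>lborel) = 1"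
  using lborel_translate[of \<rho> "- x"] \<rho>_integrable \<rho>_int by simp_all

lemma integrable_bounded_times:
  assumes [measurable]: "g \<in> borel_measurable borel" "w \<in> borel_measurable lborel" and "\<And>y. \<bar>g y\<bar> \<le> 1" "integrable lborel w"
  shows "integrable lborel (\<lambda>y::'a. g y * w y :: real)"
proof (rule Bochner_Integration.integrable_bound[OF assms(4)])
  show "AE y in lborel. norm (g y * w y) \<le> norm (w y)"
    using assms(3) by (intro AE_I2) (simp add: abs_mult mult_le_cancel_right1 mult_left_le_one_le)
qed measurable

lemma u_abs: "\<bar>u x\<bar> \<le> 1"
  using u_nonneg[of x] u_le_1[of x] by simp

lemma avg_integrable: "integrable lborel (\<lambda>y. u y * \<rho> (y - x))"
  by (rule integrable_bounded_times) (use u_abs \<rho>_shift in auto)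

lemma avg_shift:
  "integrable lborel (\<lambda>z. u (z + a) * \<rho> (z - b))" "(\<integral>z. u (z + a) * \<rho> (z - b) \<partial>lborel) = avg (b + a)"
  using lborel_translate[of "\<lambda>y. u y * \<rho> (y - (b + a))" a] avg_integrable[of "b + a"]
  by (simp_all add: avg_def add.commute)

lemma avg_nonneg: "0 \<le> avg x"
  unfolding avg_def by (intro integral_nonneg_AE) (simp add: u_nonneg \<rho>_nonneg)

lemma avg_le_1: "avg x \<le> 1"
proof -
  have "avg x \<le> (\<integral>y. \<rho> (y - x) \<partial>lborel)"
    unfolding avg_def using \<rho>_shift(1) avg_integrable
    by (intro integral_mono) (auto simp: u_le_1 u_nonneg \<rho>_nonneg mult_left_le_one_le)
  then show ?thesis by (simp add: \<rho>_shift)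
qed

text \<open>The equation tested with a translate of \<open>\<rho>\<close>: after the substitution
  \<open>y = z + h\<close>, integration over \<open>z\<close> comes first. The bound
  \<open>1 / C\<close> reflects \<open>\<bar>f\<bar> \<le> 1\<close> and the unit mass of
  \<open>\<rho>\<close>, hence does not depend on how concentrated \<open>\<rho>\<close> is.\<close>

lemma second_difference:
  "integrable lborel (\<lambda>h. (2 * avg x - avg (x + h) - avg (x - h)) * ker s h)"
  "\<bar>\<integral>h. (2 * avg x - avg (x + h) - avg (x - h)) * ker s h \<partial>lborel\<bar> \<le> 1 / C"
proof -
  define \<phi> where "\<phi> = (\<lambda>y. \<rho> (y - x))"
  have lc: "lip_cs \<phi>"
  proof -
    obtain L R where L: "L-lipschitz_on UNIV \<rho>" "{x. \<rho> x \<noteq> 0} \<subseteq> cball 0 R"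
      using lip_cs_bounded[OF \<rho>_lip] by metis
    have "L-lipschitz_on UNIV \<phi>"
    proof (rule lipschitz_onI)
      show "dist (\<phi> y) (\<phi> z) \<le> L * dist y z" for y z
        using lipschitz_onD[OF L(1), of "y - x" "z - x"] by (simp add: \<phi>_def dist_norm)
    qed (rule lipschitz_on_nonneg[OF L(1)])
    moreover have "{y. \<phi> y \<noteq> 0} \<subseteq> cball x R"
      using L(2) by (auto simp: \<phi>_def dist_norm norm_minus_commute subset_iff)
    ultimately show ?thesis
      unfolding lip_cs_def using bounded_subset[OF bounded_cball] by blast
  qed
  have [measurable]: "\<phi> \<in> borel_measurable borel" by (rule lip_cs_measurable[OF lc])
  have fe: "fin_energy s \<phi>" by (rule lip_cs_fin_energy[OF s lc])
  define F where "F = (\<lambda>p. dif u p * dif \<phi> p * ker2 s p)"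
  have [measurable]: "F \<in> borel_measurable lborel2" unfolding F_def by measurable
  have iF: "integrable lborel2 F" unfolding F_def by (rule form_integrable[OF u_energy fe])
  define G where "G = (\<lambda>z h. (u z - u (z + h)) * (\<phi> z - \<phi> (z + h)) * ker s h)"
  have GF: "(\<lambda>p. F (case p of (z, h) \<Rightarrow> (z, z + h))) = (\<lambda>(z, h). G z h)"
    by (auto simp: F_def G_def fun_eq_iff)
  have sm: "(\<lambda>(z, h). (z, z + h)) \<in> measurable lborel2 (lborel2 :: ('a \<times> 'a) measure)"
    by measurable
  have iG: "integrable lborel2 (\<lambda>(z, h). G z h)"
    using measure_preserving_integral(1)[OF distr_shear_lborel2 sm, of F] iF by (simp add: GF)
  have eG: "form s u \<phi> = (\<integral>p. (\<lambda>(z, h). G z h) p \<partial>lborel2)"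
  proof -
    have "form s u \<phi> = (\<integral>p. F p \<partial>lborel2)" by (simp add: form_def F_def)
    also have "\<dots> = (\<integral>p. F (case p of (z, h) \<Rightarrow> (z, z + h)) \<partial>lborel2)"
      by (rule measure_preserving_integral(2)[OF distr_shear_lborel2 sm, symmetric]) measurable
    finally show ?thesis by (simp only: GF)
  qed
  \<comment> \<open>Expanding the product of increments leaves four shifted averages; the two
    unmixed terms both equal \<open>avg x\<close>.\<close>
  have inner: "(\<integral>z. G z h \<partial>lborel) = (2 * avg x - avg (x + h) - avg (x - h)) * ker s h" for h
  proof -
    have 1: "integrable lborel (\<lambda>z. u z * \<phi> z)" "(\<integral>z. u z * \<phi> z \<partial>lborel) = avg x"
      using avg_shift[of 0 x] by (simp_all add: \<phi>_def)
    have 2: "integrable lborel (\<lambda>z. u z * \<phi> (z + h))" "(\<integral>z. u z * \<phi> (z + h) \<partial>lborel) = avg (x - h)"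
      using avg_shift[of 0 "x - h"] by (simp_all add: \<phi>_def algebra_simps)
    have 3: "integrable lborel (\<lambda>z. u (z + h) * \<phi> z)" "(\<integral>z. u (z + h) * \<phi> z \<partial>lborel) = avg (x + h)"
      using avg_shift[of h x] by (simp_all add: \<phi>_def)
    have 4: "integrable lborel (\<lambda>z. u (z + h) * \<phi> (z + h))" "(\<integral>z. u (z + h) * \<phi> (z + h) \<partial>lborel) = avg x"
      using avg_shift[of h "x - h"] by (simp_all add: \<phi>_def algebra_simps)
    have "G z h = (u z * \<phi> z - u z * \<phi> (z + h) - u (z + h) * \<phi> z + u (z + h) * \<phi> (z + h)) * ker s h" for z
      by (simp add: G_def algebra_simps)
    then have "(\<integral>z. G z h \<partial>lborel) = (\<integral>z. u z * \<phi> z - u z * \<phi> (z + h) - u (z + h) * \<phi> z + u (z + h) * \<phi> (z + h) \<partial>lborel) * ker s h"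
      by simp
    also have "(\<integral>z. u z * \<phi> z - u z * \<phi> (z + h) - u (z + h) * \<phi> z + u (z + h) * \<phi> (z + h) \<partial>lborel)
      = avg x - avg (x - h) - avg (x + h) + avg x"
      using 1 2 3 4 by simp
    finally show ?thesis by (simp add: algebra_simps)
  qed
  show "integrable lborel (\<lambda>h. (2 * avg x - avg (x + h) - avg (x - h)) * ker s h)"
    using lborel_pair.integrable_snd[OF iG] by (simp add: inner)
  have "(\<integral>h. (2 * avg x - avg (x + h) - avg (x - h)) * ker s h \<partial>lborel) = form s u \<phi>"
    using lborel_pair.integral_snd[OF iG] eG by (simp add: inner)
  also have "\<bar>\<dots>\<bar> \<le> 1 / C"
  proof -
    have "\<bar>C * form s u \<phi>\<bar> = \<bar>\<integral>y. f y * \<phi> y \<partial>lborel\<bar>" by (simp add: eq[OF lc])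
    also have "\<dots> \<le> (\<integral>y. \<phi> y \<partial>lborel)"
    proof (rule integral_abs_bound_integral)
      show "integrable lborel \<phi>" using \<rho>_shift by (simp add: \<phi>_def)
      then show "integrable lborel (\<lambda>y. f y * \<phi> y)"
        by (intro integrable_bounded_times f_bound) auto
      show "\<bar>f y * \<phi> y\<bar> \<le> \<phi> y" for y
        using f_bound[of y] \<rho>_nonneg by (simp add: \<phi>_def abs_mult mult_left_le_one_le)
    qed
    also have "\<dots> = 1" using \<rho>_shift by (simp add: \<phi>_def)
    finally show ?thesis using C by (simp add: abs_mult field_simps)
  qed
  finally show "\<bar>\<integral>h. (2 * avg x - avg (x + h) - avg (x - h)) * ker s h \<partial>lborel\<bar> \<le> 1 / C" .
qed

lemma avg_continuous: "continuous_on UNIV avg"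
proof -
  obtain L M R where L: "L-lipschitz_on UNIV \<rho>" "\<And>x. \<bar>\<rho> x\<bar> \<le> M" "0 < R" "{x. \<rho> x \<noteq> 0} \<subseteq> cball 0 R"
    using lip_cs_bounded[OF \<rho>_lip] by metis
  have L0: "0 \<le> L" by (rule lipschitz_on_nonneg[OF L(1)])
  let ?I = "\<lambda>x. indicator (cball x R) :: 'a \<Rightarrow> real"
  have ii: "integrable lborel (?I x)" for x
    using emeasure_bounded_finite[OF bounded_cball[of x R]] by (intro integrable_real_indicator) auto
  define K where "K = measure lborel (cball (0::'a) R)"
  have K: "measure lborel (cball x R) = K" for x :: 'a
    unfolding K_def using L(3) by (simp add: content_cball)
  have "(L * (2 * K))-lipschitz_on UNIV avg"
  proof (rule lipschitz_onI)
    fix x x' :: 'a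
    have "avg x - avg x' = (\<integral>y. u y * (\<rho> (y - x) - \<rho> (y - x')) \<partial>lborel)"
      unfolding avg_def using avg_integrable by (simp add: right_diff_distrib)
    also have "\<bar>\<dots>\<bar> \<le> (\<integral>y. L * dist x x' * (?I x y + ?I x' y) \<partial>lborel)"
    proof (rule integral_abs_bound_integral)
      show "integrable lborel (\<lambda>y. u y * (\<rho> (y - x) - \<rho> (y - x')))"
        using Bochner_Integration.integrable_diff[OF avg_integrable[of x] avg_integrable[of x']] by (simp add: right_diff_distrib)
      show "integrable lborel (\<lambda>y. L * dist x x' * (?I x y + ?I x' y))" using ii by simp
      fix y
      have "\<bar>u y * (\<rho> (y - x) - \<rho> (y - x'))\<bar> \<le> \<bar>\<rho> (y - x) - \<rho> (y - x')\<bar>"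
        using u_abs[of y] by (simp add: abs_mult mult_left_le_one_le)
      also have "\<dots> \<le> L * dist x x' * (?I x y + ?I x' y)"
      proof (cases "y \<in> cball x R \<or> y \<in> cball x' R")
        case True
        have "\<bar>\<rho> (y - x) - \<rho> (y - x')\<bar> \<le> L * dist x x'"
          using lipschitz_onD[OF L(1), of "y - x" "y - x'"] by (simp add: dist_norm norm_minus_commute)
        also have "\<dots> \<le> L * dist x x' * (?I x y + ?I x' y)"
          using True L0 mult_nonneg_nonneg[OF L0 zero_le_dist[of x x']] by (auto simp: indicator_def)
        finally show ?thesis .
      next
        case False
        then have "\<rho> (y - x) = 0" "\<rho> (y - x') = 0"
          using L(4) by (auto simp: dist_norm norm_minus_commute subset_iff)
        then show ?thesis using L0 by simp
      qed
      finally show "\<bar>u y * (\<rho> (y - x) - \<rho> (y - x'))\<bar> \<le> L * dist x x' * (?I x y + ?I x' y)" .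
    qed
    also have "\<dots> = L * dist x x' * (K + K)"
      using ii by (simp add: K)
    finally show "dist (avg x) (avg x') \<le> L * (2 * K) * dist x x'"
      by (simp add: dist_real_def algebra_simps)
  qed (use L0 in \<open>simp add: K_def\<close>)
  then show ?thesis by (rule lipschitz_on_continuous_on)
qed

text \<open>Above the level \<open>e / 2\<close> the function \<open>u\<close> is controlled by a
  multiple of \<open>u powr r\<close>, whose integral has small tails. Decay is needed for the
  doubled function to attain its maximum.\<close>

lemma avg_vanishes:
  assumes "0 < e"
  shows "\<exists>R. \<forall>x. R < norm x \<longrightarrow> avg x < e"
proof -
  obtain L M R where L: "L-lipschitz_on UNIV \<rho>" "\<And>x. \<bar>\<rho> x\<bar> \<le> M" "0 < R" "{x. \<rho> x \<noteq> 0} \<subseteq> cball 0 R"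
    using lip_cs_bounded[OF \<rho>_lip] by metis
  have M0: "0 \<le> M" using L(2)[of 0] by linarith
  \<comment> \<open>Chosen so that \<open>t \<le> c * t powr r\<close> whenever
    \<open>t \<ge> e / 2\<close>; this uses \<open>r > 1\<close>.\<close>
  define c where "c = (e / 2) powr (1 - r)"
  have c: "0 < c" using assms by (simp add: c_def)
  have ptw: "u y \<le> e / 2 + c * u y powr r" for y
  proof (cases "u y \<le> e / 2")
    case False
    then have uy: "0 < u y" "e / 2 \<le> u y" using assms by auto
    have "u y powr (1 - r) \<le> (e / 2) powr (1 - r)"
      using uy r assms by (intro powr_mono2') auto
    then have "u y powr (1 - r) * u y powr r \<le> c * u y powr r"
      unfolding c_def by (rule mult_right_mono) simp
    moreover have "u y powr (1 - r) * u y powr r = u y"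
      using uy by (simp flip: powr_add)
    ultimately show ?thesis using assms by simp
  qed (use c in \<open>simp add: add_increasing2\<close>)
  define tail where "tail = (\<lambda>n. \<integral>y. indicator (- cball 0 (real n)) y * u y powr r \<partial>lborel)"
  have ti: "integrable lborel (\<lambda>y. indicator (- cball 0 t) y * u y powr r)" for t :: real
    using integrable_mult_indicator[OF _ u_int, of "- cball 0 t"] by simp
  have "0 < e / (2 * (c * M + 1))" using assms c M0 by (simp add: add_nonneg_pos)
  then obtain n where n: "tail n < e / (2 * (c * M + 1))"
    using integral_tail_small[OF u_int] unfolding tail_def by blast
  have "avg x < e" if x: "real n + R < norm x" for x
  proof -
    have "avg x \<le> (\<integral>y. e / 2 * \<rho> (y - x) + c * M * (indicator (- cball 0 (real n)) y * u y powr r) \<partial>lborel)"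
      unfolding avg_def
    proof (rule integral_mono[OF avg_integrable])
      show "integrable lborel (\<lambda>y. e / 2 * \<rho> (y - x) + c * M * (indicator (- cball 0 (real n)) y * u y powr r))"
        using \<rho>_shift(1)[of x] ti[of "real n"] by (intro Bochner_Integration.integrable_add integrable_mult_right) auto
      fix y
      show "u y * \<rho> (y - x) \<le> e / 2 * \<rho> (y - x) + c * M * (indicator (- cball 0 (real n)) y * u y powr r)"
      proof (cases "\<rho> (y - x) = 0")
        case True then show ?thesis using c M0 by simp
      next
        case False
        then have "y - x \<in> cball 0 R" using L(4) by blast
        then have "norm (y - x) \<le> R" by simp
        then have "real n < norm y" using x norm_triangle_ineq2[of x y] by (simp add: norm_minus_commute)
        have "u y * \<rho> (y - x) \<le> (e / 2 + c * u y powr r) * \<rho> (y - x)"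
          by (intro mult_right_mono ptw \<rho>_nonneg)
        also have "\<dots> = e / 2 * \<rho> (y - x) + c * u y powr r * \<rho> (y - x)" by (simp add: algebra_simps)
        also have "c * u y powr r * \<rho> (y - x) \<le> c * u y powr r * M"
          using c L(2)[of "y - x"] by (intro mult_left_mono) auto
        finally show ?thesis using \<open>real n < norm y\<close> by (simp add: algebra_simps)
      qed
    qed
    also have "\<dots> = e / 2 * 1 + c * M * tail n"
      using \<rho>_shift[of x] ti[of "real n"] unfolding tail_def
      by (subst Bochner_Integration.integral_add) auto
    also have "\<dots> < e"
    proof -
      have "c * M * tail n \<le> c * M * (e / (2 * (c * M + 1)))"
        using n c M0 by (intro mult_left_mono) auto
      also have "\<dots> < e / 2"
      proof -
        have "0 \<le> c * M" using c M0 by simp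
        then show ?thesis using assms by (simp add: field_simps)
      qed
      finally show ?thesis by simp
    qed
    finally show ?thesis .
  qed
  then show ?thesis by blast
qed

end

text \<open>The second summand balances \<open>unit_ball_vol / 4 ^ N * (2 - 2 powr s) * L\<close>
  against \<open>1 / C\<close>, the contradiction sought in \<open>avg_hoelder\<close>. Adding
  \<open>1\<close> makes the inequality strict and \<open>L \<ge> 1\<close>.\<close>

definition hoelder_const :: real where
  "hoelder_const = 1 + 4 ^ DIM('a) / (C * unit_ball_vol DIM('a) * (2 - 2 powr s))"

lemma hoelder_const_ge_1: "1 \<le> hoelder_const"
  and hoelder_const_large: "1 / C < unit_ball_vol DIM('a) / 4 ^ DIM('a) * ((2 - 2 powr s) * hoelder_const)"
proof -
  let ?V = "unit_ball_vol DIM('a)"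
  have "2 powr s < 2 powr 1" using s by (intro powr_less_mono) auto
  then have t: "0 < 2 - 2 powr s" by simp
  have V: "0 < ?V" by simp
  have p: "0 < C * ?V * (2 - 2 powr s)" using C V t by (intro mult_pos_pos)
  then show "1 \<le> hoelder_const" by (simp add: hoelder_const_def)
  have "?V / 4 ^ DIM('a) * ((2 - 2 powr s) * hoelder_const)
     = ?V / 4 ^ DIM('a) * (2 - 2 powr s) + ?V / 4 ^ DIM('a) * (2 - 2 powr s) * (4 ^ DIM('a) / (C * ?V * (2 - 2 powr s)))"
  proof -
    have "a * (b * (1 + c)) = a * b + a * b * c" for a b c :: real by (simp add: algebra_simps)
    then show ?thesis unfolding hoelder_const_def .
  qed
  also have "?V / 4 ^ DIM('a) * (2 - 2 powr s) * (4 ^ DIM('a) / (C * ?V * (2 - 2 powr s))) = 1 / C"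
  proof -
    have "a / b * c * (b / (C * a * c)) = 1 / C" if "0 < a" "0 < b" "0 < c" for a b c :: real
      using that C by (simp add: field_simps)
    from this[OF V _ t, of "4 ^ DIM('a)"] show ?thesis by simp
  qed
  finally show "1 / C < ?V / 4 ^ DIM('a) * ((2 - 2 powr s) * hoelder_const)"
    using V t by simp
qed

text \<open>
  Hoelder estimate by doubling variables. Let \<open>v\<close> be a mollification of \<open>u\<close> and let
  \<open>v x - v y - L \<bar>x - y\<bar>\<^sup>s\<close> be maximal with \<open>D = v x - v y\<close> and \<open>e = x - y\<close>. Then
  \<open>g h = v (x + h) - v (y + h)\<close> satisfies \<open>g \<le> D\<close>, and for \<open>h\<close> near \<open>\<plusminus>e / 2\<close> the sum
  \<open>g (z - e / 2) + g (z + e / 2)\<close> telescopes to a difference of \<open>v\<close> at distance \<open>2 \<bar>e\<bar>\<close>, which is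
  at most \<open>D + (2\<^sup>s - 1) L \<bar>e\<bar>\<^sup>s\<close> instead of \<open>2 D\<close>. This gain contradicts the bound on the second
  differences of \<open>v\<close> when \<open>L\<close> is large.
\<close>

lemma avg_hoelder:
  assumes \<rho>: "lip_cs \<rho>" "\<And>x. 0 \<le> \<rho> x" "(\<integral>x. \<rho> x \<partial>lborel) = 1"
  shows "avg \<rho> x1 - avg \<rho> y1 \<le> hoelder_const * norm (x1 - y1) powr s"
proof (rule ccontr)
  define v where "v = avg \<rho>"
  define L where "L = hoelder_const"
  note sd = second_difference[OF \<rho>, folded v_def]
  have v0: "0 \<le> v x" and v1: "v x \<le> 1" for x
    unfolding v_def by (rule avg_nonneg[OF \<rho>] avg_le_1[OF \<rho>])+
  have cv: "continuous_on UNIV v" unfolding v_def by (rule avg_continuous[OF \<rho>])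
  have L1: "1 \<le> L" unfolding L_def by (rule hoelder_const_ge_1)
  define m where "m = v x1 - v y1 - L * norm (x1 - y1) powr s"
  assume "\<not> ?thesis"
  then have m: "0 < m" by (simp add: m_def v_def L_def)
  define \<Phi> where "\<Phi> = (\<lambda>p. v (fst p) - v (snd p) - L * norm (fst p - snd p) powr s)"
  obtain R0 where R0: "\<And>x. R0 < norm x \<Longrightarrow> v x < m"
    using avg_vanishes[OF \<rho> m] unfolding v_def by blast
  define R where "R = max R0 (norm x1)"
  have x1R: "x1 \<in> cball 0 R" by (simp add: R_def)
  \<comment> \<open>For \<open>x\<close> far out \<open>v x\<close> alone is below \<open>m\<close>.
    For \<open>x\<close> in the ball and \<open>y\<close> outside the larger one, the distance
    exceeds \<open>1\<close>, and with \<open>L \<ge> 1\<close> the penalty absorbs the whole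
    oscillation. Hence the maximum is attained on a compact set.\<close>
  have far: "\<Phi> (x, y) < m" if "(x, y) \<notin> cball 0 R \<times> cball 0 (R + 1)" for x y
  proof (cases "x \<in> cball 0 R")
    case False
    then have "v x < m" by (intro R0) (simp add: R_def)
    moreover have "0 \<le> L * norm (x - y) powr s" using L1 by simp
    ultimately show ?thesis using v0[of y] by (simp add: \<Phi>_def)
  next
    case True
    with that have "R + 1 < norm y" "norm x \<le> R" by auto
    then have "1 < norm (x - y)" using norm_triangle_ineq2[of y x] by (simp add: norm_minus_commute)
    then have "1 \<le> norm (x - y) powr s" using s by (simp add: ge_one_powr_ge_zero)
    then have "1 * 1 \<le> L * norm (x - y) powr s" using L1 by (intro mult_mono) auto
    then show ?thesis using v0[of y] v1[of x] m by (simp add: \<Phi>_def)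
  qed
  have c\<Phi>: "continuous_on S \<Phi>" for S
    unfolding \<Phi>_def using s
    by (intro continuous_intros continuous_on_compose2[OF cv] continuous_on_powr') auto
  have y1R: "(x1, y1) \<in> cball 0 R \<times> cball 0 (R + 1)"
    using far[of x1 y1] by (rule_tac ccontr) (simp add: \<Phi>_def m_def)
  obtain p0 where p0: "p0 \<in> cball 0 R \<times> cball 0 (R + 1)"
    "\<forall>p\<in>cball 0 R \<times> cball 0 (R + 1). \<Phi> p \<le> \<Phi> p0"
    using continuous_attains_sup[of "cball 0 R \<times> cball (0::'a) (R + 1)" \<Phi>] y1R c\<Phi> compact_Times[OF compact_cball compact_cball] by blast
  obtain x y where xy: "p0 = (x, y)" by (cases p0)
  have ge_m: "m \<le> \<Phi> (x, y)" using p0(2)[rule_format, OF y1R] xy by (simp add: \<Phi>_def m_def)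
  have max: "\<Phi> (x', y') \<le> \<Phi> (x, y)" for x' y'
    using far[of x' y'] p0(2) ge_m xy by (cases "(x', y') \<in> cball 0 R \<times> cball 0 (R + 1)") auto
  define e where "e = x - y"
  define a where "a = norm e"
  define D where "D = v x - v y"
  have DL: "L * a powr s < D" using ge_m m by (simp add: \<Phi>_def D_def a_def e_def)
  have "0 \<le> L * a powr s" using L1 by simp
  with DL have D0: "0 < D" by linarith
  then have "x \<noteq> y" by (auto simp: D_def)
  then have a0: "0 < a" by (simp add: a_def e_def)
  have "D \<le> 1" using v0[of y] v1[of x] by (simp add: D_def)
  \<comment> \<open>At distance \<open>1\<close> or more the penalty would exceed the largest
    possible oscillation. The bound is used at the end, where \<open>a powr (- s) \<ge> 1\<close> is
    needed.\<close>
  have a1: "a < 1"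
  proof (rule ccontr)
    assume "\<not> a < 1"
    then have "1 \<le> a powr s" using s by (simp add: ge_one_powr_ge_zero)
    then have "1 * 1 \<le> L * a powr s" using L1 by (intro mult_mono) auto
    with DL \<open>D \<le> 1\<close> show False by simp
  qed
  have maxD: "v x' - v y' \<le> D - L * a powr s + L * norm (x' - y') powr s" for x' y'
    using max[of x' y'] by (simp add: \<Phi>_def D_def a_def e_def)
  define g where "g = (\<lambda>h. v (x + h) - v (y + h))"
  define J where "J = (\<lambda>h. 2 * D - g h - g (- h))"
  \<comment> \<open>A common shift of both points leaves the penalty unchanged.\<close>
  have gD: "g h \<le> D" for h
    using maxD[of "x + h" "y + h"] by (simp add: g_def a_def e_def)
  have J0: "0 \<le> J h" for h using gD[of h] gD[of "- h"] by (simp add: J_def)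
  have cJ: "continuous_on UNIV J"
    unfolding J_def g_def by (intro continuous_intros continuous_on_compose2[OF cv]) auto
  then have [measurable]: "J \<in> borel_measurable borel" by (rule borel_measurable_continuous_onI)
  have Jeq: "J h * ker s h = (2 * v x - v (x + h) - v (x - h)) * ker s h - (2 * v y - v (y + h) - v (y - h)) * ker s h" for h
    by (simp add: J_def g_def D_def algebra_simps)
  have iJ: "integrable lborel (\<lambda>h. J h * ker s h)"
    unfolding Jeq by (intro Bochner_Integration.integrable_diff sd(1))
  have "(\<integral>h. J h * ker s h \<partial>lborel) = (\<integral>h. (2 * v x - v (x + h) - v (x - h)) * ker s h \<partial>lborel) - (\<integral>h. (2 * v y - v (y + h) - v (y - h)) * ker s h \<partial>lborel)"
    unfolding Jeq by (intro Bochner_Integration.integral_diff sd(1))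
  then have upper: "(\<integral>h. J h * ker s h \<partial>lborel) \<le> 2 / C"
    using sd(2)[of x] sd(2)[of y] by (simp add: abs_le_iff)
  \<comment> \<open>With radius \<open>a / 4\<close> the balls about \<open>E\<close> and
    \<open>- E\<close>, whose centers are \<open>a\<close> apart, are disjoint and lie in
    \<open>a / 4 \<le> norm h \<le> a\<close>.\<close>
  define B where "B = (\<lambda>c::'a. ball c (a / 4))"
  define E where "E = (1/2) *\<^sub>R e"
  have nE: "norm E = a / 2" by (simp add: E_def a_def)
  have J_sum: "2 * (2 - 2 powr s) * (L * a powr s) \<le> J (z - E) + J (z + E)" for z
  proof -
    have pair: "g (w - E) + g (w + E) \<le> D - L * a powr s + 2 powr s * (L * a powr s)" for w
    proof -
      have EE: "E + E = x - y" by (simp add: E_def e_def flip: scaleR_left_distrib)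
      then have "x = y + E + E" by (simp add: algebra_simps)
      then have "g (w - E) + g (w + E) = v (x + (w + E)) - v (y + (w - E))"
        by (simp add: g_def algebra_simps)
      also have "\<dots> \<le> D - L * a powr s + L * norm ((x + (w + E)) - (y + (w - E))) powr s"
        by (rule maxD)
      also have "(x + (w + E)) - (y + (w - E)) = 2 *\<^sub>R e"
      proof -
        have "(x + (w + E)) - (y + (w - E)) = (x - y) + (E + E)" by (simp add: algebra_simps)
        then show ?thesis unfolding EE by (simp add: e_def scaleR_2)
      qed
      also have "norm (2 *\<^sub>R e) powr s = 2 powr s * a powr s"
        by (simp add: a_def powr_mult)
      finally show ?thesis by (simp add: mult.left_commute)
    qed
    have "J (z - E) + J (z + E) = 4 * D - (g (z - E) + g (z + E)) - (g (- z - E) + g (- z + E))"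
    proof -
      have "- (z - E) = - z + E" "- (z + E) = - z - E" by simp_all
      then show ?thesis unfolding J_def by simp
    qed
    moreover have "4 * P - 2 * Q \<le> S"
      if "S = 4 * d - t1 - t2" "t1 \<le> d - P + Q" "t2 \<le> d - P + Q" "P < d" for S d t1 t2 P Q :: real
      using that by simp
    ultimately have "4 * (L * a powr s) - 2 * (2 powr s * (L * a powr s)) \<le> J (z - E) + J (z + E)"
      using pair[of z] pair[of "- z"] DL by blast
    moreover have "2 * (2 - 2 powr s) * (L * a powr s) = 4 * (L * a powr s) - 2 * (2 powr s * (L * a powr s))"
      by (simp add: algebra_simps)
    ultimately show ?thesis by simp
  qed
  have iB: "integrable lborel (\<lambda>h. J h * indicator (B c) h)" for c
  proof -
    have "integrable lborel (\<lambda>h. indicator (cball c (a/4)) h *\<^sub>R J h)"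
      by (rule borel_integrable_compact) (auto intro: continuous_on_subset[OF cJ])
    then show ?thesis
      by (rule Bochner_Integration.integrable_bound) (auto simp: B_def indicator_def)
  qed
  have shift: "(\<integral>h. J h * indicator (B c) h \<partial>lborel) = (\<integral>z. J (z + c) * indicator (B 0) z \<partial>lborel)"
    "integrable lborel (\<lambda>z. J (z + c) * indicator (B 0) z)" for c
  proof -
    have ind: "indicator (ball c (a / 4)) (z + c) = (indicator (ball 0 (a / 4)) z :: real)" for z
      by (simp add: indicator_def dist_norm)
    show "(\<integral>h. J h * indicator (B c) h \<partial>lborel) = (\<integral>z. J (z + c) * indicator (B 0) z \<partial>lborel)"
      "integrable lborel (\<lambda>z. J (z + c) * indicator (B 0) z)"
      using lborel_translate[of "\<lambda>h. J h * indicator (B c) h" c] iB[of c]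
      by (simp_all add: ind add.commute B_def)
  qed
  \<comment> \<open>The kernel at distance \<open>a\<close>, hence a lower bound for it on both
    balls.\<close>
  define k where "k = 1 / a powr (real DIM('a) + 2 * s)"
  have k0: "0 < k" using a0 by (simp add: k_def)
  have lower: "k * (J h * indicator (B (- E)) h + J h * indicator (B E) h) \<le> J h * ker s h" for h
  proof (cases "h \<in> B (- E) \<or> h \<in> B E")
    case True
    have d: "dist (- E) E = a"
    proof -
      have "dist (- E) E = norm (2 *\<^sub>R E)" by (simp add: dist_norm scaleR_2 norm_minus_commute flip: norm_minus_cancel[of "- E - E"])
      then show ?thesis by (simp add: nE)
    qed
    have one: "indicator (B (- E)) h + indicator (B E) h \<le> (1::real)"
    proof -
      have "\<not> (h \<in> B (- E) \<and> h \<in> B E)"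
        using dist_triangle[of "- E" E h] d a0 by (auto simp: B_def dist_commute)
      then show ?thesis by (auto simp: indicator_def)
    qed
    have h: "a / 4 \<le> norm h" "norm h \<le> a"
    proof -
      have "norm (h - E) < a / 4 \<or> norm (h + E) < a / 4"
        using True by (auto simp: B_def dist_norm norm_minus_commute)
      then show "a / 4 \<le> norm h" "norm h \<le> a"
        using norm_triangle_ineq2[of E h] norm_triangle_ineq2[of "- E" h] norm_triangle_ineq2[of h E] norm_triangle_ineq2[of h "- E"] nE a0
        by (auto simp: norm_minus_commute add.commute)
    qed
    have "k \<le> ker s h"
      unfolding k_def ker_def using h a0 s
      by (intro divide_left_mono powr_mono2 mult_pos_pos) auto
    then have "k * (J h * (indicator (B (- E)) h + indicator (B E) h)) \<le> ker s h * (J h * 1)"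
      using J0 one k0 by (intro mult_mono mult_left_mono) auto
    then show ?thesis by (simp add: algebra_simps)
  next
    case False
    then show ?thesis using J0[of h] by simp
  qed
  have "k * ((2 * (2 - 2 powr s) * (L * a powr s)) * measure lborel (B 0))
      = k * (\<integral>z. 2 * (2 - 2 powr s) * (L * a powr s) * indicator (B 0) z \<partial>lborel)"
    by (simp add: B_def)
  also have "\<dots> \<le> k * (\<integral>z. J (z + - E) * indicator (B 0) z + J (z + E) * indicator (B 0) z \<partial>lborel)"
  proof (intro mult_left_mono integral_mono)
    show "integrable lborel (\<lambda>z. 2 * (2 - 2 powr s) * (L * a powr s) * indicator (B 0) z :: real)"
      using emeasure_bounded_finite[of "B 0"] by (intro integrable_mult_right integrable_real_indicator) (auto simp: B_def)
    show "integrable lborel (\<lambda>z. J (z + - E) * indicator (B 0) z + J (z + E) * indicator (B 0) z)"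
      by (intro Bochner_Integration.integrable_add shift(2))
    show "2 * (2 - 2 powr s) * (L * a powr s) * indicator (B 0) z \<le> J (z + - E) * indicator (B 0) z + J (z + E) * indicator (B 0) z" for z
      using J_sum[of z] by (simp add: indicator_def)
  qed (use k0 in simp)
  also have "\<dots> = k * ((\<integral>h. J h * indicator (B (- E)) h \<partial>lborel) + (\<integral>h. J h * indicator (B E) h \<partial>lborel))"
    using shift[of "- E"] shift[of E] by simp
  also have "\<dots> = (\<integral>h. k * (J h * indicator (B (- E)) h + J h * indicator (B E) h) \<partial>lborel)"
    using iB by simp
  also have "\<dots> \<le> (\<integral>h. J h * ker s h \<partial>lborel)"
    by (rule integral_mono[OF _ iJ lower]) (use iB in simp)
  also note upper
  finally have fin: "k * ((2 * (2 - 2 powr s) * (L * a powr s)) * measure lborel (B 0)) \<le> 2 / C" .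
  let ?V = "unit_ball_vol DIM('a)"
  have "measure lborel (B 0) = ?V * (a / 4) ^ DIM('a)"
    using a0 by (simp add: B_def content_ball)
  also have "\<dots> = ?V / 4 ^ DIM('a) * a powr real DIM('a)"
    using a0 by (simp add: powr_realpow power_divide)
  finally have mB: "measure lborel (B 0) = ?V / 4 ^ DIM('a) * a powr real DIM('a)" .
  have "k * ((2 * (2 - 2 powr s) * (L * a powr s)) * measure lborel (B 0))
     = 2 * (?V / 4 ^ DIM('a) * ((2 - 2 powr s) * L)) * (k * (a powr s * a powr real DIM('a)))"
    unfolding mB by (simp add: algebra_simps)
  \<comment> \<open>Scaling count: the kernel contributes \<open>- (N + 2 * s)\<close>, the gain
    \<open>s\<close>, the volume of the ball \<open>N\<close>. The total \<open>- s\<close> is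
    negative, so small \<open>a\<close> only helps.\<close>
  also have "k * (a powr s * a powr real DIM('a)) = a powr (- s)"
  proof -
    have "k = a powr (- (real DIM('a) + 2 * s))" by (simp only: k_def powr_minus_divide)
    then have "k * (a powr s * a powr real DIM('a)) = a powr (- (real DIM('a) + 2 * s) + (s + real DIM('a)))"
      by (simp only: powr_add)
    then show ?thesis by simp
  qed
  finally have "2 * (?V / 4 ^ DIM('a) * ((2 - 2 powr s) * L)) * a powr (- s) \<le> 2 / C" using fin by simp
  moreover have "1 \<le> a powr (- s)"
    using a0 a1 s powr_mono'[of "- s" 0 a] by simp
  moreover have big: "1 / C < ?V / 4 ^ DIM('a) * ((2 - 2 powr s) * L)"
    unfolding L_def by (rule hoelder_const_large)
  moreover have "2 * (?V / 4 ^ DIM('a) * ((2 - 2 powr s) * L)) * 1 \<le> 2 * (?V / 4 ^ DIM('a) * ((2 - 2 powr s) * L)) * a powr (- s)"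
  proof (rule mult_left_mono[OF \<open>1 \<le> a powr (- s)\<close>])
    have "0 < 1 / C" using C by simp
    with big show "0 \<le> 2 * (?V / 4 ^ DIM('a) * ((2 - 2 powr s) * L))" by linarith
  qed
  ultimately show False by simp
qed

text \<open>The estimate for averages does not depend on \<open>\<rho>\<close>, and
  \<open>avg \<rho> h - avg \<rho> 0\<close> is the increment of \<open>u\<close> tested against
  \<open>\<rho>\<close>. Letting \<open>\<rho>\<close> range over all normalized weights removes the
  averaging.\<close>

lemma increment_AE: "AE z in lborel. u (z + h) - u z \<le> hoelder_const * norm h powr s"
proof (rule AE_le_of_lip_cs_tests)
  show "(\<lambda>z. u (z + h) - u z) \<in> borel_measurable borel" by measurable
  show "\<bar>u (z + h) - u z\<bar> \<le> 1" for z
    using u_nonneg[of z] u_nonneg[of "z + h"] u_le_1[of z] u_le_1[of "z + h"] by (simp add: abs_le_iff)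
  fix \<rho> :: "'a \<Rightarrow> real"
  assume \<rho>: "lip_cs \<rho>" "\<And>x. 0 \<le> \<rho> x" "(\<integral>x. \<rho> x \<partial>lborel) = 1"
  have "(\<integral>z. (u (z + h) - u z) * \<rho> z \<partial>lborel) = (\<integral>z. u (z + h) * \<rho> (z - 0) - u (z + 0) * \<rho> (z - 0) \<partial>lborel)"
    by (simp add: left_diff_distrib)
  also have "\<dots> = avg \<rho> h - avg \<rho> 0"
    using avg_shift[OF \<rho>, of h 0] avg_shift[OF \<rho>, of 0 0] by (subst Bochner_Integration.integral_diff) auto
  also have "\<dots> \<le> hoelder_const * norm (h - 0) powr s" by (rule avg_hoelder[OF \<rho>])
  finally show "(\<integral>z. (u (z + h) - u z) * \<rho> z \<partial>lborel) \<le> hoelder_const * norm h powr s" by simp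
qed

text \<open>\<open>increment_AE\<close> has an exceptional null set for each \<open>h\<close>.
  Fubini exchanges the quantifiers and leaves a set \<open>S\<close> of full measure on which
  \<open>u\<close> is Hoelder continuous at every pair of points; being dense, \<open>S\<close>
  determines a uniformly continuous extension.\<close>

lemma hoelder_continuous_representative:
  obtains v where "uniformly_continuous_on UNIV v" "AE x in lborel. v x = u x"
proof -
  let ?L = hoelder_const
  have L1: "1 \<le> ?L" by (rule hoelder_const_ge_1)
  have m: "Measurable.pred (borel \<Otimes>\<^sub>M borel) (\<lambda>p. \<bar>u (fst p + snd p) - u (fst p)\<bar> \<le> ?L * norm (snd p) powr s)"
    by measurable
  have ae: "AE h in lborel. AE z in lborel. \<bar>u (z + h) - u z\<bar> \<le> ?L * norm h powr s"
  proof (rule AE_I2)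
    fix h :: 'a
    have "AE z in lborel. u (z - h) - u z \<le> ?L * norm h powr s" using increment_AE[of "- h"] by simp
    then have "AE z in distr lborel lborel ((+) h). u (z - h) - u z \<le> ?L * norm h powr s"
      by (subst distr_translate_lborel)
    then have "AE z in lborel. u z - u (z + h) \<le> ?L * norm h powr s"
      by (subst (asm) AE_distr_iff) (auto simp: add.commute)
    with increment_AE[of h] show "AE z in lborel. \<bar>u (z + h) - u z\<bar> \<le> ?L * norm h powr s"
      by eventually_elim (simp add: abs_le_iff)
  qed
  have "AE z in lborel. AE h in lborel. \<bar>u (z + h) - u z\<bar> \<le> ?L * norm h powr s"
    using lborel_pair.AE_commute[of "\<lambda>z h. \<bar>u (z + h) - u z\<bar> \<le> ?L * norm h powr s"] ae m
    by (simp add: pred_def space_pair_measure)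
  then have ae2: "AE z in lborel. AE y in lborel. \<bar>u y - u z\<bar> \<le> ?L * norm (y - z) powr s"
  proof eventually_elim
    case (elim z)
    then have "AE h in distr lborel lborel ((+) (- z)). \<bar>u (z + h) - u z\<bar> \<le> ?L * norm h powr s"
      by (subst distr_translate_lborel)
    then show ?case by (subst (asm) AE_distr_iff) auto
  qed
  define S where "S = {z. AE y in lborel. \<bar>u y - u z\<bar> \<le> ?L * norm (y - z) powr s}"
  have SAE: "AE z in lborel. z \<in> S" using ae2 by (simp add: S_def)
  \<comment> \<open>Two points of \<open>S\<close> need not be comparable directly, so both are
    compared with a common generic point \<open>y\<close> that tends to \<open>x\<close>.\<close>
  have hS: "\<bar>u x - u x'\<bar> \<le> ?L * norm (x - x') powr s" if "x \<in> S" "x' \<in> S" for x x'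
  proof -
    have "\<bar>u x - u x'\<bar> \<le> ?L * (1 / real (Suc n)) powr s + ?L * (norm (x - x') + 1 / real (Suc n)) powr s" for n
    proof -
      have "AE y in lborel. \<bar>u y - u x\<bar> \<le> ?L * norm (y - x) powr s \<and> \<bar>u y - u x'\<bar> \<le> ?L * norm (y - x') powr s"
        using that by (auto simp: S_def)
      from null_set_not_ball[OF this, of "1 / real (Suc n)" x]
      obtain y where y: "dist x y < 1 / real (Suc n)" "\<bar>u y - u x\<bar> \<le> ?L * norm (y - x) powr s"
        "\<bar>u y - u x'\<bar> \<le> ?L * norm (y - x') powr s" by auto
      have "norm (y - x) powr s \<le> (1 / real (Suc n)) powr s"
        using y(1) s by (intro powr_mono2) (auto simp: dist_norm norm_minus_commute)
      moreover have "norm (y - x') powr s \<le> (norm (x - x') + 1 / real (Suc n)) powr s"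
      proof (intro powr_mono2)
        show "norm (y - x') \<le> norm (x - x') + 1 / real (Suc n)"
          using norm_triangle_ineq[of "y - x" "x - x'"] y(1) by (simp add: dist_norm norm_minus_commute)
      qed (use s in auto)
      ultimately have "?L * norm (y - x) powr s \<le> ?L * (1 / real (Suc n)) powr s"
        "?L * norm (y - x') powr s \<le> ?L * (norm (x - x') + 1 / real (Suc n)) powr s"
        using L1 by (simp_all add: mult_left_mono)
      then show ?thesis using y(2,3) by linarith
    qed
    moreover have "(\<lambda>n. ?L * (1 / real (Suc n)) powr s + ?L * (norm (x - x') + 1 / real (Suc n)) powr s) \<longlonglongrightarrow> ?L * 0 powr s + ?L * (norm (x - x') + 0) powr s"
    proof -
      have z: "(\<lambda>n. 1 / real (Suc n)) \<longlonglongrightarrow> 0"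
        using LIMSEQ_inverse_real_of_nat by (simp add: inverse_eq_divide)
      show ?thesis
        using s by (intro tendsto_add tendsto_mult tendsto_const tendsto_powr' z) (auto intro!: always_eventually add_nonneg_nonneg)
    qed
    ultimately have "\<bar>u x - u x'\<bar> \<le> ?L * 0 powr s + ?L * (norm (x - x') + 0) powr s"
      by (intro LIMSEQ_le_const) auto
    then show ?thesis by simp
  qed
  have uc: "uniformly_continuous_on S u"
    unfolding uniformly_continuous_on_def
  proof (intro allI impI)
    fix \<epsilon> :: real assume \<epsilon>: "0 < \<epsilon>"
    define d where "d = (\<epsilon> / (2 * ?L)) powr (1 / s)"
    have d: "0 < d" using \<epsilon> L1 by (simp add: d_def)
    show "\<exists>d>0. \<forall>x\<in>S. \<forall>x'\<in>S. dist x' x < d \<longrightarrow> dist (u x') (u x) < \<epsilon>"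
    proof (intro exI[of _ d] conjI d ballI impI)
      fix x x' assume x: "x \<in> S" "x' \<in> S" "dist x' x < d"
      have "norm (x' - x) powr s \<le> d powr s" using x s by (intro powr_mono2) (auto simp: dist_norm)
      also have "\<dots> = \<epsilon> / (2 * ?L)" using s \<epsilon> L1 by (simp add: d_def powr_powr)
      finally have "?L * norm (x' - x) powr s \<le> \<epsilon> / 2" using L1 by (simp add: field_simps)
      with hS[OF x(2,1)] \<epsilon> show "dist (u x') (u x) < \<epsilon>" by (simp add: dist_real_def)
    qed
  qed
  have clS: "closure S = UNIV"
  proof (intro set_eqI iffI UNIV_I)
    fix x
    show "x \<in> closure S"
      unfolding closure_approachable
    proof (intro allI impI)
      fix \<epsilon> :: real assume "0 < \<epsilon>"
      from null_set_not_ball[OF SAE this, of x] show "\<exists>y\<in>S. dist y x < \<epsilon>"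
        by (auto simp: dist_commute)
    qed
  qed
  obtain v where v: "uniformly_continuous_on (closure S) v" "\<And>x. x \<in> S \<Longrightarrow> u x = v x"
    using uniformly_continuous_on_extension_on_closure[OF uc] by metis
  show thesis
  proof (rule that[of v])
    show "uniformly_continuous_on UNIV v" using v(1) clS by simp
    show "AE x in lborel. v x = u x" using SAE by eventually_elim (simp add: v(2))
  qed
qed

end

section \<open>Reflections and moving planes\<close>

definition reflect :: "'a::euclidean_space \<Rightarrow> real \<Rightarrow> 'a \<Rightarrow> 'a" where
  "reflect e l x = x - (2 * (x \<bullet> e - l)) *\<^sub>R e"

definition halfspace :: "'a::euclidean_space \<Rightarrow> real \<Rightarrow> 'a set" where
  "halfspace e l = {x. l < x \<bullet> e}"

text \<open>\<open>A\<close> is a fundamental domain of the involution up to a null set, and the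
  part of the integral outside \<open>A\<close> is carried back into it.\<close>

lemma integral_fold:
  fixes F :: "'b \<Rightarrow> real"
  assumes T: "distr M M T = M" "T \<in> measurable M M" "\<And>x. T (T x) = x"
    and A [measurable]: "A \<in> sets M" and split: "AE x in M. indicator A x + indicator A (T x) = (1::real)"
    and F: "integrable M F"
  shows "(\<integral>x. F x \<partial>M) = (\<integral>x. indicator A x * (F x + F (T x)) \<partial>M)"
    "integrable M (\<lambda>x. indicator A x * (F x + F (T x)))" "integrable M (\<lambda>x. F (T x))"
proof -
  have [measurable]: "T \<in> measurable M M" "F \<in> borel_measurable M" using T(2) F by auto
  have i0: "integrable M (\<lambda>x. indicator A x * G x)" if "integrable M G" for G :: "'b \<Rightarrow> real"
    using integrable_mult_indicator[OF A that] by simp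
  have iT: "integrable M (\<lambda>x. F (T x))" using measure_preserving_integral(1)[OF T(1,2), of F] F by simp
  then show "integrable M (\<lambda>x. F (T x))" .
  have i: "integrable M (\<lambda>x. indicator A x * F x)" "integrable M (\<lambda>x. indicator A x * F (T x))"
    by (rule i0[OF F], rule i0[OF iT])
  then show "integrable M (\<lambda>x. indicator A x * (F x + F (T x)))" by (simp add: distrib_left)
  have eq: "(\<integral>x. indicator A (T x) * F x \<partial>M) = (\<integral>x. indicator A x * F (T x) \<partial>M)"
    and i2: "integrable M (\<lambda>x. indicator A (T x) * F x)"
    using measure_preserving_integral[OF T(1,2), of "\<lambda>x. indicator A x * F (T x)"] i(2) by (simp_all add: T(3))
  have "(\<integral>x. F x \<partial>M) = (\<integral>x. indicator A x * F x + indicator A (T x) * F x \<partial>M)"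
  proof (rule integral_cong_AE)
    show "AE x in M. F x = indicator A x * F x + indicator A (T x) * F x"
      using split by eventually_elim (simp flip: distrib_right)
  qed measurable
  also have "\<dots> = (\<integral>x. indicator A x * F x \<partial>M) + (\<integral>x. indicator A (T x) * F x \<partial>M)"
    by (rule Bochner_Integration.integral_add[OF i(1) i2])
  also have "\<dots> = (\<integral>x. indicator A x * F x \<partial>M) + (\<integral>x. indicator A x * F (T x) \<partial>M)" by (simp only: eq)
  also have "\<dots> = (\<integral>x. indicator A x * (F x + F (T x)) \<partial>M)"
    using i by (simp add: distrib_left)
  finally show "(\<integral>x. F x \<partial>M) = (\<integral>x. indicator A x * (F x + F (T x)) \<partial>M)" .
qed

lemma lipschitz_on_mult_bounded:
  fixes f g :: "'a::euclidean_space \<Rightarrow> real"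
  assumes f: "L-lipschitz_on UNIV f" "\<And>x. \<bar>f x\<bar> \<le> M" and g: "K-lipschitz_on UNIV g" "\<And>x. \<bar>g x\<bar> \<le> N"
  shows "(N * L + M * K)-lipschitz_on UNIV (\<lambda>x. f x * g x)"
proof (rule lipschitz_onI)
  have MN: "0 \<le> M" "0 \<le> N" using f(2)[of 0] g(2)[of 0] by linarith+
  show "0 \<le> N * L + M * K" using MN lipschitz_on_nonneg[OF f(1)] lipschitz_on_nonneg[OF g(1)] by simp
  fix x y
  have "f x * g x - f y * g y = (f x - f y) * g x + f y * (g x - g y)" by (simp add: algebra_simps)
  also have "\<bar>\<dots>\<bar> \<le> \<bar>f x - f y\<bar> * \<bar>g x\<bar> + \<bar>f y\<bar> * \<bar>g x - g y\<bar>"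
    by (rule order_trans[OF abs_triangle_ineq]) (simp add: abs_mult)
  also have "\<dots> \<le> (L * dist x y) * N + M * (K * dist x y)"
    using lipschitz_onD[OF f(1), of x y] lipschitz_onD[OF g(1), of x y] f(2)[of y] g(2)[of x] MN
    by (intro add_mono mult_mono) (auto simp: dist_real_def intro: order_trans[OF abs_ge_zero])
  finally show "dist (f x * g x) (f y * g y) \<le> (N * L + M * K) * dist x y"
    by (simp add: dist_real_def algebra_simps)
qed

locale reflection =
  fixes e :: "'a::euclidean_space" and l :: real
  assumes unit: "norm e = 1"
begin

abbreviation "R \<equiv> reflect e l"
abbreviation "S \<equiv> halfspace e l"

lemma ee: "e \<bullet> e = 1"
  using unit by (simp add: norm_eq_1)

lemma R_inner: "R x \<bullet> e = 2 * l - x \<bullet> e"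
  by (simp add: reflect_def inner_diff_left ee)

lemma R_R [simp]: "R (R x) = x"
proof -
  have "R (R x) = R x - (2 * (R x \<bullet> e - l)) *\<^sub>R e" by (rule reflect_def)
  also have "\<dots> = x" unfolding R_inner by (simp add: reflect_def algebra_simps)
  finally show ?thesis .
qed

lemma R_diff: "R x - R y = (x - y) - (2 * ((x - y) \<bullet> e)) *\<^sub>R e"
  by (simp add: reflect_def algebra_simps inner_diff_left)

lemma norm_R_diff: "norm (R x - R y) = norm (x - y)"
proof -
  have "(norm (v - (2 * (v \<bullet> e)) *\<^sub>R e))\<^sup>2 = (norm v)\<^sup>2" for v
    unfolding power2_norm_eq_inner
    by (simp add: inner_diff_left inner_diff_right ee inner_commute[of e v] algebra_simps)
  then have "(norm (R x - R y))\<^sup>2 = (norm (x - y))\<^sup>2" unfolding R_diff .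
  then show ?thesis by (simp add: power2_eq_iff_nonneg)
qed

lemma dist_R: "dist (R x) (R y) = dist x y"
  by (simp add: dist_norm norm_R_diff)

lemma norm_R_swap: "norm (R x - y) = norm (x - R y)"
  using norm_R_diff[of "R x" y] by simp

text \<open>Expanding the squares, \<open>(norm (R x - y))\<^sup>2\<close> exceeds
  \<open>(norm (x - y))\<^sup>2\<close> by four times the product of the distances of
  \<open>x\<close> and \<open>y\<close> to the hyperplane. Every comparison of kernels across the
  plane rests on this.\<close>

lemma norm_R_less:
  assumes "x \<in> S" "y \<in> S"
  shows "norm (x - y) < norm (R x - y)"
proof -
  have "R x - y = (x - y) - (2 * (x \<bullet> e - l)) *\<^sub>R e" by (simp add: reflect_def algebra_simps)
  then have "(norm (R x - y))\<^sup>2 = (norm (x - y))\<^sup>2 - 4 * (x \<bullet> e - l) * ((x - y) \<bullet> e) + 4 * (x \<bullet> e - l)\<^sup>2"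
    unfolding power2_norm_eq_inner
    by (simp only: inner_diff_left[of "x - y" "_ *\<^sub>R e"] inner_diff_right[of _ "x - y" "_ *\<^sub>R e"] inner_scaleR_left inner_scaleR_right ee inner_commute[of e "x - y"])
      (simp add: power2_eq_square algebra_simps)
  also have "\<dots> = (norm (x - y))\<^sup>2 + 4 * ((x \<bullet> e - l) * (y \<bullet> e - l))"
    by (simp add: power2_eq_square algebra_simps inner_diff_left)
  finally have "(norm (x - y))\<^sup>2 < (norm (R x - y))\<^sup>2"
    using assms by (simp add: halfspace_def)
  then show ?thesis by (rule power_less_imp_less_base) simp
qed

lemma ker_R:
  "ker s (R x - R y) = ker s (x - y)" "ker s (R x - y) = ker s (x - R y)"
  by (simp_all add: ker_def norm_R_diff norm_R_swap)

lemma ker_R_le: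
  assumes "0 < s" "x \<in> S" "y \<in> S" "x \<noteq> y"
  shows "ker s (x - R y) < ker s (x - y)"
  unfolding ker_R(2)[symmetric] by (rule ker_strict_mono) (use assms norm_R_less in auto)

lemma R_continuous: "continuous_on UNIV R"
  unfolding reflect_def by (intro continuous_intros)

lemma R_measurable [measurable]: "R \<in> measurable borel borel"
  by (rule borel_measurable_continuous_onI[OF R_continuous])

lemma S_measurable [measurable]: "S \<in> sets borel"
  unfolding halfspace_def by measurable

lemma S_open: "open S"
  unfolding halfspace_def by (intro open_Collect_less continuous_intros)

lemmas distr_R = distr_isometric_involution2[of R, OF R_R dist_R]

lemma R_not_S: "x \<in> S \<Longrightarrow> R x \<notin> S"
  by (simp add: halfspace_def R_inner)

lemma AE_S_split: "AE x in lborel. indicator S x + indicator S (R x) = (1::real)"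
proof -
  have "e \<noteq> 0" using unit by auto
  then have "negligible {x. e \<bullet> x = l}" by (rule negligible_hyperplane[OF disjI1])
  then have "{x. e \<bullet> x = l} \<in> null_sets lborel"
    by (simp add: negligible_iff_null_sets null_sets_completion_iff borel_closed closed_hyperplane)
  then have "AE x in lborel. x \<notin> {x. e \<bullet> x = l}" by (rule AE_not_in)
  then have "AE x in lborel. x \<bullet> e \<noteq> l"
    by eventually_elim (simp add: inner_commute)
  then show ?thesis
    by eventually_elim (auto simp: indicator_def halfspace_def R_inner)
qed

lemma integral_R:
  fixes g :: "'a \<Rightarrow> real"
  assumes "g \<in> borel_measurable borel"
  shows "integrable lborel (\<lambda>x. g (R x)) \<longleftrightarrow> integrable lborel g" "(\<integral>x. g (R x) \<partial>lborel) = (\<integral>x. g x \<partial>lborel)"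
  using measure_preserving_integral[OF distr_R(1), of g] assms by auto

text \<open>Folding the first and then the second variable writes a double integral over the whole
  space as one over \<open>S \<times> S\<close> with four reflected copies of the integrand.\<close>

lemma form_fold:
  fixes F :: "'a \<times> 'a \<Rightarrow> real"
  assumes F: "integrable lborel2 F"
  defines "G \<equiv> \<lambda>p. indicator S (fst p) * indicator S (snd p) *
      (F (fst p, snd p) + F (R (fst p), snd p) + F (fst p, R (snd p)) + F (R (fst p), R (snd p)))"
  shows "(\<integral>p. F p \<partial>lborel2) = (\<integral>p. G p \<partial>lborel2)" "integrable lborel2 G"
    "integrable lborel2 (\<lambda>p. F (R (fst p), snd p))" "integrable lborel2 (\<lambda>p. F (fst p, R (snd p)))"
proof -
  let ?T1 = "\<lambda>(x, y). (R x, y)" and ?T2 = "\<lambda>(x, y). (x, R y)"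
  have m: "?T1 \<in> measurable lborel2 (lborel2 :: ('a \<times> 'a) measure)" "?T2 \<in> measurable lborel2 (lborel2 :: ('a \<times> 'a) measure)"
    by measurable
  have A: "{p. fst p \<in> S} \<in> sets (lborel2 :: ('a \<times> 'a) measure)" "{p. snd p \<in> S} \<in> sets (lborel2 :: ('a \<times> 'a) measure)"
  proof -
    have "{p. fst p \<in> S} = S \<times> (UNIV :: 'a set)" "{p. snd p \<in> S} = (UNIV :: 'a set) \<times> S" by auto
    then show "{p. fst p \<in> S} \<in> sets (lborel2 :: ('a \<times> 'a) measure)" "{p. snd p \<in> S} \<in> sets (lborel2 :: ('a \<times> 'a) measure)"
      by (simp_all add: pair_measureI)
  qed
  have s1: "AE p in lborel2. indicator {p. fst p \<in> S} p + indicator {p. fst p \<in> S} (?T1 p) = (1::real)"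
    using AE_lborel2(1)[OF AE_S_split] by eventually_elim (auto simp: indicator_def split_beta)
  have s2: "AE p in lborel2. indicator {p. snd p \<in> S} p + indicator {p. snd p \<in> S} (?T2 p) = (1::real)"
    using AE_lborel2(2)[OF AE_S_split] by eventually_elim (auto simp: indicator_def split_beta)
  have inv: "?T1 (?T1 p) = p" "?T2 (?T2 p) = p" for p by (simp_all add: split_beta)
  note f1 = integral_fold[OF distr_R(3) m(1) inv(1) A(1) s1 F]
  note f1' = integral_fold[OF distr_R(4) m(2) inv(2) A(2) s2 F]
  show "integrable lborel2 (\<lambda>p. F (R (fst p), snd p))" using f1(3) by (simp add: split_beta)
  show "integrable lborel2 (\<lambda>p. F (fst p, R (snd p)))" using f1'(3) by (simp add: split_beta)
  note f2 = integral_fold[OF distr_R(4) m(2) inv(2) A(2) s2 f1(2)]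
  have eq: "indicator {p. snd p \<in> S} p * (indicator {p. fst p \<in> S} p * (F p + F (?T1 p)) +
      indicator {p. fst p \<in> S} (?T2 p) * (F (?T2 p) + F (?T1 (?T2 p)))) = G p" for p
    by (simp add: G_def split_beta indicator_def)
  show "(\<integral>p. F p \<partial>lborel2) = (\<integral>p. G p \<partial>lborel2)" "integrable lborel2 G"
    using f1(1) f2(1,2) by (simp_all only: eq)
qed

lemma fin_energy_R:
  assumes "fin_energy s u" "fin_energy s v"
  shows "fin_energy s (\<lambda>x. u (R x))" "form s (\<lambda>x. u (R x)) (\<lambda>x. v (R x)) = form s u v"
proof -
  have [measurable]: "u \<in> borel_measurable borel" "v \<in> borel_measurable borel"
    using assms by (auto intro: fin_energy_measurable)
  have m: "(\<lambda>(x, y). (R x, R y)) \<in> measurable lborel2 (lborel2 :: ('a \<times> 'a) measure)"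
    by measurable
  show "fin_energy s (\<lambda>x. u (R x))"
    using measure_preserving_integral(1)[OF distr_R(5) m, of "\<lambda>p. (dif u p)\<^sup>2 * ker2 s p"] assms
    by (simp add: fin_energy_def split_beta ker_R)
  show "form s (\<lambda>x. u (R x)) (\<lambda>x. v (R x)) = form s u v"
    using measure_preserving_integral(2)[OF distr_R(5) m, of "\<lambda>p. dif u p * dif v p * ker2 s p"]
    by (simp add: form_def split_beta ker_R)
qed

lemma lip_cs_R:
  assumes "lip_cs f"
  shows "lip_cs (\<lambda>x. f (R x))"
proof -
  obtain L M Q where L: "L-lipschitz_on UNIV f" "{x. f x \<noteq> 0} \<subseteq> cball 0 Q"
    using lip_cs_bounded[OF assms] by metis
  have "L-lipschitz_on UNIV (\<lambda>x. f (R x))"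
  proof (rule lipschitz_onI)
    show "dist (f (R x)) (f (R y)) \<le> L * dist x y" for x y
      using lipschitz_onD[OF L(1), of "R x" "R y"] by (simp add: dist_R)
  qed (rule lipschitz_on_nonneg[OF L(1)])
  moreover have "{x. f (R x) \<noteq> 0} \<subseteq> cball (R 0) Q"
  proof
    fix x assume "x \<in> {x. f (R x) \<noteq> 0}"
    then have "R x \<in> cball 0 Q" using L(2) by blast
    then show "x \<in> cball (R 0) Q" using dist_R[of 0 "R x"] by simp
  qed
  ultimately show ?thesis unfolding lip_cs_def using bounded_subset[OF bounded_cball] by blast
qed

text \<open>Intended for functions that are antisymmetric under \<open>R\<close>; these vanish on
  the hyperplane, so cutting off at the boundary of \<open>S\<close> creates no jump.\<close>

definition pos_half :: "('a \<Rightarrow> real) \<Rightarrow> 'a \<Rightarrow> real" where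
  "pos_half z x = (if x \<in> S then max 0 (z x) else 0)"

lemma pos_half_measurable [measurable]:
  "z \<in> borel_measurable borel \<Longrightarrow> pos_half z \<in> borel_measurable borel"
proof -
  assume [measurable]: "z \<in> borel_measurable borel"
  have "pos_half z = (\<lambda>x. indicator S x * max 0 (z x))" by (auto simp: fun_eq_iff pos_half_def)
  then show ?thesis by simp
qed

text \<open>Here \<open>a\<close>, \<open>b\<close> are the values of an antisymmetric function at
  \<open>x\<close>, \<open>y\<close>, and \<open>k\<close>, \<open>k'\<close> are the kernels for
  \<open>(x, y)\<close> and \<open>(x, R y)\<close>. Splitting into positive and negative parts
  leaves \<open>(a' * d + b' * c) * (k - k') + 2 * c * d * k'\<close>. The fourth folded term is
  absent because the positive part vanishes at both reflected points.\<close>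

lemma fold_inequality:
  fixes a b k k' :: real
  defines "c \<equiv> max 0 a" and "d \<equiv> max 0 b"
  assumes "0 \<le> k'" "k' \<le> k"
  shows "0 \<le> ((a - b) * (c - d) * k - (c - d) * (c - d) * k) + ((- a - b) * (0 - d) * k' - (0 - d) * (0 - d) * k')
     + ((a + b) * (c - 0) * k' - (c - 0) * (c - 0) * k')"
proof -
  define a' b' where "a' = max 0 (- a)" and "b' = max 0 (- b)"
  have ab: "a = c - a'" "b = d - b'" by (auto simp: c_def d_def a'_def b'_def max_def)
  have z: "a' * c = 0" "b' * d = 0" by (auto simp: c_def d_def a'_def b'_def max_def)
  have p: "0 \<le> a'" "0 \<le> b'" "0 \<le> c" "0 \<le> d" by (auto simp: c_def d_def a'_def b'_def)
  have "((a - b) * (c - d) * k - (c - d) * (c - d) * k) + ((- a - b) * (0 - d) * k' - (0 - d) * (0 - d) * k')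
     + ((a + b) * (c - 0) * k' - (c - 0) * (c - 0) * k')
     = (a' * d + b' * c) * (k - k') + 2 * c * d * k' - (a' * c) * (k + k') - (b' * d) * (k + k')"
    unfolding ab by (simp add: algebra_simps)
  also have "\<dots> = (a' * d + b' * c) * (k - k') + 2 * c * d * k'" by (simp add: z)
  finally show ?thesis using p assms(3,4) by simp
qed

text \<open>For a local form equality would hold. The nonlocal interaction across the plane has a
  favourable sign, since the kernel is smaller between a point and a mirror image.\<close>

lemma form_pos_half_le:
  assumes s: "0 < s" and z: "fin_energy s z" and w: "fin_energy s (pos_half z)"
    and anti: "\<And>x. z (R x) = - z x"
  shows "form s (pos_half z) (pos_half z) \<le> form s z (pos_half z)"
proof -
  let ?w = "pos_half z"
  define F where "F = (\<lambda>p. dif z p * dif ?w p * ker2 s p - dif ?w p * dif ?w p * ker2 s p)"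
  have iF: "integrable lborel2 F"
    unfolding F_def by (intro Bochner_Integration.integrable_diff form_integrable z w)
  have "form s z ?w - form s ?w ?w = (\<integral>p. F p \<partial>lborel2)"
    unfolding F_def form_def by (rule Bochner_Integration.integral_diff[symmetric]; intro form_integrable z w)
  also have "\<dots> \<ge> 0"
    unfolding form_fold(1)[OF iF]
  proof (rule integral_nonneg_AE, rule AE_I2)
    fix p :: "'a \<times> 'a"
    obtain x y where p: "p = (x, y)" by (cases p)
    show "0 \<le> indicator S (fst p) * indicator S (snd p) *
      (F (fst p, snd p) + F (R (fst p), snd p) + F (fst p, R (snd p)) + F (R (fst p), R (snd p)))"
    proof (cases "x \<in> S \<and> y \<in> S")
      case True
      \<comment> \<open>On the diagonal \<open>ker s 0 = 0\<close>, so the comparison of kernels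
        fails there and the sign is checked directly.\<close>
      have k: "ker s (x - R y) \<le> ker s (x - y) \<or> x = y" using ker_R_le[OF s] True by force
      have w: "?w x = max 0 (z x)" "?w y = max 0 (z y)" "?w (R x) = 0" "?w (R y) = 0"
        using True R_not_S by (auto simp: pos_half_def)
      show ?thesis
      proof (cases "x = y")
        case True
        then show ?thesis using \<open>x \<in> S \<and> y \<in> S\<close> unfolding p F_def
          by (simp add: w anti ker_R max_def algebra_simps)
      next
        case False
        with k have k: "ker s (x - R y) \<le> ker s (x - y)" by simp
        from fold_inequality[OF _ k, of "z x" "z y"] show ?thesis
          using True unfolding p F_def by (simp add: w anti ker_R)
      qed
    qed (auto simp: p)
  qed
  finally show ?thesis by simp
qed

text \<open>The mixed form is at most half the sum of the two energies; combined with
  \<open>form_pos_half_le\<close>, half of the left-hand energy is absorbed. This supplies the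
  uniform energy bound for the test sequence.\<close>

lemma form_pos_half_le_form:
  assumes s: "0 < s" and z: "fin_energy s z" and w: "fin_energy s (pos_half z)"
    and anti: "\<And>x. z (R x) = - z x"
  shows "form s (pos_half z) (pos_half z) \<le> form s z z"
proof -
  let ?w = "pos_half z"
  have "form s z ?w \<le> (\<integral>p. 1/2 * ((dif z p)\<^sup>2 * ker2 s p) + 1/2 * ((dif ?w p)\<^sup>2 * ker2 s p) \<partial>lborel2)"
    unfolding form_def
  proof (rule integral_mono)
    show "integrable lborel2 (\<lambda>p. dif z p * dif ?w p * ker2 s p)" by (rule form_integrable[OF z w])
    show "integrable lborel2 (\<lambda>p. 1/2 * ((dif z p)\<^sup>2 * ker2 s p) + 1/2 * ((dif ?w p)\<^sup>2 * ker2 s p))"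
      using z w unfolding fin_energy_def by (intro Bochner_Integration.integrable_add integrable_mult_right) auto
    have "a * b * k \<le> 1/2 * (a\<^sup>2 * k) + 1/2 * (b\<^sup>2 * k)" if "0 \<le> k" for a b k :: real
      using mult_right_mono[OF sum_squares_bound[of a b] that] by (simp add: algebra_simps)
    then show "dif z p * dif ?w p * ker2 s p \<le> 1/2 * ((dif z p)\<^sup>2 * ker2 s p) + 1/2 * ((dif ?w p)\<^sup>2 * ker2 s p)" for p
      by simp
  qed
  also have "\<dots> = 1/2 * form s z z + 1/2 * form s ?w ?w"
    unfolding form_self using z w unfolding fin_energy_def
    by (subst Bochner_Integration.integral_add) (auto intro!: integrable_mult_right)
  finally show ?thesis using form_pos_half_le[OF assms] by linarith
qed

lemma lip_cs_pos_half:
  assumes f: "lip_cs f"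
  shows "lip_cs (pos_half (\<lambda>x. f x - f (R x)))"
proof -
  obtain L where L: "L-lipschitz_on UNIV f" using f by (auto simp: lip_cs_def)
  have L0: "0 \<le> L" by (rule lipschitz_on_nonneg[OF L])
  let ?g = "\<lambda>x. f x - f (R x)"
  have b: "bounded {x. ?g x \<noteq> 0}" using lip_cs_diff[OF f lip_cs_R[OF f]] by (simp add: lip_cs_def)
  have g: "\<bar>?g x - ?g y\<bar> \<le> 2 * L * dist x y" for x y
    using lipschitz_onD[OF L, of x y] lipschitz_onD[OF L, of "R x" "R y"] by (simp add: dist_R dist_real_def abs_le_iff)
  \<comment> \<open>Only pairs on opposite sides need care: \<open>?g x\<close> is an increment of
    \<open>f\<close> between \<open>x\<close> and \<open>R x\<close>, and that distance is at most
    twice the distance from \<open>x\<close> to any point beyond the plane.\<close>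
  have cross: "\<bar>pos_half ?g x - pos_half ?g y\<bar> \<le> 2 * L * dist x y" if "x \<in> S" "y \<notin> S" for x y
  proof -
    have "\<bar>?g x\<bar> \<le> L * dist x (R x)" using lipschitz_onD[OF L, of x "R x"] by (simp add: dist_real_def)
    also have "\<dots> \<le> L * (2 * dist x y)"
    proof (rule mult_left_mono[OF _ L0])
      have "dist x (R x) = 2 * (x \<bullet> e - l)"
        using that(1) by (simp add: dist_norm reflect_def unit halfspace_def)
      also have "\<dots> \<le> 2 * ((x - y) \<bullet> e)" using that(2) by (simp add: halfspace_def inner_diff_left)
      also have "(x - y) \<bullet> e \<le> dist x y"
        using norm_cauchy_schwarz[of "x - y" e] by (simp add: unit dist_norm)
      finally show "dist x (R x) \<le> 2 * dist x y" by simp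
    qed
    finally have "\<bar>?g x\<bar> \<le> 2 * L * dist x y" by simp
    moreover have "\<bar>pos_half ?g x - pos_half ?g y\<bar> \<le> \<bar>?g x\<bar>" using that by (simp add: pos_half_def max_def)
    ultimately show ?thesis by linarith
  qed
  have "(2 * L)-lipschitz_on UNIV (pos_half ?g)"
  proof (rule lipschitz_onI)
    fix x y
    have "\<bar>pos_half ?g x - pos_half ?g y\<bar> \<le> 2 * L * dist x y"
    proof (cases "x \<in> S"; cases "y \<in> S")
      assume "x \<in> S" "y \<in> S"
      then have "\<bar>pos_half ?g x - pos_half ?g y\<bar> \<le> \<bar>?g x - ?g y\<bar>" by (auto simp: pos_half_def max_def)
      then show ?thesis using g[of x y] by linarith
    next
      assume "x \<in> S" "y \<notin> S" then show ?thesis by (rule cross)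
    next
      assume "x \<notin> S" "y \<in> S" then show ?thesis using cross[of y x] by (simp add: dist_commute abs_minus_commute)
    next
      assume "x \<notin> S" "y \<notin> S" then show ?thesis using L0 by (simp add: pos_half_def)
    qed
    then show "dist (pos_half ?g x) (pos_half ?g y) \<le> 2 * L * dist x y" by (simp add: dist_real_def)
  qed (use L0 in simp)
  moreover have "bounded {x. pos_half ?g x \<noteq> 0}"
    by (rule bounded_subset[OF b]) (auto simp: pos_half_def)
  ultimately show ?thesis by (auto simp: lip_cs_def)
qed

end

text \<open>Hoelder with the exponents \<open>r / (r - 2)\<close> and \<open>r / 2\<close>, via
  weighted Young after division by the two integrals. The levels \<open>K = L = 1\<close> give
  integrability first; vanishing integrals are treated separately.\<close>

lemma Holder_r_2:
  fixes g w :: "'b \<Rightarrow> real"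
  assumes r: "2 < r" and [measurable]: "g \<in> borel_measurable M" "w \<in> borel_measurable M"
    and nn: "\<And>x. 0 \<le> g x" "\<And>x. 0 \<le> w x"
    and g: "integrable M (\<lambda>x. g x powr r)" and w: "integrable M (\<lambda>x. w x powr r)"
  shows "integrable M (\<lambda>x. g x powr (r - 2) * (w x)\<^sup>2)"
    "(\<integral>x. g x powr (r - 2) * (w x)\<^sup>2 \<partial>M) \<le> (\<integral>x. g x powr r \<partial>M) powr ((r - 2) / r) * (\<integral>x. w x powr r \<partial>M) powr (2 / r)"
proof -
  define \<alpha> \<beta> where "\<alpha> = (r - 2) / r" and "\<beta> = 2 / r"
  have ab: "0 < \<alpha>" "0 < \<beta>" "\<alpha> + \<beta> = 1" using r by (auto simp: \<alpha>_def \<beta>_def field_simps)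
  define X Y where "X = (\<integral>x. g x powr r \<partial>M)" and "Y = (\<integral>x. w x powr r \<partial>M)"
  have XY: "0 \<le> X" "0 \<le> Y" by (auto simp: X_def Y_def intro!: integral_nonneg_AE)
  have prod: "g x powr (r - 2) * (w x)\<^sup>2 = (g x powr r) powr \<alpha> * (w x powr r) powr \<beta>" for x
    using r nn(2)[of x] by (simp add: powr_powr \<alpha>_def \<beta>_def powr_numeral)
  have young: "(g x powr r) powr \<alpha> * (w x powr r) powr \<beta> \<le> K powr \<alpha> * L powr \<beta> * (\<alpha> * (g x powr r / K) + \<beta> * (w x powr r / L))"
    if "0 < K" "0 < L" for K L x
  proof (cases "g x = 0 \<or> w x = 0")
    case False
    then have p: "0 < g x powr r / K" "0 < w x powr r / L" using that by auto
    have "(g x powr r) powr \<alpha> * (w x powr r) powr \<beta> = K powr \<alpha> * L powr \<beta> * ((g x powr r / K) powr \<alpha> * (w x powr r / L) powr \<beta>)"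
      using that by (simp add: powr_divide)
    also have "\<dots> \<le> K powr \<alpha> * L powr \<beta> * (\<alpha> * (g x powr r / K) + \<beta> * (w x powr r / L))"
      using ab p by (intro mult_left_mono Youngs_inequality_0) auto
    finally show ?thesis .
  next
    case True
    then have zero: "(g x powr r) powr \<alpha> * (w x powr r) powr \<beta> = 0" by auto
    show ?thesis unfolding zero using that ab
      by (intro mult_nonneg_nonneg add_nonneg_nonneg) auto
  qed
  have i: "integrable M (\<lambda>x. \<alpha> * (g x powr r / K) + \<beta> * (w x powr r / L))" for K L
    using g w by simp
  show int: "integrable M (\<lambda>x. g x powr (r - 2) * (w x)\<^sup>2)"
  proof (rule Bochner_Integration.integrable_bound[OF i[of 1 1]])
    show "AE x in M. norm (g x powr (r - 2) * (w x)\<^sup>2) \<le> norm (\<alpha> * (g x powr r / 1) + \<beta> * (w x powr r / 1))"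
      using young[of 1 1] ab by (intro AE_I2) (simp add: prod)
  qed measurable
  show "(\<integral>x. g x powr (r - 2) * (w x)\<^sup>2 \<partial>M) \<le> (\<integral>x. g x powr r \<partial>M) powr ((r - 2) / r) * (\<integral>x. w x powr r \<partial>M) powr (2 / r)"
  proof (cases "X = 0 \<or> Y = 0")
    case True
    have "AE x in M. g x powr r = 0 \<or> w x powr r = 0"
      using True integral_nonneg_eq_0_iff_AE[OF g] integral_nonneg_eq_0_iff_AE[OF w]
      by (auto simp: X_def Y_def elim!: eventually_mono)
    then have "(\<integral>x. g x powr (r - 2) * (w x)\<^sup>2 \<partial>M) = (\<integral>x. 0 \<partial>M)"
      by (intro integral_cong_AE) (auto elim!: eventually_mono)
    then show ?thesis by simp
  next
    case False
    with XY have p: "0 < X" "0 < Y" by auto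
    have "(\<integral>x. g x powr (r - 2) * (w x)\<^sup>2 \<partial>M) \<le> (\<integral>x. X powr \<alpha> * Y powr \<beta> * (\<alpha> * (g x powr r / X) + \<beta> * (w x powr r / Y)) \<partial>M)"
      using young[OF p] i by (intro integral_mono int integrable_mult_right) (auto simp: prod)
    also have "\<dots> = X powr \<alpha> * Y powr \<beta> * (\<alpha> * (X / X) + \<beta> * (Y / Y))"
      using g w by (simp add: X_def Y_def)
    also have "\<dots> = X powr \<alpha> * Y powr \<beta>" using p ab by simp
    finally show ?thesis by (simp add: X_def Y_def \<alpha>_def \<beta>_def)
  qed
qed

lemma powr_diff_le_mvt:
  fixes a b :: real
  assumes "0 \<le> b" "b < a" "1 \<le> p"
  shows "a powr p - b powr p \<le> p * a powr (p - 1) * (a - b)"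
proof -
  have "continuous_on {b..a} (\<lambda>t. t powr p)"
    using assms by (intro continuous_on_powr' continuous_intros) auto
  moreover have "(\<lambda>t. t powr p) differentiable (at t)" if "b < t" "t < a" for t
    using that assms DERIV_powr[of "\<lambda>t. t" 1 t "\<lambda>_. p" 0] has_real_derivative_powr[of t p]
    by (auto simp: real_differentiable_def)
  ultimately obtain l t where t: "b < t" "t < a" "DERIV (\<lambda>t. t powr p) t :> l" "a powr p - b powr p = (a - b) * l"
    using MVT[of b a "\<lambda>t. t powr p"] assms(2) by metis
  have "l = p * t powr (p - 1)"
    using DERIV_unique[OF t(3) has_real_derivative_powr] t assms by simp
  also have "\<dots> \<le> p * a powr (p - 1)"
    using t assms by (intro mult_left_mono powr_mono2) auto
  finally show ?thesis using t(4) assms by (simp add: mult.commute mult_right_mono)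
qed

lemma form_diff_left:
  assumes "fin_energy s u" "fin_energy s v" "fin_energy s \<phi>"
  shows "form s (\<lambda>x. u x - v x) \<phi> = form s u \<phi> - form s v \<phi>"
proof -
  have "form s (\<lambda>x. u x - v x) \<phi> = (\<integral>p. dif u p * dif \<phi> p * ker2 s p - dif v p * dif \<phi> p * ker2 s p \<partial>lborel2)"
    unfolding form_def by (rule Bochner_Integration.integral_cong) (auto simp: algebra_simps)
  also have "\<dots> = form s u \<phi> - form s v \<phi>"
    unfolding form_def by (rule Bochner_Integration.integral_diff; intro form_integrable assms)
  finally show ?thesis .
qed

lemma open_AE_closed:
  fixes S :: "'a::euclidean_space set" and h :: "'a \<Rightarrow> real"
  assumes S: "open S" and h: "continuous_on UNIV h" and ae: "AE x in lborel. x \<in> S \<longrightarrow> h x = 0" and x: "x \<in> S"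
  shows "h x = 0"
proof (rule ccontr)
  assume "h x \<noteq> 0"
  have "open (S \<inter> h -` (- {0}))"
    by (intro open_Int S open_vimage[OF _ h]) auto
  moreover have "x \<in> S \<inter> h -` (- {0})" using x \<open>h x \<noteq> 0\<close> by simp
  ultimately obtain d where d: "0 < d" "ball x d \<subseteq> S \<inter> h -` (- {0})"
    using openE by blast
  from null_set_not_ball[OF ae d(1), of x] d(2) show False by auto
qed

section \<open>Maximum principles for the reflected difference\<close>

text \<open>The continuous representative agrees with a positive function only almost everywhere.
  Positivity is therefore recorded as nonnegativity and one point with a positive value.\<close>

locale continuous_solution =
  fixes s p q C r :: real and u :: "'a::euclidean_space \<Rightarrow> real"
  assumes r_eq: "r = crit_exp DIM('a) s" and s: "0 < s" "s < 1" "2 * s < real DIM('a)" and C: "0 < C"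
    and p: "r - 1 \<le> p" and pq: "p < q"
    and u_cont: "uniformly_continuous_on UNIV u"
    and u_nonneg: "\<And>x. 0 \<le> u x" and u_le_1: "\<And>x. u x \<le> 1" and u_nonzero: "\<exists>x. 0 < u x"
    and u_int: "integrable lborel (\<lambda>x. u x powr r)"
    and u_energy: "fin_energy s u" and u_approx: "lip_approx s u"
    and eq: "\<And>\<phi>. lip_cs \<phi> \<Longrightarrow> C * form s u \<phi> = (\<integral>x. (u x powr p - u x powr q) * \<phi> x \<partial>lborel)"
begin

definition f :: "real \<Rightarrow> real" where
  "f t = t powr p - t powr q"

lemma r: "2 < r"
  unfolding r_eq using crit_exp_gt_2 s by blast

lemma Sobolev:
  assumes "fin_energy s (w :: 'a \<Rightarrow> real)" "integrable lborel (\<lambda>x. \<bar>w x\<bar> powr r)"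
  shows "(\<integral>x. \<bar>w x\<bar> powr r \<partial>lborel) powr (2 / r) \<le> Sobolev_const DIM('a) s * form s w w"
  using Sobolev_inequality[OF s(1,3)] assms by (simp add: r_eq)

lemma continuous: "continuous_on UNIV u"
  using u_cont by (rule uniformly_continuous_imp_continuous)

lemma u_measurable [measurable]: "u \<in> borel_measurable borel"
  using continuous by (rule borel_measurable_continuous_onI)

lemma f_measurable [measurable]: "f \<in> borel_measurable borel"
  unfolding f_def by measurable

lemma f_nonneg: "0 \<le> f (u x)" and f_le: "f (u x) \<le> u x powr (r - 1)"
  using powr_diff_bounds[of "u x" r p q] u_nonneg u_le_1 r p pq by (auto simp: f_def)

text \<open>The \<open>q\<close>-th powers contribute with the right sign and are dropped. The mean
  value theorem leaves the exponent \<open>p - 1\<close>, which \<open>u \<le> 1\<close> lowers to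
  \<open>r - 2\<close>, the exponent required by \<open>Holder_r_2\<close>.\<close>

lemma f_diff_le: "f (u x) - f (u y) \<le> p * u x powr (r - 2) * (u x - u y)" if "u y < u x"
proof -
  have p1: "1 \<le> p" using r p by linarith
  have "u y powr q \<le> u x powr q" using that u_nonneg p1 pq by (intro powr_mono2) auto
  then have "f (u x) - f (u y) \<le> u x powr p - u y powr p" by (simp add: f_def)
  also have "\<dots> \<le> p * u x powr (p - 1) * (u x - u y)"
    by (rule powr_diff_le_mvt[OF u_nonneg that p1])
  also have "\<dots> \<le> p * u x powr (r - 2) * (u x - u y)"
  proof (intro mult_right_mono mult_left_mono)
    show "u x powr (p - 1) \<le> u x powr (r - 2)"
      using p u_nonneg[of x] u_le_1[of x] by (intro powr_mono') auto
  qed (use that p1 in auto)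
  finally show ?thesis .
qed

lemma f_lipschitz: "\<bar>f (u x) - f (u y)\<bar> \<le> (p + q) * \<bar>u x - u y\<bar>"
proof -
  have p1: "1 \<le> p" "1 \<le> q" using r p pq by linarith+
  have pow: "\<bar>u x powr m - u y powr m\<bar> \<le> m * \<bar>u x - u y\<bar>" if m: "1 \<le> m" for m x y
  proof -
    have *: "\<bar>u x powr m - u y powr m\<bar> \<le> m * \<bar>u x - u y\<bar>" if "u y < u x" for x y
    proof -
      have "u y powr m \<le> u x powr m" using that m u_nonneg by (intro powr_mono2) auto
      moreover have "u x powr m - u y powr m \<le> m * u x powr (m - 1) * (u x - u y)"
        by (rule powr_diff_le_mvt[OF u_nonneg that m])
      moreover have "m * u x powr (m - 1) * (u x - u y) \<le> m * 1 * (u x - u y)"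
        using that m u_nonneg[of x] u_le_1[of x] by (intro mult_right_mono mult_left_mono powr_le1) auto
      ultimately show ?thesis using that by simp
    qed
    show ?thesis using *[of x y] *[of y x] by (cases "u x" "u y" rule: linorder_cases) (simp_all add: abs_minus_commute)
  qed
  have "\<bar>f (u x) - f (u y)\<bar> \<le> \<bar>u x powr p - u y powr p\<bar> + \<bar>u x powr q - u y powr q\<bar>"
    by (simp add: f_def)
  also have "\<dots> \<le> p * \<bar>u x - u y\<bar> + q * \<bar>u x - u y\<bar>" using p1 by (intro add_mono pow)
  finally show ?thesis by (simp add: distrib_right)
qed

text \<open>Solves \<open>p * X powr ((r - 2) / r) * Sobolev_const = C / 2\<close> for
  \<open>X\<close>: below this threshold the linearized right-hand side is at most half of the
  energy.\<close>

definition small_const :: real where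
  "small_const = (C / (2 * p * Sobolev_const DIM('a) s)) powr (r / (r - 2))"

lemma small_const_pos: "0 < small_const"
  unfolding small_const_def using C p r Sobolev_const_pos[of "DIM('a)" s] by simp

end

locale reflected_solution = continuous_solution s p q C r u + reflection e l
  for s p q C r :: real and u :: "'a::euclidean_space \<Rightarrow> real" and e :: 'a and l
begin

definition z :: "'a \<Rightarrow> real" where "z x = u x - u (R x)"
definition F :: "'a \<Rightarrow> real" where "F x = f (u x) - f (u (R x))"

lemma z_anti: "z (R x) = - z x"
  by (simp add: z_def)

lemma z_continuous: "continuous_on UNIV z"
  unfolding z_def by (intro continuous_intros continuous continuous_on_compose2[OF continuous R_continuous]) auto

lemma z_measurable [measurable]: "z \<in> borel_measurable borel"
  using z_continuous by (rule borel_measurable_continuous_onI)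

lemma F_measurable [measurable]: "F \<in> borel_measurable borel"
  unfolding F_def by measurable

lemma uR_energy: "fin_energy s (\<lambda>x. u (R x))"
  by (rule fin_energy_R(1)[OF u_energy u_energy])

lemma z_energy: "fin_energy s z"
  unfolding z_def by (rule fin_energy_diff[OF u_energy uR_energy])

lemma F_integrable: "integrable lborel (\<lambda>x. \<bar>F x\<bar> powr (r / (r - 1)))"
proof -
  define m where "m = (\<lambda>x. max (u x) (u (R x)))"
  have "integrable lborel (\<lambda>x. u x powr r + u (R x) powr r)"
    using u_int integral_R(1)[of "\<lambda>x. u x powr r"] by simp
  then have im: "integrable lborel (\<lambda>x. \<bar>m x\<bar> powr r)"
    by (rule Bochner_Integration.integrable_bound) (auto simp: m_def max_def u_nonneg)
  show ?thesis
  proof (rule integrable_conj_exp[OF _ _ im])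
    have "\<bar>F x\<bar> \<le> \<bar>m x\<bar> powr (r - 1)" for x
    proof -
      have m0: "0 \<le> m x" using u_nonneg[of x] by (simp add: m_def le_max_iff_disj)
      have "u x powr (r - 1) \<le> m x powr (r - 1)" "u (R x) powr (r - 1) \<le> m x powr (r - 1)"
        using u_nonneg r by (auto simp: m_def intro!: powr_mono2)
      then show ?thesis
        using f_nonneg[of x] f_nonneg[of "R x"] f_le[of x] f_le[of "R x"] m0 by (simp add: F_def abs_le_iff)
    qed
    then show "AE x in lborel. \<bar>F x\<bar> \<le> 1 * \<bar>m x\<bar> powr (r - 1)" by simp
  qed (use r in auto)
qed

lemma f_u_conj: "integrable lborel (\<lambda>x. \<bar>f (u x)\<bar> powr (r / (r - 1)))"
proof (rule integrable_conj_exp)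
  show "integrable lborel (\<lambda>x. \<bar>u x\<bar> powr r)" using u_int u_nonneg by simp
  show "AE x in lborel. \<bar>f (u x)\<bar> \<le> 1 * \<bar>u x\<bar> powr (r - 1)"
    using f_nonneg f_le u_nonneg by simp
qed (use r in auto)

text \<open>The equation tested with \<open>\<phi>\<close> minus the one tested with
  \<open>\<phi> \<circ> R\<close>; invariance of the form and of Lebesgue measure moves the
  reflection onto \<open>u\<close>.\<close>

lemma z_eq:
  assumes \<phi>: "lip_cs \<phi>"
  shows "C * form s z \<phi> = (\<integral>x. F x * \<phi> x \<partial>lborel)"
proof -
  have fe: "fin_energy s \<phi>" by (rule lip_cs_fin_energy[OF s(1,2) \<phi>])
  have [measurable]: "\<phi> \<in> borel_measurable borel" by (rule lip_cs_measurable[OF \<phi>])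
  note \<phi>R = lip_cs_R[OF \<phi>]
  have ip: "integrable lborel (\<lambda>x. \<bar>\<phi> x\<bar> powr r)" "integrable lborel (\<lambda>x. \<bar>\<phi> (R x)\<bar> powr r)"
    using lip_cs_integrable_powr[OF \<phi>] lip_cs_integrable_powr[OF \<phi>R] r by simp_all
  have i1: "integrable lborel (\<lambda>x. f (u x) * \<phi> x)" "integrable lborel (\<lambda>x. f (u x) * \<phi> (R x))"
    using r f_u_conj ip by (auto intro!: integrable_Young[of r])
  have "form s (\<lambda>x. u (R x)) \<phi> = form s u (\<lambda>x. \<phi> (R x))"
    using fin_energy_R(2)[OF u_energy lip_cs_fin_energy[OF s(1,2) \<phi>R]] by simp
  then have "C * form s z \<phi> = C * form s u \<phi> - C * form s u (\<lambda>x. \<phi> (R x))"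
    unfolding z_def form_diff_left[OF u_energy uR_energy fe] by (simp add: right_diff_distrib)
  also have "\<dots> = (\<integral>x. f (u x) * \<phi> x \<partial>lborel) - (\<integral>x. f (u x) * \<phi> (R x) \<partial>lborel)"
    by (simp add: eq[OF \<phi>] eq[OF \<phi>R] f_def)
  also have "(\<integral>x. f (u x) * \<phi> (R x) \<partial>lborel) = (\<integral>x. f (u (R x)) * \<phi> x \<partial>lborel)"
    using integral_R(2)[of "\<lambda>x. f (u x) * \<phi> (R x)"] by simp
  also have "(\<integral>x. f (u x) * \<phi> x \<partial>lborel) - (\<integral>x. f (u (R x)) * \<phi> x \<partial>lborel) = (\<integral>x. F x * \<phi> x \<partial>lborel)"
  proof -
    have "integrable lborel (\<lambda>x. f (u (R x)) * \<phi> x)"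
      using integral_R(1)[of "\<lambda>x. f (u x) * \<phi> (R x)"] i1(2) by simp
    with i1(1) show ?thesis by (simp add: F_def left_diff_distrib)
  qed
  finally show ?thesis .
qed

text \<open>Extends \<open>z_eq\<close> to limits of Lipschitz tests with bounded energy.
  \<open>F_integrable\<close> puts the right-hand side in the dual of the critical Lebesgue
  space.\<close>

lemma weak_test:
  assumes \<phi>: "\<And>n::nat. lip_cs (\<phi> n)" and bd: "\<And>n. form s (\<phi> n) (\<phi> n) \<le> A"
    and lim: "AE x in lborel. (\<lambda>n. \<phi> n x) \<longlonglongrightarrow> \<phi>0 x" and m: "\<phi>0 \<in> borel_measurable borel"
  shows "fin_energy s \<phi>0" "integrable lborel (\<lambda>x. \<bar>\<phi>0 x\<bar> powr r)"
    "C * form s z \<phi>0 = (\<integral>x. F x * \<phi>0 x \<partial>lborel)"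
proof -
  have ip: "integrable lborel (\<lambda>x. \<bar>\<phi> n x\<bar> powr r)" for n
    using lip_cs_integrable_powr[OF \<phi>] r by simp
  note wl = weak_limit[OF s(1,3) lip_cs_fin_energy[OF s(1,2) \<phi>] ip[unfolded r_eq] bd lim m, folded r_eq]
  show "fin_energy s \<phi>0" "integrable lborel (\<lambda>x. \<bar>\<phi>0 x\<bar> powr r)" by (rule wl(1), rule wl(2))
  have "(\<lambda>n. C * form s z (\<phi> n)) \<longlonglongrightarrow> C * form s z \<phi>0"
    by (intro tendsto_mult tendsto_const wl(3) z_energy)
  moreover have "(\<lambda>n. C * form s z (\<phi> n)) \<longlonglongrightarrow> (\<integral>x. F x * \<phi>0 x \<partial>lborel)"
    unfolding z_eq[OF \<phi>] by (rule wl(4)[OF F_measurable F_integrable])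
  ultimately show "C * form s z \<phi>0 = (\<integral>x. F x * \<phi>0 x \<partial>lborel)" by (rule LIMSEQ_unique)
qed

lemma AE_R:
  assumes "AE x in lborel. P x"
  shows "AE x in lborel. P (R x)"
proof -
  have "AE x in distr lborel lborel R. P x" unfolding distr_R(1) by (rule assms)
  then show ?thesis by (rule AE_distrD[rotated]) simp
qed

lemma approx:
  obtains \<psi> A where "\<And>n::nat. lip_cs (\<psi> n)" "\<And>n. form s (\<lambda>x. \<psi> n x - \<psi> n (R x)) (\<lambda>x. \<psi> n x - \<psi> n (R x)) \<le> A"
    "AE x in lborel. (\<lambda>n. \<psi> n x - \<psi> n (R x)) \<longlonglongrightarrow> z x"
proof -
  obtain \<psi> A where \<psi>: "\<And>n::nat. lip_cs (\<psi> n)" "\<And>n. form s (\<psi> n) (\<psi> n) \<le> A"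
    "AE x in lborel. (\<lambda>n. \<psi> n x) \<longlonglongrightarrow> u x" using u_approx unfolding lip_approx_def by auto
  have fe: "fin_energy s (\<psi> n)" for n by (rule lip_cs_fin_energy[OF s(1,2) \<psi>(1)])
  show thesis
  proof (rule that[of \<psi> "4 * A"])
    show "lip_cs (\<psi> n)" for n by (rule \<psi>(1))
  next
    fix n
    have "form s (\<lambda>x. \<psi> n x - \<psi> n (R x)) (\<lambda>x. \<psi> n x - \<psi> n (R x)) \<le> 2 * form s (\<psi> n) (\<psi> n) + 2 * form s (\<lambda>x. \<psi> n (R x)) (\<lambda>x. \<psi> n (R x))"
      by (rule form_diff_le[OF fe fin_energy_R(1)[OF fe fe]])
    then show "form s (\<lambda>x. \<psi> n x - \<psi> n (R x)) (\<lambda>x. \<psi> n x - \<psi> n (R x)) \<le> 4 * A"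
      using \<psi>(2)[of n] by (simp add: fin_energy_R(2)[OF fe fe])
  next
    show "AE x in lborel. (\<lambda>n. \<psi> n x - \<psi> n (R x)) \<longlonglongrightarrow> z x"
      using \<psi>(3) AE_R[OF \<psi>(3)] unfolding z_def by eventually_elim (rule tendsto_diff)
  qed
qed

text \<open>
  Maximum principle in narrow sets: the exponent of \<open>u\<close> in the linearization is exactly the one
  for which Hoelder's inequality and the Sobolev inequality close up.
\<close>

lemma reflection_le_of_small:
  assumes small: "(\<integral>x. indicator {x\<in>S. u (R x) < u x} x * u x powr r \<partial>lborel) < small_const"
    and x: "x \<in> S"
  shows "u x \<le> u (R x)"
proof -
  obtain \<psi> A where \<psi>: "\<And>n::nat. lip_cs (\<psi> n)" "\<And>n. form s (\<lambda>x. \<psi> n x - \<psi> n (R x)) (\<lambda>x. \<psi> n x - \<psi> n (R x)) \<le> A"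
    "AE x in lborel. (\<lambda>n. \<psi> n x - \<psi> n (R x)) \<longlonglongrightarrow> z x" by (rule approx) (rule that)
  define w where "w = pos_half z"
  have [measurable]: "w \<in> borel_measurable borel" unfolding w_def by measurable
  \<comment> \<open>The one-sided positive part of the antisymmetrized approximants is an admissible
    test and tends to \<open>w\<close>.\<close>
  define \<phi> where "\<phi> = (\<lambda>n. pos_half (\<lambda>x. \<psi> n x - \<psi> n (R x)))"
  have lc: "lip_cs (\<phi> n)" for n unfolding \<phi>_def by (rule lip_cs_pos_half[OF \<psi>(1)])
  have fg: "fin_energy s (\<lambda>x. \<psi> n x - \<psi> n (R x))" for n
    by (rule lip_cs_fin_energy[OF s(1,2) lip_cs_diff[OF \<psi>(1) lip_cs_R[OF \<psi>(1)]]])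
  have bd: "form s (\<phi> n) (\<phi> n) \<le> A" for n
  proof -
    have "form s (\<phi> n) (\<phi> n) \<le> form s (\<lambda>x. \<psi> n x - \<psi> n (R x)) (\<lambda>x. \<psi> n x - \<psi> n (R x))"
      unfolding \<phi>_def
      by (rule form_pos_half_le_form[OF s(1) fg]) (use lip_cs_fin_energy[OF s(1,2) lc[unfolded \<phi>_def]] in auto)
    then show ?thesis using \<psi>(2)[of n] by linarith
  qed
  have lim: "AE x in lborel. (\<lambda>n. \<phi> n x) \<longlonglongrightarrow> w x"
    using \<psi>(3) by eventually_elim (auto simp: \<phi>_def w_def pos_half_def intro!: tendsto_max)
  note wt = weak_test[OF lc bd lim \<open>w \<in> borel_measurable borel\<close>]
  define P where "P = {x\<in>S. u (R x) < u x}"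
  have [measurable]: "P \<in> sets borel" unfolding P_def by measurable
  \<comment> \<open>Restricting the weight to the set where \<open>w\<close> is positive is what
    lets the smallness assumption act: the integral of \<open>g powr r\<close> is the quantity
    assumed small.\<close>
  define g where "g = (\<lambda>x. indicator P x * u x)"
  have g0: "0 \<le> g x" and w0: "0 \<le> w x" for x using u_nonneg by (auto simp: g_def w_def pos_half_def)
  have gr: "g x powr r = indicator P x * u x powr r" for x using r by (simp add: g_def indicator_def)
  have gi: "integrable lborel (\<lambda>x. g x powr r)"
    unfolding gr using integrable_mult_indicator[OF _ u_int, of P] by simp
  have wi: "integrable lborel (\<lambda>x. w x powr r)" using wt(2) w0 by simp
  define X Y where "X = (\<integral>x. g x powr r \<partial>lborel)" and "Y = (\<integral>x. w x powr r \<partial>lborel)"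
  have X: "0 \<le> X" "X < small_const" using small by (auto simp: X_def gr P_def intro!: integral_nonneg_AE)
  note H = Holder_r_2[OF r _ _ g0 w0 gi wi]
  have p0: "0 < p" using p r by linarith
  have Fw: "F x * w x \<le> p * (g x powr (r - 2) * (w x)\<^sup>2)" for x
  proof (cases "x \<in> P")
    case True
    then have w: "w x = u x - u (R x)" and g: "g x = u x" and lt: "u (R x) < u x"
      by (auto simp: P_def w_def pos_half_def z_def g_def)
    have "F x * w x \<le> (p * u x powr (r - 2) * (u x - u (R x))) * w x"
      unfolding F_def by (intro mult_right_mono f_diff_le lt w0)
    then show ?thesis by (simp add: w g power2_eq_square mult.assoc)
  next
    case False
    then have "w x = 0" by (auto simp: P_def w_def pos_half_def z_def)
    then show ?thesis by simp
  qed
  let ?S = "Sobolev_const DIM('a) s"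
  have S0: "0 < ?S" by (rule Sobolev_const_pos) simp
  have E: "form s w w \<le> form s z w"
    unfolding w_def using form_pos_half_le[OF s(1) z_energy _ z_anti] wt(1) by (simp add: w_def)
  have "C * form s z w = (\<integral>x. F x * w x \<partial>lborel)" by (rule wt(3))
  also have "\<dots> \<le> (\<integral>x. p * (g x powr (r - 2) * (w x)\<^sup>2) \<partial>lborel)"
  proof (rule integral_mono[OF _ _ Fw])
    show "integrable lborel (\<lambda>x. F x * w x)"
      by (rule integrable_Young[of r]) (use r F_integrable wt(2) in auto)
    show "integrable lborel (\<lambda>x. p * (g x powr (r - 2) * (w x)\<^sup>2))"
      using H(1) by (simp add: g_def)
  qed
  also have "\<dots> \<le> p * (X powr ((r - 2) / r) * Y powr (2 / r))"
    using H(2) p0 unfolding X_def Y_def by (simp add: g_def mult_left_mono)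
  also have "\<dots> \<le> p * (X powr ((r - 2) / r) * (?S * form s w w))"
    using Sobolev[OF wt(1,2)] p0 w0
    by (intro mult_left_mono) (auto simp: Y_def)
  finally have 1: "C * form s z w \<le> p * (X powr ((r - 2) / r) * (?S * form s w w))" .
  have "X powr ((r - 2) / r) \<le> small_const powr ((r - 2) / r)"
    using X r by (intro powr_mono2) auto
  also have "\<dots> = C / (2 * p * ?S)"
    unfolding small_const_def powr_powr using r C p0 S0 by simp
  finally have "p * (X powr ((r - 2) / r) * (?S * form s w w)) \<le> p * (C / (2 * p * ?S) * (?S * form s w w))"
    using p0 S0 form_nonneg[of s w] by (intro mult_left_mono mult_right_mono) auto
  also have "\<dots> = C / 2 * form s w w" using p0 S0 by (simp add: field_simps)
  \<comment> \<open>The right-hand side is absorbed, so the energy of \<open>w\<close> vanishes; the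
    Sobolev inequality then gives \<open>w = 0\<close> almost everywhere and continuity everywhere
    on \<open>S\<close>.\<close>
  finally have "C * form s w w \<le> C / 2 * form s w w"
    using 1 mult_left_mono[OF E, of C] C by linarith
  then have "form s w w \<le> 0" using C by simp
  then have "form s w w = 0" using form_nonneg[of s w] by simp
  then have "Y powr (2 / r) \<le> 0" using Sobolev[OF wt(1,2)] w0 by (simp add: Y_def)
  then have "Y powr (2 / r) = 0" by (simp add: antisym)
  then have "Y = 0" by simp
  then have "AE x in lborel. w x powr r = 0"
    using integral_nonneg_eq_0_iff_AE[OF wi] by (simp add: Y_def)
  then have ae: "AE x in lborel. x \<in> S \<longrightarrow> max 0 (z x) = 0"
    by eventually_elim (auto simp: w_def pos_half_def)
  have "continuous_on UNIV (\<lambda>x. max 0 (z x))"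
    by (intro continuous_on_max continuous_on_const z_continuous)
  from open_AE_closed[OF S_open this ae x] have "max 0 (z x) = 0" .
  then show ?thesis by (simp add: z_def max_def split: if_splits)
qed


text \<open>
  Strong maximum principle. With \<open>d = u \<circ> R - u \<ge> 0\<close> on the half-space, test with
  \<open>\<eta> (1 - n d)\<^sup>+\<close>, which converges to \<open>\<eta>\<close> on the zero set of \<open>d\<close> and to \<open>0\<close> elsewhere. The
  right-hand side tends to \<open>0\<close>, and the folded form has the limit
  \<open>- \<integral>\<integral> (\<eta> x [d x = 0] d y + \<eta> y [d y = 0] d x) (ker (x - y) - ker (x - R y))\<close>.
\<close>

lemma zero_set_dichotomy:
  assumes le: "\<And>x. x \<in> S \<Longrightarrow> u x \<le> u (R x)"
    and \<eta>: "lip_cs \<eta>" "\<And>x. 0 \<le> \<eta> x" "\<And>x. x \<notin> S \<Longrightarrow> \<eta> x = 0"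
  shows "AE p in lborel2. fst p \<in> S \<longrightarrow> snd p \<in> S \<longrightarrow> z (fst p) = 0 \<longrightarrow> \<eta> (fst p) * z (snd p) = 0"
proof -
  define d where "d = (\<lambda>x. - z x)"
  have d0: "0 \<le> d x" if "x \<in> S" for x using le[OF that] by (simp add: d_def z_def)
  have dR: "d (R x) = - d x" for x by (simp add: d_def z_anti)
  have [measurable]: "d \<in> borel_measurable borel" "\<eta> \<in> borel_measurable borel"
    using lip_cs_measurable[OF \<eta>(1)] by (auto simp: d_def)
  have d_energy: "fin_energy s d" unfolding d_def using fin_energy_cmult[OF z_energy, of "-1"] by simp
  have \<eta>_energy: "fin_energy s \<eta>" by (rule lip_cs_fin_energy[OF s(1,2) \<eta>(1)])
  obtain L M Q where LM: "L-lipschitz_on UNIV \<eta>" "\<And>x. \<bar>\<eta> x\<bar> \<le> M" "0 < Q" "{x. \<eta> x \<noteq> 0} \<subseteq> cball 0 Q"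
    using lip_cs_bounded[OF \<eta>(1)] by metis
  have M0: "0 \<le> M" using LM(2)[of 0] by linarith
  \<comment> \<open>The upper cut at \<open>1\<close> keeps \<open>T n\<close> bounded for negative
    arguments, which the approximants of \<open>d\<close> can take.\<close>
  define T where "T = (\<lambda>n t. max 0 (min 1 (1 - real (Suc n) * t)))"
  have T01: "0 \<le> T n t" "T n t \<le> 1" for n t by (auto simp: T_def)
  have T_lip: "\<bar>T n a - T n b\<bar> \<le> real (Suc n) * \<bar>a - b\<bar>" for n a b
  proof -
    have "\<bar>T n a - T n b\<bar> \<le> \<bar>real (Suc n) * a - real (Suc n) * b\<bar>" unfolding T_def by (auto simp: max_def min_def)
    then show ?thesis by (simp add: abs_mult flip: right_diff_distrib)
  qed
  have T_anti: "T n b \<le> T n a" if "a \<le> b" for n a b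
    using that mult_left_mono[OF that, of "real (Suc n)"] unfolding T_def by (intro max.mono min.mono) auto
  define \<phi> where "\<phi> = (\<lambda>n x. \<eta> x * T n (d x))"
  have [measurable]: "\<phi> n \<in> borel_measurable borel" for n unfolding \<phi>_def T_def by measurable
  obtain \<psi> A where \<psi>: "\<And>n::nat. lip_cs (\<psi> n)" "\<And>n. form s (\<lambda>x. \<psi> n x - \<psi> n (R x)) (\<lambda>x. \<psi> n x - \<psi> n (R x)) \<le> A"
    "AE x in lborel. (\<lambda>n. \<psi> n x - \<psi> n (R x)) \<longlonglongrightarrow> z x" by (rule approx) (rule that)
  have test: "fin_energy s (\<phi> n) \<and> integrable lborel (\<lambda>x. \<bar>\<phi> n x\<bar> powr r) \<and> C * form s z (\<phi> n) = (\<integral>x. F x * \<phi> n x \<partial>lborel)" for n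
  proof -
    \<comment> \<open>No Lipschitz bound for \<open>d\<close> is at hand, so \<open>\<phi> n\<close>
      is reached with \<open>n\<close> fixed by replacing \<open>d\<close> with Lipschitz
      approximants. The product rule bounds the energies uniformly in \<open>m\<close>; growth of
      that bound with \<open>n\<close> is harmless, since \<open>m\<close> goes to infinity
      first.\<close>
    define g where "g = (\<lambda>m x. \<psi> m x - \<psi> m (R x))"
    define \<xi> where "\<xi> = (\<lambda>m x. \<eta> x * T n (- g m x))"
    have glc: "lip_cs (g m)" for m unfolding g_def by (rule lip_cs_diff[OF \<psi>(1) lip_cs_R[OF \<psi>(1)]])
    have ge: "fin_energy s (g m)" for m by (rule lip_cs_fin_energy[OF s(1,2) glc])
    have lc: "lip_cs (\<xi> m)" for m
    proof -
      obtain K where K: "K-lipschitz_on UNIV (g m)" using glc by (auto simp: lip_cs_def)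
      have "(real (Suc n) * K)-lipschitz_on UNIV (\<lambda>x. T n (- g m x))"
      proof (rule lipschitz_onI)
        fix x y
        have "\<bar>T n (- g m x) - T n (- g m y)\<bar> \<le> real (Suc n) * \<bar>g m x - g m y\<bar>"
          using T_lip[of n "- g m x" "- g m y"] by (simp add: abs_minus_commute)
        also have "\<dots> \<le> real (Suc n) * (K * dist x y)"
          using lipschitz_onD[OF K, of x y] by (intro mult_left_mono) (auto simp: dist_real_def)
        finally show "dist (T n (- g m x)) (T n (- g m y)) \<le> real (Suc n) * K * dist x y"
          by (simp add: dist_real_def mult.assoc)
      qed (use lipschitz_on_nonneg[OF K] in simp)
      from lipschitz_on_mult_bounded[OF LM(1,2) this, of 1] T01
      have "\<exists>L. L-lipschitz_on UNIV (\<xi> m)" unfolding \<xi>_def by (auto simp: abs_le_iff intro: order_trans[of _ 0])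
      moreover have "bounded {x. \<xi> m x \<noteq> 0}"
        by (rule bounded_subset[of "{x. \<eta> x \<noteq> 0}"]) (use \<eta>(1) in \<open>auto simp: lip_cs_def \<xi>_def\<close>)
      ultimately show ?thesis by (simp add: lip_cs_def)
    qed
    have bd: "form s (\<xi> m) (\<xi> m) \<le> 2 * form s \<eta> \<eta> + 2 * M\<^sup>2 * (real (Suc n))\<^sup>2 * A" for m
    proof -
      have "form s (\<xi> m) (\<xi> m) \<le> 2 * form s \<eta> \<eta> + (2 * M\<^sup>2 * (real (Suc n))\<^sup>2) * form s (g m) (g m)"
      proof (rule form_le_add[OF \<eta>_energy ge lip_cs_fin_energy[OF s(1,2) lc]])
        fix x y
        define a b where "a = T n (- g m x)" and "b = T n (- g m y)"
        have *: "\<xi> m x - \<xi> m y = (\<eta> x - \<eta> y) * a + \<eta> y * (a - b)"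
          by (simp add: \<xi>_def a_def b_def algebra_simps)
        have "(\<xi> m x - \<xi> m y)\<^sup>2 \<le> 2 * ((\<eta> x - \<eta> y) * a)\<^sup>2 + 2 * (\<eta> y * (a - b))\<^sup>2"
        proof -
          have "(A + B)\<^sup>2 \<le> 2 * A\<^sup>2 + 2 * B\<^sup>2" for A B :: real
            using zero_le_power2[of "A - B"] by (simp add: power2_eq_square algebra_simps)
          then show ?thesis unfolding * .
        qed
        moreover have "((\<eta> x - \<eta> y) * a)\<^sup>2 \<le> (\<eta> x - \<eta> y)\<^sup>2"
        proof -
          have "a\<^sup>2 \<le> 1" using T01[of n "- g m x"] unfolding a_def by (intro power_le_one) auto
          then have "(\<eta> x - \<eta> y)\<^sup>2 * a\<^sup>2 \<le> (\<eta> x - \<eta> y)\<^sup>2 * 1" by (intro mult_left_mono) auto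
          then show ?thesis by (simp add: power_mult_distrib)
        qed
        moreover have "(\<eta> y * (a - b))\<^sup>2 \<le> M\<^sup>2 * ((real (Suc n))\<^sup>2 * (g m x - g m y)\<^sup>2)"
        proof -
          have "\<bar>\<eta> y * (a - b)\<bar> \<le> M * (real (Suc n) * \<bar>g m x - g m y\<bar>)"
            unfolding abs_mult using LM(2) M0 T_lip[of n "- g m x" "- g m y"]
            by (intro mult_mono) (auto simp: a_def b_def abs_minus_commute)
          then have "\<bar>\<eta> y * (a - b)\<bar>\<^sup>2 \<le> (M * (real (Suc n) * \<bar>g m x - g m y\<bar>))\<^sup>2" by (rule power_mono) simp
          then show ?thesis by (simp add: power_mult_distrib)
        qed
        ultimately show "(\<xi> m x - \<xi> m y)\<^sup>2 \<le> 2 * (\<eta> x - \<eta> y)\<^sup>2 + 2 * M\<^sup>2 * (real (Suc n))\<^sup>2 * (g m x - g m y)\<^sup>2"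
          by (simp add: mult.assoc)
      qed
      also have "\<dots> \<le> 2 * form s \<eta> \<eta> + (2 * M\<^sup>2 * (real (Suc n))\<^sup>2) * A"
        using \<psi>(2)[of m] by (intro add_left_mono mult_left_mono) (auto simp: g_def)
      finally show ?thesis .
    qed
    have lim: "AE x in lborel. (\<lambda>m. \<xi> m x) \<longlonglongrightarrow> \<phi> n x"
      using \<psi>(3)
    proof eventually_elim
      case (elim x)
      then have "(\<lambda>m. g m x) \<longlonglongrightarrow> z x" by (simp add: g_def)
      then show ?case unfolding \<xi>_def \<phi>_def T_def d_def
        by (intro tendsto_mult tendsto_max tendsto_min tendsto_diff tendsto_minus tendsto_const)
    qed
    from weak_test[OF lc bd lim] show ?thesis by simp
  qed
  have \<phi>_energy: "fin_energy s (\<phi> n)" for n using test by blast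
  have I\<eta>: "integrable lborel \<eta>" using lip_cs_integrable_powr[OF \<eta>(1), of 1] \<eta>(2) by simp
  define I where "I = (\<integral>x. \<eta> x \<partial>lborel)"
  have pq0: "0 \<le> p + q" using p pq r by linarith
  \<comment> \<open>Where the cut-off is nonzero, \<open>d\<close> is below
    \<open>1 / (n + 1)\<close>, and the nonlinearity is Lipschitz on the range of \<open>u\<close>;
    the right-hand side is thus of order \<open>1 / n\<close>.\<close>
  have small: "\<bar>form s d (\<phi> n)\<bar> \<le> (p + q) * I / C * (1 / real (Suc n))" for n
  proof -
    have "form s d (\<phi> n) = - form s z (\<phi> n)"
    proof -
      have "form s d (\<phi> n) = (\<integral>x. - (dif z x * dif (\<phi> n) x * ker2 s x) \<partial>lborel2)"
        unfolding form_def by (rule Bochner_Integration.integral_cong) (auto simp: d_def algebra_simps)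
      then show ?thesis by (simp add: form_def)
    qed
    then have "C * \<bar>form s d (\<phi> n)\<bar> = \<bar>\<integral>x. F x * \<phi> n x \<partial>lborel\<bar>"
      using test[of n] C by (metis abs_minus_cancel abs_mult abs_of_pos)
    also have "\<dots> \<le> (\<integral>x. (p + q) * (1 / real (Suc n)) * \<eta> x \<partial>lborel)"
    proof (rule integral_abs_bound_integral)
      show "integrable lborel (\<lambda>x. F x * \<phi> n x)"
        by (rule integrable_Young[of r]) (use r F_integrable test in auto)
      show "integrable lborel (\<lambda>x. (p + q) * (1 / real (Suc n)) * \<eta> x)" using I\<eta> by simp
      fix x
      show "\<bar>F x * \<phi> n x\<bar> \<le> (p + q) * (1 / real (Suc n)) * \<eta> x"
      proof (cases "x \<in> S")
        case True
        have dT: "d x * T n (d x) \<le> 1 / real (Suc n)"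
        proof (cases "real (Suc n) * d x \<le> 1")
          case True
          then have "d x \<le> 1 / real (Suc n)" by (simp add: field_simps)
          moreover have "d x * T n (d x) \<le> d x * 1" using d0[OF \<open>x \<in> S\<close>] T01 by (intro mult_left_mono) auto
          ultimately show ?thesis by simp
        next
          case False
          then have "T n (d x) = 0" by (simp add: T_def)
          then show ?thesis by simp
        qed
        have "\<bar>F x\<bar> \<le> (p + q) * d x"
          using f_lipschitz[of x "R x"] d0[OF True] by (simp add: F_def d_def z_def abs_minus_commute)
        then have "\<bar>F x * \<phi> n x\<bar> \<le> ((p + q) * d x) * \<phi> n x"
          using \<eta>(2)[of x] T01[of n "d x"] by (simp add: \<phi>_def abs_mult mult_right_mono)
        also have "\<dots> = (p + q) * \<eta> x * (d x * T n (d x))" by (simp add: \<phi>_def)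
        also have "\<dots> \<le> (p + q) * \<eta> x * (1 / real (Suc n))"
          using pq0 \<eta>(2) by (intro mult_left_mono dT) auto
        finally show ?thesis by (simp only: mult_ac)
      qed (simp add: \<phi>_def \<eta>(3))
    qed
    also have "\<dots> = (p + q) * (1 / real (Suc n)) * I" unfolding I_def by (rule integral_mult_right_zero)
    finally have "C * \<bar>form s d (\<phi> n)\<bar> / C \<le> (p + q) * (1 / real (Suc n)) * I / C"
      using C by (intro divide_right_mono) auto
    then show ?thesis using C by (simp add: mult_ac)
  qed
  define Fn where "Fn = (\<lambda>n q. dif d q * dif (\<phi> n) q * ker2 s q)"
  define G where "G = (\<lambda>n q. indicator S (fst q) * indicator S (snd q) *
      (Fn n (fst q, snd q) + Fn n (R (fst q), snd q) + Fn n (fst q, R (snd q)) + Fn n (R (fst q), R (snd q))))"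
  have iFn: "integrable lborel2 (Fn n)" for n unfolding Fn_def by (rule form_integrable[OF d_energy \<phi>_energy])
  have iG: "integrable lborel2 (G n)" for n unfolding G_def by (rule form_fold(2)[OF iFn])
  have eG: "(\<integral>q. G n q \<partial>lborel2) = form s d (\<phi> n)" for n
    unfolding G_def form_fold(1)[OF iFn, symmetric] by (simp add: form_def Fn_def)
  define E where "E = (\<lambda>q. dif d q * dif \<eta> q * ker2 s q)"
  have iE: "integrable lborel2 E" unfolding E_def by (rule form_integrable[OF d_energy \<eta>_energy])
  define SS where "SS = (\<lambda>q. indicator S (fst q) * indicator S (snd q) :: real)"
  \<comment> \<open>The energy bound for \<open>\<phi> n\<close> grows with \<open>n\<close>, so no
    two-sided majorant of \<open>G n\<close> is available. \<open>H\<close> bounds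
    \<open>G n\<close> from above, which is enough for Fatou's lemma applied to
    \<open>H - G n\<close>.\<close>
  define H where "H = (\<lambda>q. SS q * (\<bar>E q\<bar> + E (R (fst q), snd q) + E (fst q, R (snd q))))"
  have iH: "integrable lborel2 H"
  proof -
    have i: "integrable lborel2 (\<lambda>q. \<bar>E q\<bar> + E (R (fst q), snd q) + E (fst q, R (snd q)))"
      using form_fold(3,4)[OF iE] iE by (intro Bochner_Integration.integrable_add integrable_abs)
    have "SS q = indicator (S \<times> S) q" for q by (cases q) (simp add: SS_def indicator_def)
    then show ?thesis unfolding H_def using integrable_mult_indicator[OF _ i, of "S \<times> S"] by (simp add: pair_measureI)
  qed
  define Z where "Z = (\<lambda>q. SS q * ((\<eta> (fst q) * of_bool (d (fst q) = 0) * d (snd q) + \<eta> (snd q) * of_bool (d (snd q) = 0) * d (fst q))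
      * (ker s (fst q - snd q) - ker s (fst q - R (snd q)))))"
  have [measurable]: "Z \<in> borel_measurable (borel \<Otimes>\<^sub>M borel)" unfolding Z_def SS_def by measurable
  have Gval: "G n (x, y) = (d x - d y) * (\<phi> n x - \<phi> n y) * ker s (x - y) + (d x + d y) * (\<phi> n x + \<phi> n y) * ker s (x - R y)"
    if "x \<in> S" "y \<in> S" for n x y
  proof -
    have "\<phi> n (R x) = 0" "\<phi> n (R y) = 0" using R_not_S that \<eta>(3) by (auto simp: \<phi>_def)
    then show ?thesis using that by (simp add: G_def Fn_def dR ker_R algebra_simps)
  qed
  have Hval: "H (x, y) = \<bar>(d x - d y) * (\<eta> x - \<eta> y)\<bar> * ker s (x - y) + (d x + d y) * (\<eta> x + \<eta> y) * ker s (x - R y)"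
    if "x \<in> S" "y \<in> S" for x y
  proof -
    have "\<eta> (R x) = 0" "\<eta> (R y) = 0" using R_not_S that \<eta>(3) by auto
    then have "E (R x, y) = (d x + d y) * \<eta> y * ker s (x - R y)" "E (x, R y) = (d x + d y) * \<eta> x * ker s (x - R y)"
      by (simp_all add: E_def dR ker_R algebra_simps)
    moreover have "\<bar>E (x, y)\<bar> = \<bar>(d x - d y) * (\<eta> x - \<eta> y)\<bar> * ker s (x - y)"
      by (simp add: E_def abs_mult)
    ultimately show ?thesis using that by (simp add: H_def SS_def distrib_right distrib_left)
  qed
  have out: "G n (x, y) = 0" "H (x, y) = 0" "Z (x, y) = 0" if "\<not> (x \<in> S \<and> y \<in> S)" for n x y
    using that by (auto simp: G_def H_def Z_def SS_def)
  have GH: "0 \<le> H q - G n q" for n q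
  proof -
    obtain x y where q: "q = (x, y)" by (cases q)
    show ?thesis
    proof (cases "x \<in> S \<and> y \<in> S")
      case True
      \<comment> \<open>\<open>T n\<close> is decreasing, so the larger of \<open>a\<close> and
        \<open>b\<close> carries the smaller factor; inserting the cut-offs never makes the product
        exceed the one with \<open>\<bar>c - c'\<bar>\<close>.\<close>
      have key: "(a - b) * (c * T n a - c' * T n b) \<le> \<bar>(a - b) * (c - c')\<bar>" if "0 \<le> c" "0 \<le> c'" for a b c c'
      proof -
        have *: "(a - b) * (c * T n a - c' * T n b) \<le> \<bar>(a - b) * (c - c')\<bar>" if "b \<le> a" "0 \<le> c'" for a b c c'
        proof -
          have "c' * T n a \<le> c' * T n b" using that by (intro mult_left_mono T_anti)
          then have "c * T n a - c' * T n b \<le> (c - c') * T n a" by (simp add: left_diff_distrib)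
          also have "\<dots> \<le> \<bar>c - c'\<bar> * 1" using T01[of n a] by (intro mult_mono) auto
          finally have "(a - b) * (c * T n a - c' * T n b) \<le> (a - b) * \<bar>c - c'\<bar>"
            using that by (intro mult_left_mono) auto
          then show ?thesis using that by (simp add: abs_mult)
        qed
        show ?thesis
        proof (cases "b \<le> a")
          case True then show ?thesis using * that by blast
        next
          case False
          then have "(b - a) * (c' * T n b - c * T n a) \<le> \<bar>(b - a) * (c' - c)\<bar>" using *[of a b c c'] that by simp
          then show ?thesis by (simp add: abs_mult abs_minus_commute algebra_simps)
        qed
      qed
      have "(d x - d y) * (\<phi> n x - \<phi> n y) * ker s (x - y) \<le> \<bar>(d x - d y) * (\<eta> x - \<eta> y)\<bar> * ker s (x - y)"
        unfolding \<phi>_def using key \<eta>(2) by (intro mult_right_mono) auto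
      moreover have "(d x + d y) * (\<phi> n x + \<phi> n y) * ker s (x - R y) \<le> (d x + d y) * (\<eta> x + \<eta> y) * ker s (x - R y)"
        unfolding \<phi>_def using True d0[of x] d0[of y] \<eta>(2) T01
        by (intro mult_right_mono mult_left_mono add_mono) (auto simp: mult_left_le)
      ultimately show ?thesis using True by (simp add: q Gval Hval)
    qed (simp add: q out)
  qed
  have Tlim: "(\<lambda>n. T n a) \<longlonglongrightarrow> of_bool (a = 0)" if "0 \<le> a" for a
  proof (cases "a = 0")
    case False
    with that have "0 < a" by simp
    then obtain n0 where n0: "1 < real n0 * a" using reals_Archimedean3 by blast
    have "T n a = 0" if "n0 \<le> n" for n
    proof -
      have "real n0 * a \<le> real (Suc n) * a" using that \<open>0 < a\<close> by (intro mult_right_mono) auto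
      then show ?thesis using n0 by (simp add: T_def)
    qed
    then have "\<forall>\<^sub>F n in sequentially. T n a = 0" by (auto simp: eventually_sequentially)
    then show ?thesis using False by (simp add: tendsto_eventually)
  qed (simp add: T_def)
  have Glim: "(\<lambda>n. G n q) \<longlonglongrightarrow> - Z q" for q
  proof -
    obtain x y where q: "q = (x, y)" by (cases q)
    show ?thesis
    proof (cases "x \<in> S \<and> y \<in> S")
      case True
      define a b :: real where "a = of_bool (d x = 0)" and "b = (of_bool (d y = 0) :: real)"
      have "(\<lambda>n. G n q) \<longlonglongrightarrow> (d x - d y) * (\<eta> x * a - \<eta> y * b) * ker s (x - y) + (d x + d y) * (\<eta> x * a + \<eta> y * b) * ker s (x - R y)"
        unfolding q Gval[OF conjunct1[OF True] conjunct2[OF True]] \<phi>_def a_def b_def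
        using True by (intro tendsto_intros Tlim d0) auto
      moreover have "(d x - d y) * (\<eta> x * a - \<eta> y * b) * ker s (x - y) + (d x + d y) * (\<eta> x * a + \<eta> y * b) * ker s (x - R y) = - Z q"
      proof -
        have "d x * a = 0" "d y * b = 0" by (auto simp: a_def b_def)
        then have "(dx - dy) * (ex * a' - ey * b') * k + (dx + dy) * (ex * a' + ey * b') * k' = - ((ex * a' * dy + ey * b' * dx) * (k - k'))"
          if "dx * a' = 0" "dy * b' = 0" for dx dy ex ey a' b' k k' :: real
        proof -
          have "(dx - dy) * (ex * a' - ey * b') * k + (dx + dy) * (ex * a' + ey * b') * k'
            = - ((ex * a' * dy + ey * b' * dx) * (k - k')) + (dx * a') * (ex * (k + k')) + (dy * b') * (ey * (k + k'))"
            by (simp add: algebra_simps)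
          then show ?thesis using that by simp
        qed
        from this[OF \<open>d x * a = 0\<close> \<open>d y * b = 0\<close>] show ?thesis
          using True by (simp add: q Z_def SS_def a_def b_def)
      qed
      ultimately show ?thesis by simp
    qed (simp add: q out)
  qed
  have Z0: "0 \<le> Z q" for q
  proof -
    obtain x y where q: "q = (x, y)" by (cases q)
    show ?thesis
    proof (cases "x \<in> S \<and> y \<in> S")
      case True
      have "(\<eta> x * of_bool (d x = 0) * d y + \<eta> y * of_bool (d y = 0) * d x) * (ker s (x - y) - ker s (x - R y)) \<ge> 0"
      proof (cases "x = y")
        case False
        then have "0 \<le> ker s (x - y) - ker s (x - R y)" using ker_R_le[OF s(1), of x y] True by simp
        then show ?thesis using True d0 \<eta>(2) by (intro mult_nonneg_nonneg add_nonneg_nonneg) auto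
      next
        case True then show ?thesis by simp
      qed
      then show ?thesis using True by (simp add: q Z_def SS_def)
    qed (simp add: q out)
  qed
  \<comment> \<open>Fatou along \<open>H - G n\<close>, whose limit is \<open>H + Z\<close> and
    whose integrals eventually stay below that of \<open>H\<close> plus \<open>\<delta>\<close>. As
    \<open>Z \<ge> 0\<close>, it must vanish almost everywhere.\<close>
  have HZ: "integrable lborel2 (\<lambda>q. H q + Z q) \<and> (\<integral>q. H q + Z q \<partial>lborel2) \<le> (\<integral>q. H q \<partial>lborel2) + \<delta>" if \<delta>: "0 < \<delta>" for \<delta>
  proof -
    have "(\<lambda>n. (p + q) * I / C * (1 / real (Suc n))) \<longlonglongrightarrow> (p + q) * I / C * 0"
      using LIMSEQ_inverse_real_of_nat by (intro tendsto_mult tendsto_const) (simp add: inverse_eq_divide)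
    then have "(\<lambda>n. (p + q) * I / C * (1 / real (Suc n))) \<longlonglongrightarrow> 0" by simp
    from LIMSEQ_D[OF this \<delta>] obtain n0 where n0: "\<And>n. n0 \<le> n \<Longrightarrow> \<bar>(p + q) * I / C * (1 / real (Suc n))\<bar> < \<delta>" by auto
    have 1: "integrable lborel2 (\<lambda>q. H q - G (n + n0) q)" for n using iH iG by simp
    have 3: "(\<integral>q. H q - G (n + n0) q \<partial>lborel2) \<le> (\<integral>q. H q \<partial>lborel2) + \<delta>" for n
    proof -
      have "n0 \<le> n + n0" by simp
      from small[of "n + n0"] n0[OF this] have "- form s d (\<phi> (n + n0)) \<le> \<delta>" by linarith
      then show ?thesis using iH iG by (simp add: eG)
    qed
    have 4: "AE q in lborel2. (\<lambda>n. H q - G (n + n0) q) \<longlonglongrightarrow> H q + Z q"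
    proof (rule AE_I2)
      fix q
      have "(\<lambda>n. H q - G (n + n0) q) \<longlonglongrightarrow> H q - (- Z q)"
        by (intro tendsto_diff tendsto_const LIMSEQ_ignore_initial_segment Glim)
      then show "(\<lambda>n. H q - G (n + n0) q) \<longlonglongrightarrow> H q + Z q" by simp
    qed
    have 5: "(\<lambda>q. H q + Z q) \<in> borel_measurable lborel2" using iH by simp
    from Fatou_bounded[OF 1 GH 3 4 5] show ?thesis by blast
  qed
  have iZ: "integrable lborel2 Z"
    using Bochner_Integration.integrable_diff[OF conjunct1[OF HZ[of 1]] iH] by simp
  have "(\<integral>q. Z q \<partial>lborel2) \<le> \<delta>" if "0 < \<delta>" for \<delta>
    using HZ[OF that] iH iZ by simp
  then have "(\<integral>q. Z q \<partial>lborel2) \<le> 0" by (rule field_le_epsilon[of _ 0, simplified])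
  moreover have "0 \<le> (\<integral>q. Z q \<partial>lborel2)" by (intro integral_nonneg_AE) (simp add: Z0)
  ultimately have "(\<integral>q. Z q \<partial>lborel2) = 0" by simp
  then have "AE q in lborel2. Z q = 0"
    using integral_nonneg_eq_0_iff_AE[OF iZ] Z0 by simp
  then show ?thesis
  proof eventually_elim
    case (elim q)
    obtain x y where q: "q = (x, y)" by (cases q)
    show ?case
    proof (intro impI)
      assume S: "fst q \<in> S" "snd q \<in> S" and zx: "z (fst q) = 0"
      show "\<eta> (fst q) * z (snd q) = 0"
      proof (cases "x = y")
        case True then show ?thesis using zx q by simp
      next
        case False
        then have k: "0 < ker s (x - y) - ker s (x - R y)" using ker_R_le[OF s(1), of x y] S q by simp
        have "\<eta> x * d y + \<eta> y * of_bool (d y = 0) * d x = 0"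
          using elim S zx k by (simp add: q Z_def SS_def d_def)
        moreover have "d x = 0" using zx q by (simp add: d_def)
        ultimately show ?thesis using q by (simp add: d_def)
      qed
    qed
  qed
qed

text \<open>If \<open>u\<close> and \<open>u \<circ> R\<close> differ somewhere on \<open>S\<close>,
  a generic zero of \<open>z\<close> inside some cut-off would, by
  \<open>zero_set_dichotomy\<close>, make \<open>z\<close> vanish almost everywhere on
  \<open>S\<close>, hence everywhere by continuity. So the zeros form a null set.\<close>

lemma strong_maximum_principle:
  assumes le: "\<And>x. x \<in> S \<Longrightarrow> u x \<le> u (R x)"
  shows "(\<forall>x. u (R x) = u x) \<or> (AE x in lborel. x \<in> S \<longrightarrow> u x < u (R x))"
proof (cases "\<forall>x\<in>S. z x = 0")
  case True
  have "u (R x) = u x" for x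
  proof -
    consider "x \<in> S" | "R x \<in> S" | "x \<bullet> e = l" by (fastforce simp: halfspace_def R_inner)
    then show ?thesis
    proof cases
      case 1 then show ?thesis using True by (simp add: z_def)
    next
      case 2
      then have "z (R x) = 0" using True by blast
      then show ?thesis by (simp add: z_anti) (simp add: z_def)
    next
      case 3 then show ?thesis by (simp add: reflect_def)
    qed
  qed
  then show ?thesis by blast
next
  case False
  \<comment> \<open>Lipschitz, zero off the half-space, and positive on its part in the open ball of
    radius \<open>n\<close>; countably many of these exhaust \<open>S\<close>.\<close>
  define \<eta> where "\<eta> = (\<lambda>n x. max 0 (min (x \<bullet> e - l) (real n - norm x)))"
  have S: "\<eta> n x = 0" if "x \<notin> S" for n x using that by (simp add: \<eta>_def halfspace_def)
  have nn: "0 \<le> \<eta> n x" for n x by (simp add: \<eta>_def)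
  have lc: "lip_cs (\<eta> n)" for n
  proof -
    have "1-lipschitz_on UNIV (\<eta> n)"
    proof (rule lipschitz_onI)
      fix x y :: 'a
      have "\<bar>(x - y) \<bullet> e\<bar> \<le> norm (x - y)" using Cauchy_Schwarz_ineq2[of "x - y" e] unit by simp
      then have "\<bar>(x \<bullet> e - l) - (y \<bullet> e - l)\<bar> \<le> norm (x - y)" by (simp add: inner_diff_left)
      moreover have "\<bar>(real n - norm x) - (real n - norm y)\<bar> \<le> norm (x - y)"
        using norm_triangle_ineq3[of x y] by (simp add: abs_minus_commute)
      ultimately show "dist (\<eta> n x) (\<eta> n y) \<le> 1 * dist x y"
        unfolding \<eta>_def dist_norm by (auto simp: max_def min_def abs_le_iff)
    qed simp
    moreover have "{x. \<eta> n x \<noteq> 0} \<subseteq> cball 0 (real n)" by (auto simp: \<eta>_def max_def min_def split: if_splits)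
    ultimately show ?thesis unfolding lip_cs_def using bounded_subset[OF bounded_cball] by blast
  qed
  have "AE x in lborel. x \<in> S \<longrightarrow> z x = 0 \<longrightarrow> \<eta> n x = 0" for n
  proof -
    have "AE x in lborel. AE y in lborel. x \<in> S \<longrightarrow> y \<in> S \<longrightarrow> z x = 0 \<longrightarrow> \<eta> n x * z y = 0"
      using lborel_pair.AE_pair[OF zero_set_dichotomy[OF le lc nn S]] by simp
    then show ?thesis
    proof eventually_elim
      case (elim x)
      show ?case
      proof (intro impI, rule ccontr)
        assume x: "x \<in> S" "z x = 0" "\<eta> n x \<noteq> 0"
        from elim have ae: "AE y in lborel. y \<in> S \<longrightarrow> z y = 0" by eventually_elim (use x in auto)
        have "z y = 0" if "y \<in> S" for y by (rule open_AE_closed[OF S_open z_continuous ae that])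
        with False show False by blast
      qed
    qed
  qed
  then have "AE x in lborel. \<forall>n. x \<in> S \<longrightarrow> z x = 0 \<longrightarrow> \<eta> n x = 0" by (subst AE_all_countable) blast
  then have "AE x in lborel. x \<in> S \<longrightarrow> u x < u (R x)"
  proof eventually_elim
    case (elim x)
    show ?case
    proof
      assume x: "x \<in> S"
      obtain n where "norm x < real n" using reals_Archimedean2 by blast
      then have "\<eta> n x \<noteq> 0" using x by (simp add: \<eta>_def halfspace_def max_def min_def)
      then have "z x \<noteq> 0" using elim x by blast
      then show "u x < u (R x)" using le[OF x] by (simp add: z_def)
    qed
  qed
  then show ?thesis by blast
qed

end

section \<open>Critical planes and radial symmetry\<close>

context continuous_solution
begin

lemma reflected: "norm e = 1 \<Longrightarrow> reflected_solution s p q C r u e"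
  by (intro reflected_solution.intro continuous_solution_axioms reflection.intro)

lemma integrable_indicator_powr:
  assumes "A \<in> sets borel"
  shows "integrable lborel (\<lambda>y. indicator A y * u y powr r)"
  using integrable_mult_indicator[OF _ u_int, of A] assms by simp

text \<open>By uniform continuity a value \<open>\<epsilon>\<close> at \<open>x\<close> forces
  \<open>u > \<epsilon> / 2\<close> on a ball of fixed radius, hence a fixed amount \<open>c\<close>
  of the integral of \<open>u powr r\<close>, which the tail cannot provide.\<close>

lemma vanishes:
  assumes \<epsilon>: "0 < \<epsilon>"
  shows "\<exists>B. \<forall>x. B < norm x \<longrightarrow> u x < \<epsilon>"
proof -
  obtain \<delta> where \<delta>: "0 < \<delta>" "\<And>x y. dist y x < \<delta> \<Longrightarrow> dist (u y) (u x) < \<epsilon> / 2"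
    using u_cont \<epsilon> unfolding uniformly_continuous_on_def by (metis UNIV_I half_gt_zero)
  define c where "c = (\<epsilon> / 2) powr r * measure lborel (ball (0::'a) \<delta>)"
  have c: "0 < c" using \<epsilon> \<delta>(1) by (simp add: c_def)
  obtain n :: nat where n: "(\<integral>y. indicator (- cball 0 (real n)) y * u y powr r \<partial>lborel) < c"
    using integral_tail_small[OF u_int c] by blast
  have "u x < \<epsilon>" if x: "real n + \<delta> < norm x" for x
  proof (rule ccontr)
    assume "\<not> u x < \<epsilon>"
    have "c = (\<integral>y. (\<epsilon> / 2) powr r * indicator (ball x \<delta>) y \<partial>lborel)"
      using \<delta>(1) by (simp add: c_def content_ball)
    also have "\<dots> \<le> (\<integral>y. indicator (- cball 0 (real n)) y * u y powr r \<partial>lborel)"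
    proof (rule integral_mono)
      show "integrable lborel (\<lambda>y. (\<epsilon> / 2) powr r * indicator (ball x \<delta>) y :: real)"
        using emeasure_bounded_finite[OF bounded_ball[of x \<delta>]] by (intro integrable_mult_right integrable_real_indicator) auto
      show "integrable lborel (\<lambda>y. indicator (- cball 0 (real n)) y * u y powr r)"
        by (rule integrable_indicator_powr) measurable
      fix y
      show "(\<epsilon> / 2) powr r * indicator (ball x \<delta>) y \<le> indicator (- cball 0 (real n)) y * u y powr r"
      proof (cases "y \<in> ball x \<delta>")
        case True
        then have d: "dist y x < \<delta>" by (simp add: dist_commute)
        then have "\<bar>u y - u x\<bar> < \<epsilon> / 2" using \<delta>(2) by (simp add: dist_real_def)
        then have "\<epsilon> / 2 \<le> u y" using \<open>\<not> u x < \<epsilon>\<close> by linarith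
        then have "(\<epsilon> / 2) powr r \<le> u y powr r" using \<epsilon> r by (intro powr_mono2) auto
        moreover have "real n < norm y" using x d norm_triangle_ineq2[of x y] by (simp add: dist_norm norm_minus_commute)
        ultimately show ?thesis using True by simp
      qed simp
    qed
    also note n
    finally show False by simp
  qed
  then show ?thesis by blast
qed

text \<open>Iterating the period would carry a positive value to infinity, where \<open>u\<close>
  tends to zero. This yields uniqueness of the symmetry plane in each direction.\<close>

lemma not_periodic:
  assumes "t \<noteq> 0"
  shows "\<not> (\<forall>x. u (x + t) = u x)"
proof
  assume per: "\<forall>x. u (x + t) = u x"
  obtain x0 where x0: "0 < u x0" using u_nonzero by blast
  have it: "u (x0 + real n *\<^sub>R t) = u x0" for n
  proof (induction n)
    case (Suc n)
    have "x0 + real (Suc n) *\<^sub>R t = (x0 + real n *\<^sub>R t) + t" by (simp add: scaleR_left_distrib)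
    then have "u (x0 + real (Suc n) *\<^sub>R t) = u ((x0 + real n *\<^sub>R t) + t)" by (simp only:)
    also have "\<dots> = u (x0 + real n *\<^sub>R t)" by (rule per[rule_format])
    finally show ?case using Suc by simp
  qed simp
  obtain B where B: "\<And>x. B < norm x \<Longrightarrow> u x < u x0" using vanishes[OF x0] by blast
  obtain n where n: "B + norm x0 < real n * norm t" using reals_Archimedean3 assms by (metis zero_less_norm_iff)
  have "norm (real n *\<^sub>R t) \<le> norm (x0 + real n *\<^sub>R t) + norm x0"
    using norm_triangle_ineq4[of "x0 + real n *\<^sub>R t" x0] by simp
  then have "B < norm (x0 + real n *\<^sub>R t)" using n by simp
  from B[OF this] it[of n] show False by simp
qed

definition below :: "'a \<Rightarrow> real \<Rightarrow> bool" where
  "below e l \<longleftrightarrow> (\<forall>x. l < x \<bullet> e \<longrightarrow> u x \<le> u (reflect e l x))"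

lemma belowI_small:
  assumes e: "norm e = 1"
    and "(\<integral>x. indicator {x\<in>halfspace e l. u (reflect e l x) < u x} x * u x powr r \<partial>lborel) < small_const"
  shows "below e l"
  using reflected_solution.reflection_le_of_small[OF reflected[OF e] assms(2)]
  by (simp add: below_def halfspace_def)

lemma bad_set_measurable:
  assumes "norm e = 1"
  shows "{x\<in>halfspace e l. u (reflect e l x) < u x} \<in> sets borel"
proof -
  interpret reflected_solution s p q C r u e l by (rule reflected[OF assms])
  show ?thesis by measurable
qed

text \<open>Far out the half-space meets only the tail of the integral of \<open>u powr r\<close>,
  so the smallness condition holds whatever the bad set is.\<close>

lemma below_eventually:
  assumes e: "norm e = 1"
  shows "\<exists>l0. \<forall>l\<ge>l0. below e l"
proof -
  obtain n :: nat where n: "(\<integral>y. indicator (- cball 0 (real n)) y * u y powr r \<partial>lborel) < small_const"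
    using integral_tail_small[OF u_int small_const_pos] by blast
  have "below e l" if l: "real n \<le> l" for l
  proof (rule belowI_small[OF e])
    have "(\<integral>x. indicator {x\<in>halfspace e l. u (reflect e l x) < u x} x * u x powr r \<partial>lborel)
      \<le> (\<integral>y. indicator (- cball 0 (real n)) y * u y powr r \<partial>lborel)"
    proof (rule integral_mono)
      show "integrable lborel (\<lambda>x. indicator {x\<in>halfspace e l. u (reflect e l x) < u x} x * u x powr r)"
        by (rule integrable_indicator_powr[OF bad_set_measurable[OF e]])
      show "integrable lborel (\<lambda>y. indicator (- cball 0 (real n)) y * u y powr r)"
        by (rule integrable_indicator_powr) measurable
      fix x
      have "l < x \<bullet> e \<Longrightarrow> real n < norm x" using norm_cauchy_schwarz[of x e] e l by simp
      then show "indicator {x\<in>halfspace e l. u (reflect e l x) < u x} x * u x powr r \<le> indicator (- cball 0 (real n)) x * u x powr r"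
        by (auto simp: indicator_def halfspace_def)
    qed
    with n show "(\<integral>x. indicator {x\<in>halfspace e l. u (reflect e l x) < u x} x * u x powr r \<partial>lborel) < small_const" by simp
  qed
  then show ?thesis by blast
qed

text \<open>A fixed point with positive value is reflected arbitrarily far away as \<open>l\<close>
  decreases, and there \<open>u\<close> is smaller.\<close>

lemma not_always_below:
  assumes e: "norm e = 1"
  shows "\<exists>B. \<forall>l<B. \<not> below e l"
proof -
  obtain x where x: "0 < u x" using u_nonzero by blast
  obtain B where B: "\<And>y. B < norm y \<Longrightarrow> u y < u x" using vanishes[OF x] by blast
  have "\<not> below e l" if l: "l < - (\<bar>B\<bar> + \<bar>x \<bullet> e\<bar>)" for l
  proof
    assume b: "below e l"
    interpret reflection e l by standard (rule e)
    have "l < x \<bullet> e" using l by linarith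
    then have "u x \<le> u (reflect e l x)" using b by (simp add: below_def)
    moreover have "\<bar>reflect e l x \<bullet> e\<bar> \<le> norm (reflect e l x)" using Cauchy_Schwarz_ineq2[of "reflect e l x" e] e by simp
    then have "\<bar>2 * l - x \<bullet> e\<bar> \<le> norm (reflect e l x)" unfolding R_inner .
    then have "B < norm (reflect e l x)" using l by linarith
    ultimately show False using B by fastforce
  qed
  then show ?thesis by blast
qed

lemma reflect_continuous_param: "(\<lambda>n. l n) \<longlonglongrightarrow> l0 \<Longrightarrow> (\<lambda>n. u (reflect e (l n) x)) \<longlonglongrightarrow> u (reflect e l0 x)"
proof -
  assume l: "(\<lambda>n. l n) \<longlonglongrightarrow> l0"
  have "(\<lambda>n. reflect e (l n) x) \<longlonglongrightarrow> reflect e l0 x" unfolding reflect_def by (intro tendsto_intros l)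
  then show ?thesis using continuous by (auto intro: continuous_on_tendsto_compose)
qed

lemma critical_plane:
  assumes e: "norm e = 1"
  shows "\<exists>l. (\<forall>x. u (reflect e l x) = u x) \<and> (\<forall>m\<ge>l. below e m)"
proof -
  define \<Lambda> where "\<Lambda> = {l. \<forall>m\<ge>l. below e m}"
  have ne: "\<Lambda> \<noteq> {}" using below_eventually[OF e] by (auto simp: \<Lambda>_def)
  obtain B where B: "\<And>l. l < B \<Longrightarrow> \<not> below e l" using not_always_below[OF e] by blast
  have bb: "bdd_below \<Lambda>"
  proof (rule bdd_belowI)
    fix l assume "l \<in> \<Lambda>"
    then have "below e l" by (simp add: \<Lambda>_def)
    then show "B \<le> l" using B by force
  qed
  define l0 where "l0 = Inf \<Lambda>"
  have above: "below e m" if m: "l0 < m" for m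
  proof -
    obtain l where "l \<in> \<Lambda>" "l < m" using cInf_lessD[OF ne, of m] m unfolding l0_def by blast
    then show ?thesis by (simp add: \<Lambda>_def)
  qed
  have at: "below e l0"
    unfolding below_def
  proof (intro allI impI)
    fix x assume x: "l0 < x \<bullet> e"
    have l: "(\<lambda>n. l0 + 1 / real (Suc n)) \<longlonglongrightarrow> l0"
      using tendsto_add[OF tendsto_const[of l0] LIMSEQ_inverse_real_of_nat] by (simp add: inverse_eq_divide)
    have "\<forall>\<^sub>F n in sequentially. l0 + 1 / real (Suc n) < x \<bullet> e" by (rule order_tendstoD(2)[OF l x])
    then have "\<forall>\<^sub>F n in sequentially. u x \<le> u (reflect e (l0 + 1 / real (Suc n)) x)"
    proof eventually_elim
      case (elim n)
      have "below e (l0 + 1 / real (Suc n))" by (rule above) simp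
      with elim show ?case by (simp add: below_def)
    qed
    then show "u x \<le> u (reflect e l0 x)"
      by (rule tendsto_lowerbound[OF reflect_continuous_param[OF l]]) simp
  qed
  interpret reflected_solution s p q C r u e l0 by (rule reflected[OF e])
  have "\<forall>x. u (reflect e l0 x) = u x"
  proof (rule ccontr)
    assume not_sym: "\<not> ?thesis"
    have "u x \<le> u (R x)" if "x \<in> S" for x using at that by (simp add: below_def halfspace_def)
    from strong_maximum_principle[OF this] not_sym
    have strict: "AE x in lborel. x \<in> S \<longrightarrow> u x < u (R x)" by blast
    \<comment> \<open>Otherwise \<open>\<Lambda>\<close> would contain a number below its
      infimum.\<close>
    have "\<exists>l. l0 - 1 / real (Suc n) < l \<and> l < l0 \<and> \<not> below e l" for n
    proof (rule ccontr)
      assume no: "\<not> ?thesis"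
      define l1 where "l1 = l0 - 1 / real (Suc n) / 2"
      have "below e m" if "l1 \<le> m" for m
      proof (cases "m < l0")
        case True
        define \<epsilon> where "\<epsilon> = 1 / real (Suc n)"
        have "0 < \<epsilon>" by (simp add: \<epsilon>_def)
        then have "l0 - \<epsilon> < m" using that unfolding l1_def \<epsilon>_def[symmetric] by linarith
        then have "l0 - 1 / real (Suc n) < m" by (simp only: \<epsilon>_def)
        then show ?thesis using no True by blast
      next
        case False
        then show ?thesis using at above by (cases "m = l0") auto
      qed
      then have "l1 \<in> \<Lambda>" by (simp add: \<Lambda>_def)
      then have "l0 \<le> l1" unfolding l0_def by (rule cInf_lower[OF _ bb])
      then show False by (simp add: l1_def)
    qed
    then have "\<exists>l. \<forall>n. l0 - 1 / real (Suc n) < l n \<and> l n < l0 \<and> \<not> below e (l n)" by (intro choice) blast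
    then obtain l where l: "\<And>n. l0 - 1 / real (Suc n) < l n" "\<And>n. l n < l0" "\<And>n. \<not> below e (l n)" by blast
    have lim: "l \<longlonglongrightarrow> l0"
    proof (rule tendsto_sandwich)
      show "(\<lambda>n. l0 - 1 / real (Suc n)) \<longlonglongrightarrow> l0"
        using tendsto_diff[OF tendsto_const[of l0] LIMSEQ_inverse_real_of_nat] by (simp add: inverse_eq_divide)
      show "(\<lambda>n. l0) \<longlonglongrightarrow> l0" by (rule tendsto_const)
    qed (use l in \<open>auto intro: always_eventually less_imp_le\<close>)
    define P where "P = (\<lambda>n. {x\<in>halfspace e (l n). u (reflect e (l n) x) < u x})"
    have Pm [measurable]: "P n \<in> sets borel" for n unfolding P_def by (rule bad_set_measurable[OF e])
    have ge: "small_const \<le> (\<integral>x. indicator (P n) x * u x powr r \<partial>lborel)" for n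
    proof (rule ccontr)
      assume "\<not> ?thesis"
      then have "(\<integral>x. indicator (P n) x * u x powr r \<partial>lborel) < small_const" by simp
      then have "below e (l n)" unfolding P_def by (rule belowI_small[OF e])
      with l(3) show False by blast
    qed
    \<comment> \<open>Almost every point eventually leaves the bad sets: on \<open>S\<close> the
      strict inequality persists for nearby planes, on the other side the point drops out of the
      half-space. The integrals thus tend to zero, although each is at least
      \<open>small_const\<close>.\<close>
    have "(\<lambda>n. \<integral>x. indicator (P n) x * u x powr r \<partial>lborel) \<longlonglongrightarrow> (\<integral>x. 0 \<partial>(lborel :: 'a measure))"
    proof (rule integral_dominated_convergence[where w="\<lambda>x. u x powr r"])
      show "AE x in lborel. (\<lambda>n. indicator (P n) x * u x powr r) \<longlonglongrightarrow> 0"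
        using strict AE_S_split
      proof eventually_elim
        case (elim x)
        have "\<forall>\<^sub>F n in sequentially. x \<notin> P n"
        proof (cases "x \<in> S")
          case True
          then have "u x < u (reflect e l0 x)" using elim by blast
          from order_tendstoD(1)[OF reflect_continuous_param[OF lim] this]
          show ?thesis by eventually_elim (simp add: P_def)
        next
          case False
          then have "reflect e l0 x \<in> S" using elim by (auto simp: indicator_def split: if_splits)
          then have "x \<bullet> e < l0" by (simp add: halfspace_def R_inner)
          from order_tendstoD(1)[OF lim this]
          show ?thesis by eventually_elim (simp add: P_def halfspace_def)
        qed
        then have "\<forall>\<^sub>F n in sequentially. indicator (P n) x * u x powr r = 0"
          by eventually_elim simp
        then show ?case by (rule tendsto_eventually)
      qed
    qed (auto simp: u_int indicator_def)
    then have "(\<lambda>n. \<integral>x. indicator (P n) x * u x powr r \<partial>lborel) \<longlonglongrightarrow> 0" by simp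
    then have "small_const \<le> 0" by (rule LIMSEQ_le_const) (use ge in blast)
    with small_const_pos show False by simp
  qed
  then show ?thesis using at above by (metis order_le_less)
qed

section \<open>From symmetry planes to a center\<close>

text \<open>The composition of two parallel reflections is a translation by
  \<open>2 * (m - l)\<close> in direction \<open>e\<close>, which \<open>not_periodic\<close>
  forbids unless it is trivial.\<close>

lemma two_planes:
  assumes e: "norm e = 1" and "\<And>x. u (reflect e l x) = u x" "\<And>x. u (reflect e m x) = u x"
  shows "l = m"
proof (rule ccontr)
  assume "l \<noteq> m"
  interpret reflection e l by standard (rule e)
  have "u (x + (2 * (m - l)) *\<^sub>R e) = u x" for x
  proof -
    have "reflect e m (reflect e l x) = x + (2 * (m - l)) *\<^sub>R e"
    proof -
      have "reflect e m (reflect e l x) = x - ((2 * (x \<bullet> e - l)) *\<^sub>R e + (2 * (2 * l - x \<bullet> e - m)) *\<^sub>R e)"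
        unfolding reflect_def[of e m] R_inner by (simp only: reflect_def diff_diff_eq)
      also have "(2 * (x \<bullet> e - l)) *\<^sub>R e + (2 * (2 * l - x \<bullet> e - m)) *\<^sub>R e = (- (2 * (m - l))) *\<^sub>R e"
        unfolding scaleR_left_distrib[symmetric] by (simp add: algebra_simps)
      finally show ?thesis by (simp only: scaleR_minus_left diff_minus_eq_add)
    qed
    then show ?thesis using assms(2,3) by metis
  qed
  moreover have "(2 * (m - l)) *\<^sub>R e \<noteq> 0" using \<open>l \<noteq> m\<close> e by auto
  ultimately show False using not_periodic by blast
qed

text \<open>The reflections in the coordinate planes through \<open>x0\<close> act on separate
  coordinates, and their composition is the point reflection at \<open>x0\<close>.\<close>

lemma point_symmetry:
  assumes "\<And>b x. b \<in> Basis \<Longrightarrow> u (reflect b (x0 \<bullet> b) x) = u x"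
  shows "u (2 *\<^sub>R x0 - x) = u x"
proof -
  have "u (x + (\<Sum>b\<in>A. (2 * (x0 \<bullet> b - x \<bullet> b)) *\<^sub>R b)) = u x" if "finite A" "A \<subseteq> Basis" for A
    using that
  proof induction
    case (insert b A)
    let ?y = "x + (\<Sum>b\<in>A. (2 * (x0 \<bullet> b - x \<bullet> b)) *\<^sub>R b)"
    have b: "b \<in> Basis" using insert by simp
    have "(\<Sum>b\<in>A. (2 * (x0 \<bullet> b - x \<bullet> b)) *\<^sub>R b) \<bullet> b = 0"
      unfolding inner_sum_left
    proof (rule sum.neutral, rule ballI)
      fix c assume "c \<in> A"
      then have "c \<in> Basis" "c \<noteq> b" using insert by auto
      then show "(2 * (x0 \<bullet> c - x \<bullet> c)) *\<^sub>R c \<bullet> b = 0" using b by (simp add: inner_Basis)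
    qed
    then have "?y \<bullet> b = x \<bullet> b" by (simp add: inner_add_left)
    then have "reflect b (x0 \<bullet> b) ?y = x + (\<Sum>b\<in>insert b A. (2 * (x0 \<bullet> b - x \<bullet> b)) *\<^sub>R b)"
      using insert by (simp add: reflect_def algebra_simps)
    then show ?case using assms[OF b, of ?y] insert by simp
  qed simp
  from this[of Basis]
  have "u (x + (\<Sum>b\<in>Basis. (2 * (x0 \<bullet> b - x \<bullet> b)) *\<^sub>R b)) = u x" by simp
  moreover have "(\<Sum>b\<in>Basis. (2 * (x0 \<bullet> b - x \<bullet> b)) *\<^sub>R b) = 2 *\<^sub>R (x0 - x)"
  proof -
    have "(\<Sum>b\<in>Basis. (2 * (x0 \<bullet> b - x \<bullet> b)) *\<^sub>R b) = (\<Sum>b\<in>Basis. ((2 *\<^sub>R (x0 - x)) \<bullet> b) *\<^sub>R b)"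
      by (simp add: inner_diff_left)
    then show ?thesis by (simp only: euclidean_representation)
  qed
  moreover have "x + 2 *\<^sub>R (x0 - x) = 2 *\<^sub>R x0 - x" by (simp add: scaleR_2)
  ultimately show ?thesis by simp
qed

lemma center_exists:
  obtains x0 where "\<And>e x. norm e = 1 \<Longrightarrow> u (reflect e (x0 \<bullet> e) x) = u x"
    "\<And>e l. norm e = 1 \<Longrightarrow> x0 \<bullet> e \<le> l \<Longrightarrow> below e l"
proof -
  have "\<exists>L. \<forall>e. norm e = 1 \<longrightarrow> (\<forall>x. u (reflect e (L e) x) = u x) \<and> (\<forall>m\<ge>L e. below e m)"
    using critical_plane by (intro choice) blast
  then obtain L where L: "\<And>e x. norm e = 1 \<Longrightarrow> u (reflect e (L e) x) = u x" "\<And>e m. norm e = 1 \<Longrightarrow> L e \<le> m \<Longrightarrow> below e m"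
    by blast
  define x0 where "x0 = (\<Sum>b\<in>Basis. L b *\<^sub>R b)"
  have x0: "x0 \<bullet> b = L b" if "b \<in> Basis" for b using that by (simp add: x0_def)
  have ps: "u (2 *\<^sub>R x0 - x) = u x" for x
    by (rule point_symmetry) (simp add: x0 L(1))
  have Le: "L e = x0 \<bullet> e" if e: "norm e = 1" for e
  proof -
    \<comment> \<open>The point reflection at \<open>x0\<close> carries the critical plane of
      \<open>e\<close> to its mirror plane \<open>l'\<close>, again a symmetry plane. Uniqueness
      forces the two to coincide, so the plane contains \<open>x0\<close>.\<close>
    define l' where "l' = 2 * (x0 \<bullet> e) - L e"
    have "u (reflect e l' x) = u x" for x
    proof -
      have "reflect e l' x = 2 *\<^sub>R x0 - reflect e (L e) (2 *\<^sub>R x0 - x)"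
        by (simp add: reflect_def l'_def inner_diff_left algebra_simps)
      then show ?thesis using ps L(1)[OF e] by metis
    qed
    from two_planes[OF e L(1)[OF e] this] show ?thesis by (simp add: l'_def)
  qed
  show thesis using that[of x0] L Le by metis
qed

lemma radial:
  "\<exists>x0. radially_strictly_decreasing_about x0 u"
proof -
  obtain x0 where sym: "\<And>e x. norm e = 1 \<Longrightarrow> u (reflect e (x0 \<bullet> e) x) = u x"
    and bel: "\<And>e l. norm e = 1 \<Longrightarrow> x0 \<bullet> e \<le> l \<Longrightarrow> below e l" by (rule center_exists) (rule that)
  \<comment> \<open>The plane used is the perpendicular bisector of \<open>x\<close> and
    \<open>y\<close>. The point \<open>y\<close> being no farther from \<open>x0\<close> means
    exactly that \<open>x0\<close> is not on the side of \<open>x\<close>, so the plane is in the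
    range where the comparison holds.\<close>
  have mono: "u x \<le> u y" if le: "norm (y - x0) \<le> norm (x - x0)" for x y
  proof (cases "x = y")
    case False
    define d where "d = norm (x - y)"
    have d: "0 < d" using False by (simp add: d_def)
    define e where "e = (1 / d) *\<^sub>R (x - y)"
    have e: "norm e = 1" using d by (simp add: e_def d_def)
    have xy: "x - y = d *\<^sub>R e" using d by (simp add: e_def)
    have de: "(x - y) \<bullet> e = d" unfolding xy using e by (simp add: norm_eq_1)
    define l where "l = ((x + y) \<bullet> e) / 2"
    have "(norm (y - x0))\<^sup>2 \<le> (norm (x - x0))\<^sup>2" using le by (simp add: power_mono)
    moreover have "(norm (x - x0))\<^sup>2 - (norm (y - x0))\<^sup>2 = (x - y) \<bullet> (x + y - 2 *\<^sub>R x0)"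
      unfolding power2_norm_eq_inner by (simp add: inner_diff_left inner_diff_right inner_add_right inner_commute scaleR_2)
    moreover have "(x - y) \<bullet> (x + y - 2 *\<^sub>R x0) = d * (2 * (l - x0 \<bullet> e))"
      unfolding xy by (simp add: l_def inner_diff_right inner_commute[of e] algebra_simps)
    ultimately have "0 \<le> d * (2 * (l - x0 \<bullet> e))" by linarith
    then have "x0 \<bullet> e \<le> l" using d by (simp add: zero_le_mult_iff)
    then have "below e l" by (rule bel[OF e])
    moreover have xl: "2 * (x \<bullet> e - l) = d" using de by (simp add: l_def inner_diff_left inner_add_left field_simps)
    then have "l < x \<bullet> e" using d by simp
    moreover have "reflect e l x = y" unfolding reflect_def xl xy[symmetric] by simp
    ultimately show ?thesis by (auto simp: below_def)
  qed simp
  obtain b :: 'a where b: "b \<in> Basis" using nonempty_Basis by blast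
  have nb: "norm b = 1" using b by simp
  define g where "g = (\<lambda>\<rho>. u (x0 + \<rho> *\<^sub>R b))"
  have ug: "u x = g (norm (x - x0))" for x
    unfolding g_def by (intro antisym mono) (simp_all add: nb)
  \<comment> \<open>Equality would make \<open>u\<close> constant on a shell. A plane slightly off
    the center maps a ball inside the shell into the shell again, against the strict inequality
    almost everywhere.\<close>
  have "g \<rho>2 < g \<rho>1" if \<rho>: "0 \<le> \<rho>1" "\<rho>1 < \<rho>2" for \<rho>1 \<rho>2
  proof (rule ccontr)
    assume "\<not> ?thesis"
    then have le: "g \<rho>1 \<le> g \<rho>2" by simp
    have const: "u x = g \<rho>1" if "\<rho>1 \<le> norm (x - x0)" "norm (x - x0) \<le> \<rho>2" for x
    proof -
      have "u x \<le> u (x0 + \<rho>1 *\<^sub>R b)" "u (x0 + \<rho>2 *\<^sub>R b) \<le> u x"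
        using that \<rho> by (auto intro!: mono simp: nb)
      then show ?thesis using le unfolding g_def by linarith
    qed
    \<comment> \<open>With one eighth of the thickness, \<open>x\<close> has distance between
      \<open>\<rho>1 + 3 * \<tau>\<close> and \<open>\<rho>1 + 5 * \<tau>\<close> from
      \<open>x0\<close>, and the reflection changes this by at most \<open>2 * \<tau>\<close>; both
      points stay in the shell.\<close>
    define \<tau> where "\<tau> = (\<rho>2 - \<rho>1) / 8"
    have \<tau>: "0 < \<tau>" using \<rho> by (simp add: \<tau>_def)
    have \<tau>8: "8 * \<tau> = \<rho>2 - \<rho>1" by (simp add: \<tau>_def)
    define l where "l = x0 \<bullet> b + \<tau>"
    interpret reflected_solution s p q C r u b l by (rule reflected[OF nb])
    have "u x \<le> u (R x)" if "x \<in> S" for x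
      using bel[OF nb, of l] \<tau> that by (simp add: below_def halfspace_def l_def)
    from strong_maximum_principle[OF this]
    have ae: "AE x in lborel. x \<in> S \<longrightarrow> u x < u (R x)"
    proof
      assume "\<forall>x. u (R x) = u x"
      then have "l = x0 \<bullet> b" using two_planes[OF nb, of l "x0 \<bullet> b"] sym[OF nb] by blast
      then show ?thesis using \<tau> by (simp add: l_def)
    qed
    define c where "c = x0 + (\<rho>1 + 4 * \<tau>) *\<^sub>R b"
    obtain x where x: "x \<in> ball c \<tau>" "x \<in> S \<longrightarrow> u x < u (R x)"
      using null_set_not_ball[OF ae \<tau>] by blast
    have cx: "norm (c - x0) = \<rho>1 + 4 * \<tau>" using \<rho> \<tau> by (simp add: c_def nb)
    have dxc: "norm (x - c) < \<tau>" using x(1) by (simp add: dist_norm norm_minus_commute)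
    have n1: "\<bar>norm (x - x0) - norm (c - x0)\<bar> \<le> norm (x - c)"
      using norm_triangle_ineq3[of "x - x0" "c - x0"] by simp
    have x1: "\<rho>1 + 3 * \<tau> < norm (x - x0)" "norm (x - x0) < \<rho>1 + 5 * \<tau>"
      using n1 dxc unfolding cx by linarith+
    have xS: "x \<in> S"
    proof -
      have "\<bar>(x - c) \<bullet> b\<bar> \<le> norm (x - c)" using Cauchy_Schwarz_ineq2[of "x - c" b] nb by simp
      then have "- \<tau> < (x - c) \<bullet> b" using dxc by linarith
      moreover have "c \<bullet> b = x0 \<bullet> b + \<rho>1 + 4 * \<tau>" using ee by (simp add: c_def inner_add_left)
      ultimately have "x0 \<bullet> b + \<tau> < x \<bullet> b" using \<rho> \<tau> by (simp add: inner_diff_left)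
      then show ?thesis by (simp add: halfspace_def l_def)
    qed
    have Rx0: "norm (R x0 - x0) = 2 * \<tau>"
      using \<tau> by (simp add: reflect_def l_def nb)
    have "norm (R x - x0) = norm (x - R x0)" by (rule norm_R_swap)
    moreover have "\<bar>norm (x - R x0) - norm (x - x0)\<bar> \<le> norm (R x0 - x0)"
      using norm_triangle_ineq3[of "x - R x0" "x - x0"] by (simp add: norm_minus_commute)
    ultimately have "\<rho>1 + \<tau> < norm (R x - x0)" "norm (R x - x0) < \<rho>1 + 7 * \<tau>"
      using x1 unfolding Rx0 by linarith+
    then have "u (R x) = g \<rho>1" using \<tau> \<tau>8 by (intro const; linarith)
    moreover have "u x = g \<rho>1" using x1 \<tau> \<tau>8 by (intro const; linarith)
    ultimately show False using x(2) xS by simp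
  qed
  then have "strict_antimono_on {0..} g" by (auto simp: monotone_on_def)
  with ug show ?thesis unfolding radially_strictly_decreasing_about_def by blast
qed

end

theorem theorem5p1:
  fixes s p q :: real and u :: "'a::euclidean_space \<Rightarrow> real"
  assumes "0 < s" and "s < 1"
    and "real DIM('a) > 2 * s"
    and "p \<ge> crit_exp DIM('a) s - 1"
    and "q > (p - 1) * (real DIM('a) / (2 * s)) - 1"
    and "weak_solution s p q u"
  shows "\<exists>v. continuous_on UNIV v \<and> (AE x in lborel. v x = u x) \<and>
             (\<exists>x0. radially_strictly_decreasing_about x0 v)"
proof -
  note s = assms(1,2,3)
  define r where "r = crit_exp DIM('a) s"
  define C where "C = frac_const DIM('a) s / 2"
  have r: "2 < r" unfolding r_def using crit_exp_gt_2 s by blast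
  have C: "0 < C" unfolding C_def using frac_const_pos[OF s(1,2)] by simp
  have p: "r - 1 \<le> p" using assms(4) by (simp add: r_def)
  \<comment> \<open>With \<open>r - 2 = 4 * s / (N - 2 * s)\<close>, the bound
    \<open>p \<ge> r - 1\<close> is equivalent to \<open>p + 1 \<le> (p - 1) * N / (2 * s)\<close>,
    and the condition on \<open>q\<close> then gives \<open>q > p\<close>.\<close>
  have pq: "p < q"
  proof -
    define N where "N = real DIM('a)"
    have N: "2 * s < N" using s by (simp add: N_def)
    have "r - 2 = 4 * s / (N - 2 * s)" using N s by (simp add: r_def crit_exp_def N_def field_simps)
    then have "4 * s / (N - 2 * s) \<le> p - 1" using p by linarith
    then have "4 * s \<le> (p - 1) * (N - 2 * s)" using N by (simp add: pos_divide_le_eq)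
    then have "2 * s * (p + 1) \<le> (p - 1) * N" by (simp add: algebra_simps)
    then have "p + 1 \<le> (p - 1) * N / (2 * s)" using s by (simp add: pos_le_divide_eq mult.commute)
    then show ?thesis using assms(5) by (simp add: N_def)
  qed
  have dH: "dotH s u" and pos: "\<And>x. 0 < u x" using assms(6) by (auto simp: weak_solution_def)
  have fe: "fin_energy s u" and ir: "integrable lborel (\<lambda>x. \<bar>u x\<bar> powr r)" and la: "lip_approx s u"
    using dotH_lip_approx[OF s dH] by (auto simp: r_def)
  have um [measurable]: "u \<in> borel_measurable borel" using fe by (rule fin_energy_measurable)
  have le1: "AE x in lborel. u x \<le> 1"
    using weak_solution_le_1[OF s _ pq assms(6)] p by (simp add: r_def)
  have eq: "C * form s u \<phi> = (\<integral>x. (u x powr p - u x powr q) * \<phi> x \<partial>lborel)" if \<phi>: "lip_cs \<phi>" for \<phi>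
  proof -
    have "dotH s \<phi>" by (rule lip_cs_dotH[OF s \<phi>])
    then have "integrable lborel (\<lambda>x. u x powr p * \<phi> x)" "integrable lborel (\<lambda>x. u x powr q * \<phi> x)"
      "C * form s u \<phi> = (\<integral>x. u x powr p * \<phi> x \<partial>lborel) - (\<integral>x. u x powr q * \<phi> x \<partial>lborel)"
      using assms(6) by (auto simp: weak_solution_def frac_form_eq C_def)
    then show ?thesis by (simp add: left_diff_distrib)
  qed
  \<comment> \<open>Used twice: for a truncated copy of \<open>u\<close> and for its continuous
    representative.\<close>
  have transfer: "fin_energy s w" "lip_approx s w" "integrable lborel (\<lambda>x. \<bar>w x\<bar> powr r)"
    "\<And>\<phi>. lip_cs \<phi> \<Longrightarrow> C * form s w \<phi> = (\<integral>x. (w x powr p - w x powr q) * \<phi> x \<partial>lborel)"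
    if [measurable]: "w \<in> borel_measurable borel" and ae: "AE x in lborel. w x = u x" for w
  proof -
    show "fin_energy s w" using form_cong_AE(2)[OF that(1) um um ae] fe by simp
    show "lip_approx s w"
    proof -
      obtain \<psi> A where \<psi>: "\<forall>n::nat. lip_cs (\<psi> n)" "\<forall>n. form s (\<psi> n) (\<psi> n) \<le> A"
        "AE x in lborel. (\<lambda>n. \<psi> n x) \<longlonglongrightarrow> u x" using la unfolding lip_approx_def by blast
      have "AE x in lborel. (\<lambda>n. \<psi> n x) \<longlonglongrightarrow> w x" using \<psi>(3) ae by eventually_elim simp
      then show ?thesis unfolding lip_approx_def using that(1) \<psi>(1,2) by blast
    qed
    show "integrable lborel (\<lambda>x. \<bar>w x\<bar> powr r)"
      by (rule integrable_cong_AE_imp[OF ir]) (use ae in \<open>auto elim: eventually_mono\<close>)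
    show "C * form s w \<phi> = (\<integral>x. (w x powr p - w x powr q) * \<phi> x \<partial>lborel)" if "lip_cs \<phi>" for \<phi>
    proof -
      have [measurable]: "\<phi> \<in> borel_measurable borel" by (rule lip_cs_measurable[OF that])
      have "form s w \<phi> = form s u \<phi>" by (rule form_cong_AE(1)[OF _ _ _ ae]) measurable
      moreover have "(\<integral>x. (w x powr p - w x powr q) * \<phi> x \<partial>lborel) = (\<integral>x. (u x powr p - u x powr q) * \<phi> x \<partial>lborel)"
        by (rule integral_cong_AE) (use ae in \<open>auto elim: eventually_mono\<close>)
      ultimately show ?thesis using eq[OF that] by simp
    qed
  qed
  \<comment> \<open>The bound by \<open>1\<close> is known almost everywhere only, while
    \<open>bounded_solution\<close> asks for it at every point.\<close>
  define w where "w = (\<lambda>x. min 1 (u x))"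
  have wm [measurable]: "w \<in> borel_measurable borel" by (simp add: w_def)
  have wae: "AE x in lborel. w x = u x" using le1 by eventually_elim (simp add: w_def)
  have w01: "0 \<le> w x" "w x \<le> 1" for x using pos[of x] by (simp_all add: w_def)
  note tw = transfer[OF wm wae]
  interpret w: bounded_solution s C r w "\<lambda>x. w x powr p - w x powr q"
  proof
    show "integrable lborel (\<lambda>x. w x powr r)" using tw(3) w01 by simp
    show "\<bar>w x powr p - w x powr q\<bar> \<le> 1" for x
    proof -
      have "0 \<le> w x powr p - w x powr q" "w x powr p - w x powr q \<le> w x powr (r - 1)"
        using powr_diff_bounds[of "w x" r p q] w01 r p pq by auto
      moreover have "w x powr (r - 1) \<le> 1" using w01 r by (intro powr_le1) auto
      ultimately show ?thesis by linarith
    qed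
  qed (use s C r w01 tw in auto)
  obtain v where v: "uniformly_continuous_on UNIV v" "AE x in lborel. v x = w x"
    by (rule w.hoelder_continuous_representative) (rule that)
  have cv: "continuous_on UNIV v" using v(1) by (rule uniformly_continuous_imp_continuous)
  have vm: "v \<in> borel_measurable borel" using cv by (rule borel_measurable_continuous_onI)
  have vae: "AE x in lborel. v x = u x" using v(2) wae by eventually_elim simp
  note tv = transfer[OF vm vae]
  \<comment> \<open>The pointwise bounds are phrased as the vanishing of continuous functions, so
    that almost everywhere becomes everywhere.\<close>
  have v01: "0 \<le> v x" "v x \<le> 1" for x
  proof -
    have 1: "AE x in lborel. x \<in> UNIV \<longrightarrow> min 0 (v x) = 0" "AE x in lborel. x \<in> UNIV \<longrightarrow> max 1 (v x) - 1 = 0"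
      using v(2) by (eventually_elim, use w01 in auto)+
    have 2: "continuous_on UNIV (\<lambda>x. min 0 (v x))" "continuous_on UNIV (\<lambda>x. max 1 (v x) - 1)"
      by (intro continuous_intros cv)+
    have "min 0 (v x) = 0" "max 1 (v x) - 1 = 0"
      using open_AE_closed[OF open_UNIV 2(1) 1(1), of x] open_AE_closed[OF open_UNIV 2(2) 1(2), of x] by auto
    then show "0 \<le> v x" "v x \<le> 1" by linarith+
  qed
  have "\<exists>x. 0 < v x"
  proof -
    from null_set_not_ball[OF vae, of 1 0] obtain x where "v x = u x" by auto
    then show ?thesis using pos[of x] by (intro exI[of _ x]) simp
  qed
  then interpret v: continuous_solution s p q C r v
    by unfold_locales (use s C p pq v(1) v01 tv r_def in auto)
  show ?thesis using cv vae v.radial by blast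
qed

end
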